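(* Suppose $G_{t'}\sim\mathcal G(n,p(t'))$ for all $t'\in\mathcal T$ with $p_{\min}:=\min_{t'\in\mathcal T}p(t')>0$, and let $b_{\max}=\max_{t'\in[0,1]}b(t')$ and $\gamma_n(t)=1+\frac{b^{5/2}(t)}{\sqrt{\log n}}\max\left\{b^2(t),\frac{\log n}{\sqrt n}\right\}$. Let $t\in[0,1]$ and suppose $n\gtrsim\log n$. Choose $$\delta=\min\left\{\frac{(\gamma_n(t))^{2/3}(\log n)^{1/3}}{(2M)^{2/3}\,n\,b^{7/3}(t)\,(Lp_{\min})^{1/3}}\,T^{2/3},\;T\right\}\qquad\text{and}\qquad d_\delta(t)=3np_\delta(t).$$ If $T$ is such that $\delta\gtrsim\frac{\log n}{p_{\min}}$ and $$\min\left\{\left(\frac{(\gamma_n(t))^{2/3}(M\log n)^{1/3}}{2^{2/3}\,n\,b^{7/3}(t)(Lp_{\min})^{1/3}}\right)\frac1{T^{1/3}},\;M\right\}+\sqrt{\frac{\log n}{n}}\lesssim\frac1{b^{5/2}(t)},$$ then with probability at least $1-O(n^{-9})$, $$\frac{\|\hat\pi(t)-\pi^*(t)\|_\infty}{\|\pi^*(t)\|_\infty}\lesssim\left(\frac{b_{\max}}{1-b_{\max}\sqrt{\frac{\log n}{n}}}\right)\Bigg[\gamma_n(t)\sqrt{\frac{\log n}{Lnp_{\min}}}\max\left\{\frac{(2M)^{1/3}n^{1/2}b^{7/6}(t)(Lp_{\min})^{1/6}}{\gamma_n^{1/3}(t)(\log n)^{1/6}T^{1/3}},\frac1{\sqrt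 T}\right\}$$ $$\qquad\qquad+Mn\,b^{7/2}(t)\min\left\{\frac{\gamma_n^{2/3}(t)(\log n)^{1/3}}{(2M)^{2/3}\,n\,b^{7/3}(t)(Lp_{\min})^{1/3}T^{1/3}},1\right\}\Bigg].$$
   Context: Dynamic BTL model. Let $n\ge 2$, $T\ge 1$, $L\ge 1$ be integers, $[n]=\{1,\dots,n\}$. For each $t\in[0,1]$ let $w_t^*\in\mathbb R^n$ have strictly positive entries $w^*_{t,i}$, and for $i\ne j$ put $y^*_{ij}(t)=\frac{w^*_{t,j}}{w^*_{t,i}+w^*_{t,j}}$. Smoothness assumption: there is $M\ge0$ with $|y^*_{ij}(t)-y^*_{ij}(t')|\le M|t-t'|$ for all $t,t'\in[0,1]$ and $i\ne j$. Grid: $\mathcal T=\{i/T: i=0,\dots,T\}$. For each $t'\in\mathcal T$ there is an undirected comparison graph $G_{t'}=([n],\mathcal E_{t'})$. Given the graphs, for each $t'\in\mathcal T$, $\{i,j\}\in\mathcal E_{t'}$ and $l\in\{1,\dots,L\}$ one observes $y^{(l)}_{ij}(t')\in\{0,1\}$ with $\mathbb P(y^{(l)}_{ij}(t')=1)=y^*_{ij}(t')$ (the value 1 means $j$ beats $i$), with $y^{(l)}_{ji}(t')=1-y^{(l)}_{ij}(t')$, all outcomes being independent across unordered pairs, times $t'$ and indices $l$. Put $y_{ij}(t')=\frac1L\sum_{l=1}^L y^{(l)}_{ij}(t')$. Neighborhood and union graph. For $t\in[0,1]$, $\delta\in[\frac12,T]$: $\mathcal N_\delta(t)=\{t'\in\mathcal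 T: |t-t'|\le \delta/T\}$; $\mathcal N_{ij,\delta}(t)=\{t'\in\mathcal N_\delta(t): \{i,j\}\in\mathcal E_{t'}\}$; $\mathcal E_\delta(t)=\bigcup_{t'\in\mathcal N_\delta(t)}\mathcal E_{t'}$. Erdős–Rényi setting. $\mathcal G(n,p)$ is the Erdős–Rényi random graph; the graphs $G_{t'}\sim\mathcal G(n,p(t'))$, $t'\in\mathcal T$, are mutually independent. Put $p_\delta(t)=1-\prod_{t'\in\mathcal N_\delta(t)}(1-p(t'))$. Estimator. With normalization $d_\delta(t)$, define $\hat P(t)\in\mathbb R^{n\times n}$ by $\hat P_{ij}(t)=\frac{1}{d_\delta(t)|\mathcal N_{ij,\delta}(t)|}\sum_{t'\in\mathcal N_{ij,\delta}(t)}y_{ij}(t')$ if $\{i,j\}\in\mathcal E_\delta(t)$, $\hat P_{ij}(t)=0$ for other $i\neq j$, and $\hat P_{ii}(t)=1-\sum_{k\ne i}\hat P_{ik}(t)$. $\hat\pi(t)$ is the stationary distribution (leading left eigenvector, normalized to be a probability vector) of $\hat P(t)$. The target is $\pi^*(t)=w_t^*/\sum_{i=1}^n w^*_{t,i}$, and $b(t)=\max_{i,j\in[n]}w^*_{t,i}/w^*_{t,j}$. Conventions: $a\lesssim c$ (equivalently $c\gtrsim a$) means $a\le Cc$ for an absolute constant $C>0$. Where $\lesssim,\gtrsim$ appear in the hypotheses, the claim is that there exist suitable absolute constants for which the conclusion holds, with an absolute constant in the conclusion. $O(\cdot)$ hides an absolute constant. If $M=0$, quantities with $(2M)^{2/3}$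 in the denominator are read as $+\infty$ (so $\delta=T$).
   Formalization: The formal theorem additionally assumes b_max·sqrt(log n / n) < 1; otherwise the factor b_max/(1 − b_max·sqrt(log n / n)) is negative or undefined and the stated upper bound fails, since the hypotheses control only b(t). *)

theory Defs
  imports "HOL-Probability.Probability"
begin

text \<open>
  Items are the elements of \<open>{1..n}\<close>.  A vector in \<open>\<real>\<^sup>n\<close> is a function
  \<open>nat \<Rightarrow> real\<close> and an \<open>n \<times> n\<close> matrix a function \<open>nat \<Rightarrow> nat \<Rightarrow> real\<close>, of which only the
  values at indices in \<open>{1..n}\<close> matter.  An undirected graph is its set of edges \<open>{i, j}\<close>,
  and a family of graphs is indexed by the grid times themselves.
\<close>

subsection \<open>The dynamic BTL model\<close>

definition grid :: "nat \<Rightarrow> real set" where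
  "grid T = (\<lambda>i. real i / real T) ` {0..T}"

text \<open>\<open>btl_prob w t i j\<close> is the probability that \<open>j\<close> beats \<open>i\<close> at time \<open>t\<close>.\<close>

definition btl_prob :: "(real \<Rightarrow> nat \<Rightarrow> real) \<Rightarrow> real \<Rightarrow> nat \<Rightarrow> nat \<Rightarrow> real" where
  "btl_prob w t i j = w t j / (w t i + w t j)"

definition pi_star :: "nat \<Rightarrow> (real \<Rightarrow> nat \<Rightarrow> real) \<Rightarrow> real \<Rightarrow> nat \<Rightarrow> real" where
  "pi_star n w t i = w t i / (\<Sum>k\<in>{1..n}. w t k)"

definition cond_number :: "nat \<Rightarrow> (real \<Rightarrow> nat \<Rightarrow> real) \<Rightarrow> real \<Rightarrow> real" where
  "cond_number n w t = Max ((\<lambda>(i, j). w t i / w t j) ` ({1..n} \<times> {1..n}))"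

text \<open>
  For positive weights with Lipschitz \<open>btl_prob\<close> the function \<open>cond_number n w\<close> is continuous
  on \<open>{0..1}\<close>, so that this supremum is an attained maximum.
\<close>

definition cond_number_max :: "nat \<Rightarrow> (real \<Rightarrow> nat \<Rightarrow> real) \<Rightarrow> real" where
  "cond_number_max n w = (SUP t\<in>{0..1}. cond_number n w t)"

definition btl_smooth :: "nat \<Rightarrow> real \<Rightarrow> (real \<Rightarrow> nat \<Rightarrow> real) \<Rightarrow> bool" where
  "btl_smooth n M w \<longleftrightarrow>
     (\<forall>i\<in>{1..n}. \<forall>j\<in>{1..n}. i \<noteq> j \<longrightarrow>
        (\<forall>t\<in>{0..1}. \<forall>t'\<in>{0..1}. \<bar>btl_prob w t i j - btl_prob w t' i j\<bar> \<le> M * \<bar>t - t'\<bar>))"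

subsection \<open>Neighborhoods and the union graph\<close>

definition nbhd :: "nat \<Rightarrow> real \<Rightarrow> real \<Rightarrow> real set" where
  "nbhd T \<delta> t = {t' \<in> grid T. \<bar>t - t'\<bar> \<le> \<delta> / real T}"

definition nbhd_edge ::
  "nat \<Rightarrow> (real \<Rightarrow> nat set set) \<Rightarrow> real \<Rightarrow> real \<Rightarrow> nat \<Rightarrow> nat \<Rightarrow> real set" where
  "nbhd_edge T G \<delta> t i j = {t' \<in> nbhd T \<delta> t. {i, j} \<in> G t'}"

definition union_edges :: "nat \<Rightarrow> (real \<Rightarrow> nat set set) \<Rightarrow> real \<Rightarrow> real \<Rightarrow> nat set set" where
  "union_edges T G \<delta> t = (\<Union>t'\<in>nbhd T \<delta> t. G t')"

definition p_union :: "nat \<Rightarrow> (real \<Rightarrow> real) \<Rightarrow> real \<Rightarrow> real \<Rightarrow> real" where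
  "p_union T p \<delta> t = 1 - (\<Prod>t'\<in>nbhd T \<delta> t. 1 - p t')"

subsection \<open>The law of the data\<close>

definition all_pairs :: "nat \<Rightarrow> nat set set" where
  "all_pairs n = {{i, j} | i j. i \<in> {1..n} \<and> j \<in> {1..n} \<and> i \<noteq> j}"

definition erdos_renyi :: "nat \<Rightarrow> real \<Rightarrow> nat set set pmf" where
  "erdos_renyi n q =
     map_pmf (\<lambda>f. {e \<in> all_pairs n. f e}) (Pi_pmf (all_pairs n) False (\<lambda>_. bernoulli_pmf q))"

definition graphs_law :: "nat \<Rightarrow> nat \<Rightarrow> (real \<Rightarrow> real) \<Rightarrow> (real \<Rightarrow> nat set set) pmf" where
  "graphs_law n T p = Pi_pmf (grid T) {} (\<lambda>t'. erdos_renyi n (p t'))"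

text \<open>
  Outcomes are drawn once per unordered pair, represented by its ordering \<open>i < j\<close>: the Boolean
  at index \<open>(t', i, j, l)\<close> tells whether \<open>j\<close> beats \<open>i\<close> in the \<open>l\<close>-th comparison at time \<open>t'\<close>.
  Only the pairs that are edges at time \<open>t'\<close> are compared.
\<close>

type_synonym outcomes = "real \<times> nat \<times> nat \<times> nat \<Rightarrow> bool"

definition comparisons ::
  "nat \<Rightarrow> nat \<Rightarrow> nat \<Rightarrow> (real \<Rightarrow> nat set set) \<Rightarrow> (real \<times> nat \<times> nat \<times> nat) set" where
  "comparisons n T L G =
     {(t', i, j, l). t' \<in> grid T \<and> i \<in> {1..n} \<and> j \<in> {1..n} \<and> i < j \<and> l \<in> {1..L} \<and> {i, j} \<in> G t'}"

definition outcomes_law ::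
  "nat \<Rightarrow> nat \<Rightarrow> nat \<Rightarrow> (real \<Rightarrow> nat \<Rightarrow> real) \<Rightarrow> (real \<Rightarrow> nat set set) \<Rightarrow> outcomes pmf" where
  "outcomes_law n T L w G =
     Pi_pmf (comparisons n T L G) False (\<lambda>(t', i, j, l). bernoulli_pmf (btl_prob w t' i j))"

definition data_law ::
  "nat \<Rightarrow> nat \<Rightarrow> nat \<Rightarrow> (real \<Rightarrow> nat \<Rightarrow> real) \<Rightarrow> (real \<Rightarrow> real)
     \<Rightarrow> ((real \<Rightarrow> nat set set) \<times> outcomes) pmf" where
  "data_law n T L w p =
     do {
       G \<leftarrow> graphs_law n T p;
       Y \<leftarrow> outcomes_law n T L w G;
       return_pmf (G, Y)
     }"

subsection \<open>The estimator\<close>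

definition outcome_value :: "outcomes \<Rightarrow> real \<Rightarrow> nat \<Rightarrow> nat \<Rightarrow> nat \<Rightarrow> real" where
  "outcome_value Y t' i j l =
     (if i < j then of_bool (Y (t', i, j, l)) else 1 - of_bool (Y (t', j, i, l)))"

definition outcome_mean :: "nat \<Rightarrow> outcomes \<Rightarrow> real \<Rightarrow> nat \<Rightarrow> nat \<Rightarrow> real" where
  "outcome_mean L Y t' i j = (1 / real L) * (\<Sum>l\<in>{1..L}. outcome_value Y t' i j l)"

definition P_hat_off ::
  "nat \<Rightarrow> nat \<Rightarrow> real \<Rightarrow> real \<Rightarrow> (real \<Rightarrow> nat set set) \<Rightarrow> outcomes \<Rightarrow> real \<Rightarrow> nat \<Rightarrow> nat \<Rightarrow> real" where
  "P_hat_off T L \<delta> d G Y t i j =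
     (if {i, j} \<in> union_edges T G \<delta> t
      then 1 / (d * real (card (nbhd_edge T G \<delta> t i j))) *
             (\<Sum>t'\<in>nbhd_edge T G \<delta> t i j. outcome_mean L Y t' i j)
      else 0)"

definition P_hat ::
  "nat \<Rightarrow> nat \<Rightarrow> nat \<Rightarrow> real \<Rightarrow> real \<Rightarrow> (real \<Rightarrow> nat set set) \<Rightarrow> outcomes \<Rightarrow> real \<Rightarrow> nat \<Rightarrow> nat \<Rightarrow> real"
  where
  "P_hat n T L \<delta> d G Y t i j =
     (if i = j then 1 - (\<Sum>k\<in>{1..n} - {i}. P_hat_off T L \<delta> d G Y t i k)
      else P_hat_off T L \<delta> d G Y t i j)"

text \<open>The first condition only makes the vector unique as a function on \<open>nat\<close>.\<close>

definition stationary_distribution :: "nat \<Rightarrow> (nat \<Rightarrow> nat \<Rightarrow> real) \<Rightarrow> (nat \<Rightarrow> real) \<Rightarrow> bool" where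
  "stationary_distribution n P \<pi> \<longleftrightarrow>
     (\<forall>i. i \<notin> {1..n} \<longrightarrow> \<pi> i = 0) \<and>
     (\<forall>i\<in>{1..n}. 0 \<le> \<pi> i) \<and> (\<Sum>i\<in>{1..n}. \<pi> i) = 1 \<and>
     (\<forall>j\<in>{1..n}. (\<Sum>i\<in>{1..n}. \<pi> i * P i j) = \<pi> j)"

text \<open>Meaningful only when the stationary distribution exists and is unique.\<close>

definition the_stationary :: "nat \<Rightarrow> (nat \<Rightarrow> nat \<Rightarrow> real) \<Rightarrow> nat \<Rightarrow> real" where
  "the_stationary n P = (THE \<pi>. stationary_distribution n P \<pi>)"

definition norm_inf :: "nat \<Rightarrow> (nat \<Rightarrow> real) \<Rightarrow> real" where
  "norm_inf n v = Max ((\<lambda>i. \<bar>v i\<bar>) ` {1..n})"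

subsection \<open>Parameters\<close>

definition gamma_fac :: "nat \<Rightarrow> real \<Rightarrow> real" where
  "gamma_fac n b =
     1 + b powr (5/2) / sqrt (ln (real n)) * max (b\<^sup>2) (ln (real n) / sqrt (real n))"

text \<open>For \<open>M = 0\<close> the first argument of the minimum stands for \<open>+\<infinity>\<close>.\<close>

definition bandwidth :: "nat \<Rightarrow> nat \<Rightarrow> nat \<Rightarrow> real \<Rightarrow> real \<Rightarrow> real \<Rightarrow> real" where
  "bandwidth n T L M b pmin =
     (if M = 0 then real T
      else min (gamma_fac n b powr (2/3) * ln (real n) powr (1/3) /
                  ((2 * M) powr (2/3) * real n * b powr (7/3) * (real L * pmin) powr (1/3)) *
                  real T powr (2/3))
               (real T))"

end

theory Submission
  imports Defs
begin

text \<open>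
  The hypothesis \<open>\<delta> \<ge> c\<^sub>2 ln n / p\<^sub>m\<^sub>i\<^sub>n\<close> makes every pair be compared at
  \<open>k \<ge> p\<^sub>m\<^sub>i\<^sub>n \<delta> / 8\<close> of the times in the neighborhood, with high probability.  The union graph is then complete,
  and the averages \<open>X i j\<close> of the outcomes of the pairs are independent with sub-Gaussian
  fluctuations of order \<open>1 / sqrt (L k)\<close>.  The difference \<open>x\<close> of \<open>\<pi>\<close>-hat and \<open>\<pi>\<^sup>*\<close> satisfies
  \<open>x (1 - P) = r\<close>, where \<open>P\<close> is the empirical matrix and \<open>r\<close> depends linearly on the noise.
  As the rows of \<open>P\<close> overlap, \<open>P\<close> contracts the \<open>\<ell>\<^sup>1\<close> norm of vectors with sum zero (Dobrushin), which
  bounds \<open>x\<close> in \<open>\<ell>\<^sup>1\<close>; one more application of the equation turns this into a bound in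
  \<open>\<ell>\<^sup>\<infinity>\<close>, because no row sum of \<open>X\<close> is small.  The sharp power of \<open>b\<close> needs
  the variance \<open>y (1 - y)\<close> of an outcome, i.e. a Bernstein bound for \<open>r\<close>.
\<close>

text \<open>All estimates concern the averages \<open>X\<close> before normalisation, since the
  factor \<open>1 / d\<close> cancels from both the l1 bound and the coordinatewise bound; the
  condition \<open>d \<ge> n\<close> keeps the diagonal of the empirical matrix nonnegative. Once
  the graphs are fixed, the outcomes form a finite product measure, and averages of different pairs
  read disjoint sets of coordinates. The obstacle is the overlap of two rows. With at least
  \<open>K\<close> outcomes per pair an entry lies within O(1 / sqrt K) of its mean, and that mean
  is only of order 1 / b. An overlap of order 1 / b per column therefore follows directly only if K
  exceeds a multiple of b^2. With fewer outcomes the minimum of two entries is bounded below by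
  their product, whose expectation is of order 1 / b^2; the lost factor b has to be recovered from
  \<gamma>. The bias caused by averaging over neighboring times can afford the loss in either case,
  because the claimed bound multiplies it by n b^(7/2).\<close>

subsection \<open>Perturbation of stationary distributions\<close>

text \<open>The positive part \<open>u\<close> and the negative part \<open>v\<close> of
  \<open>x\<close> have equal mass \<open>s\<close>. Coupling them by the product measure writes
  \<open>s\<close> times the image of \<open>x\<close> as a nonnegative combination of differences
  of rows, and two rows with overlap \<alpha> are at l1 distance at most 2 - 2\<alpha>.\<close>

lemma dobrushin_contraction:
  fixes P :: "'a \<Rightarrow> 'a \<Rightarrow> real" and x :: "'a \<Rightarrow> real"
  assumes V: "finite V"
    and row: "\<And>i. i \<in> V \<Longrightarrow> (\<Sum>j\<in>V. P i j) = 1"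
    and overlap: "\<And>i k. i \<in> V \<Longrightarrow> k \<in> V \<Longrightarrow> i \<noteq> k \<Longrightarrow> \<alpha> \<le> (\<Sum>j\<in>V. min (P i j) (P k j))"
    and x: "(\<Sum>i\<in>V. x i) = 0"
  shows "(\<Sum>j\<in>V. \<bar>\<Sum>i\<in>V. x i * P i j\<bar>) \<le> (1 - \<alpha>) * (\<Sum>i\<in>V. \<bar>x i\<bar>)"
proof -
  define u v where "u i = max (x i) 0" and "v i = max (- x i) 0" for i
  define s where "s = (\<Sum>i\<in>V. u i)"
  have uv: "x i = u i - v i" "\<bar>x i\<bar> = u i + v i" "u i \<ge> 0" "v i \<ge> 0" "u i * v i = 0" for i
    by (auto simp: u_def v_def max_def)
  have s': "(\<Sum>i\<in>V. v i) = s"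
    using x by (simp add: uv(1) sum_subtractf s_def)
  have abs_x: "(\<Sum>i\<in>V. \<bar>x i\<bar>) = 2 * s"
    by (simp add: uv(2) sum.distrib s' flip: s_def)
  have "s \<ge> 0" unfolding s_def by (intro sum_nonneg uv)
  show ?thesis
  proof (cases "s = 0")
    case True
    then have "(\<Sum>i\<in>V. \<bar>x i\<bar>) = 0" using abs_x by simp
    then have "\<forall>i\<in>V. x i = 0"
      using V by (subst (asm) sum_nonneg_eq_0_iff) auto
    then show ?thesis by simp
  next
    case False
    then have "s > 0" using \<open>s \<ge> 0\<close> by simp
    have split: "s * (\<Sum>i\<in>V. x i * P i j) = (\<Sum>i\<in>V. \<Sum>k\<in>V. u i * v k * (P i j - P k j))" for j
    proof -
      have "(\<Sum>i\<in>V. \<Sum>k\<in>V. u i * v k * (P i j - P k j))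
          = (\<Sum>i\<in>V. u i * P i j) * (\<Sum>k\<in>V. v k) - (\<Sum>i\<in>V. u i) * (\<Sum>k\<in>V. v k * P k j)"
        unfolding sum_product sum_subtractf[symmetric]
        by (intro sum.cong refl) (simp add: algebra_simps)
      also have "\<dots> = s * (\<Sum>i\<in>V. x i * P i j)"
        by (simp add: s' uv(1) sum_subtractf algebra_simps flip: s_def)
      finally show ?thesis by simp
    qed
    have pair: "(\<Sum>j\<in>V. \<bar>P i j - P k j\<bar>) \<le> 2 - 2 * \<alpha>" if "i \<in> V" "k \<in> V" "i \<noteq> k" for i k
    proof -
      have "(\<Sum>j\<in>V. \<bar>P i j - P k j\<bar>) = (\<Sum>j\<in>V. P i j + P k j - 2 * min (P i j) (P k j))"
        by (intro sum.cong) (auto simp: min_def)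
      also have "\<dots> = 2 - 2 * (\<Sum>j\<in>V. min (P i j) (P k j))"
        using that by (simp add: sum.distrib sum_subtractf row flip: sum_distrib_left)
      finally show ?thesis using overlap[OF that] by simp
    qed
    have "s * (\<Sum>j\<in>V. \<bar>\<Sum>i\<in>V. x i * P i j\<bar>) = (\<Sum>j\<in>V. \<bar>s * (\<Sum>i\<in>V. x i * P i j)\<bar>)"
      unfolding sum_distrib_left[of s "\<lambda>j. \<bar>_ j\<bar>"] using \<open>s > 0\<close> by (simp add: abs_mult)
    also have "\<dots> \<le> (\<Sum>j\<in>V. \<Sum>i\<in>V. \<Sum>k\<in>V. u i * v k * \<bar>P i j - P k j\<bar>)"
      unfolding split
      by (intro sum_mono order.trans[OF sum_abs] ) (simp add: abs_mult uv(3,4))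
    also have "\<dots> = (\<Sum>i\<in>V. \<Sum>k\<in>V. u i * v k * (\<Sum>j\<in>V. \<bar>P i j - P k j\<bar>))"
      unfolding sum_distrib_left
      by (subst sum.swap) (intro sum.cong refl sum.swap)
    \<comment> \<open>The overlap hypothesis speaks of distinct rows only; the terms with
      \<open>i = k\<close> vanish because \<open>u i * v i = 0\<close>.\<close>
    also have "\<dots> \<le> (\<Sum>i\<in>V. \<Sum>k\<in>V. u i * v k * (2 - 2 * \<alpha>))"
    proof (intro sum_mono)
      fix i k assume ik: "i \<in> V" "k \<in> V"
      show "u i * v k * (\<Sum>j\<in>V. \<bar>P i j - P k j\<bar>) \<le> u i * v k * (2 - 2 * \<alpha>)"
        using pair[OF ik] uv(3)[of i] uv(4)[of k] uv(5)[of i]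
        by (cases "i = k") (auto intro!: mult_left_mono)
    qed
    also have "\<dots> = s * s * (2 - 2 * \<alpha>)"
      by (simp add: s' flip: sum_distrib_right sum_distrib_left s_def)
    finally have "s * (\<Sum>j\<in>V. \<bar>\<Sum>i\<in>V. x i * P i j\<bar>) \<le> s * ((1 - \<alpha>) * (2 * s))"
      by (simp add: algebra_simps)
    then show ?thesis using \<open>s > 0\<close> by (simp add: abs_x)
  qed
qed

text \<open>Power iteration from the point mass at 1. Successive iterates differ by vectors of sum
  zero, so the contraction makes their l1 distances decay geometrically; every coordinate converges,
  and the limit is stationary by continuity.\<close>

lemma stationary_distribution_exists:
  assumes n: "n \<ge> 2"
    and nonneg: "\<And>i j. i \<in> {1..n} \<Longrightarrow> j \<in> {1..n} \<Longrightarrow> 0 \<le> P i j"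
    and row: "\<And>i. i \<in> {1..n} \<Longrightarrow> (\<Sum>j\<in>{1..n}. P i j) = 1"
    and overlap: "\<And>i k. i \<in> {1..n} \<Longrightarrow> k \<in> {1..n} \<Longrightarrow> i \<noteq> k \<Longrightarrow>
                    \<alpha> \<le> (\<Sum>j\<in>{1..n}. min (P i j) (P k j))"
    and \<alpha>: "\<alpha> > 0"
  shows "\<exists>\<pi>. stationary_distribution n P \<pi>"
proof -
  let ?V = "{1..n}"
  define step where "step v = (\<lambda>j. if j \<in> ?V then \<Sum>i\<in>?V. v i * P i j else 0)" for v
  define v where "v m = (step ^^ m) (\<lambda>i. if i = 1 then 1 else 0)" for m
  have v_Suc: "v (Suc m) j = (\<Sum>i\<in>?V. v m i * P i j)" if "j \<in> ?V" for m j
    using that by (simp add: v_def step_def)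
  have v_out: "v m j = 0" if "j \<notin> ?V" for m j
    using that n by (cases m) (auto simp: v_def step_def)
  have v_nonneg: "0 \<le> v m j" for m j
  proof (induction m arbitrary: j)
    case (Suc m)
    then show ?case
      by (cases "j \<in> ?V") (auto simp: v_Suc v_out intro!: sum_nonneg mult_nonneg_nonneg nonneg simp del: atLeastAtMost_iff)
  qed (auto simp: v_def)
  have v_sum: "(\<Sum>j\<in>?V. v m j) = 1" for m
  proof (induction m)
    case 0
    then show ?case using n by (simp add: v_def)
  next
    case (Suc m)
    have "(\<Sum>j\<in>?V. v (Suc m) j) = (\<Sum>j\<in>?V. \<Sum>i\<in>?V. v m i * P i j)"
      by (intro sum.cong v_Suc) auto
    also have "\<dots> = (\<Sum>i\<in>?V. v m i * (\<Sum>j\<in>?V. P i j))"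
      by (subst sum.swap) (simp add: sum_distrib_left)
    also have "\<dots> = (\<Sum>i\<in>?V. v m i)"
      by (intro sum.cong refl) (simp only: row mult_1_right)
    also have "\<dots> = 1" by (rule Suc.IH)
    finally show ?case .
  qed
  \<comment> \<open>An overlap is at most a row sum, so 0 \<le> 1 - \<alpha> < 1, as the geometric
    series requires. Rows 1 and 2 exist because \<open>n \<ge> 2\<close>.\<close>
  have "\<alpha> \<le> (\<Sum>j\<in>?V. min (P 1 j) (P 2 j))" using n by (intro overlap) auto
  also have "\<dots> \<le> (\<Sum>j\<in>?V. P 1 j)" by (intro sum_mono) auto
  also have "\<dots> = 1" using n by (intro row) auto
  finally have \<alpha>1: "\<alpha> \<le> 1" .
  have geo: "(\<Sum>j\<in>?V. \<bar>v (Suc m) j - v m j\<bar>) \<le> 2 * (1 - \<alpha>) ^ m" for m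
  proof (induction m)
    case 0
    have "(\<Sum>j\<in>?V. \<bar>v (Suc 0) j - v 0 j\<bar>) \<le> (\<Sum>j\<in>?V. v (Suc 0) j + v 0 j)"
      by (intro sum_mono) (use v_nonneg in \<open>smt (verit)\<close>)
    also have "\<dots> = 2" unfolding sum.distrib v_sum by simp
    finally show ?case by simp
  next
    case (Suc m)
    have "(\<Sum>j\<in>?V. \<bar>v (Suc (Suc m)) j - v (Suc m) j\<bar>)
        = (\<Sum>j\<in>?V. \<bar>\<Sum>i\<in>?V. (v (Suc m) i - v m i) * P i j\<bar>)"
      by (intro sum.cong refl) (simp add: v_Suc sum_subtractf left_diff_distrib)
    also have "\<dots> \<le> (1 - \<alpha>) * (\<Sum>j\<in>?V. \<bar>v (Suc m) j - v m j\<bar>)"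
      by (intro dobrushin_contraction row overlap) (auto simp: sum_subtractf v_sum simp del: One_nat_def)
    also have "\<dots> \<le> (1 - \<alpha>) * (2 * (1 - \<alpha>) ^ m)"
      using \<alpha>1 Suc by (intro mult_left_mono) auto
    finally show ?case by simp
  qed
  have "convergent (\<lambda>m. v m j)" for j
  proof (cases "j \<in> ?V")
    case True
    have bd: "norm (v (Suc m) j - v m j) \<le> 2 * (1 - \<alpha>) ^ m" for m
      using geo[of m] member_le_sum[of j ?V "\<lambda>j. \<bar>v (Suc m) j - v m j\<bar>"] True by fastforce
    have "summable (\<lambda>m. v (Suc m) j - v m j)"
      by (rule summable_comparison_test'[where g = "\<lambda>m. 2 * (1 - \<alpha>) ^ m", OF _ bd])
         (use \<alpha> \<alpha>1 in \<open>auto intro!: summable_mult summable_geometric\<close>)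
    then have "(\<lambda>m. v m j - v 0 j) \<longlonglongrightarrow> (\<Sum>m. v (Suc m) j - v m j)"
      using summable_LIMSEQ[of "\<lambda>m. v (Suc m) j - v m j"]
      by (simp add: sum_lessThan_telescope[of "\<lambda>m. v m j"])
    from tendsto_add[OF this tendsto_const[of "v 0 j"]] show ?thesis
      by (auto simp: convergent_def)
  qed (simp add: v_out convergent_const)
  then have lim: "(\<lambda>m. v m j) \<longlonglongrightarrow> lim (\<lambda>m. v m j)" for j
    by (simp add: convergent_LIMSEQ_iff)
  define \<pi> where "\<pi> j = lim (\<lambda>m. v m j)" for j
  note lim = lim[folded \<pi>_def]
  have "\<pi> j = 0" if "j \<notin> ?V" for j
    using lim[of j] that by (simp add: v_out LIMSEQ_const_iff)
  moreover have "0 \<le> \<pi> j" for j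
    using lim[of j] v_nonneg by (intro LIMSEQ_le_const) auto
  moreover have "(\<Sum>j\<in>?V. \<pi> j) = 1"
  proof -
    have "(\<lambda>m. \<Sum>j\<in>?V. v m j) \<longlonglongrightarrow> (\<Sum>j\<in>?V. \<pi> j)" by (intro tendsto_sum lim)
    then show ?thesis unfolding v_sum LIMSEQ_const_iff by simp
  qed
  moreover have "(\<Sum>i\<in>?V. \<pi> i * P i j) = \<pi> j" if "j \<in> ?V" for j
  proof (rule LIMSEQ_unique)
    show "(\<lambda>m. v (Suc m) j) \<longlonglongrightarrow> \<pi> j" using lim by (rule LIMSEQ_Suc)
    show "(\<lambda>m. v (Suc m) j) \<longlonglongrightarrow> (\<Sum>i\<in>?V. \<pi> i * P i j)"
      unfolding v_Suc[OF that] by (intro tendsto_intros lim)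
  qed
  ultimately show ?thesis unfolding stationary_distribution_def by blast
qed

text \<open>The difference of two stationary vectors has sum zero and is fixed by \<open>P\<close>,
  which a strict l1 contraction allows only for the zero vector. Outside \<open>{1..n}\<close> both
  vectors are 0 by definition.\<close>

lemma stationary_distribution_unique:
  assumes row: "\<And>i. i \<in> {1..n} \<Longrightarrow> (\<Sum>j\<in>{1..n}. P i j) = 1"
    and overlap: "\<And>i k. i \<in> {1..n} \<Longrightarrow> k \<in> {1..n} \<Longrightarrow> i \<noteq> k \<Longrightarrow>
                    \<alpha> \<le> (\<Sum>j\<in>{1..n}. min (P i j) (P k j))"
    and \<alpha>: "\<alpha> > 0"
    and st: "stationary_distribution n P \<pi>" "stationary_distribution n P \<pi>'"
  shows "\<pi> = \<pi>'"
proof -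
  let ?V = "{1..n}"
  let ?S = "\<Sum>i\<in>?V. \<bar>\<pi> i - \<pi>' i\<bar>"
  have "?S = (\<Sum>j\<in>?V. \<bar>\<Sum>i\<in>?V. (\<pi> i - \<pi>' i) * P i j\<bar>)"
    using st by (intro sum.cong refl)
      (simp add: stationary_distribution_def sum_subtractf left_diff_distrib)
  also have "\<dots> \<le> (1 - \<alpha>) * ?S"
    using st by (intro dobrushin_contraction row overlap)
      (auto simp: sum_subtractf stationary_distribution_def)
  finally have "\<alpha> * ?S \<le> 0" by (simp add: algebra_simps)
  then have "?S \<le> 0" using \<alpha> by (simp add: mult_le_0_iff)
  then have "?S = 0" by (intro antisym sum_nonneg) auto
  then have "\<forall>i\<in>?V. \<pi> i = \<pi>' i"
    by (subst (asm) sum_nonneg_eq_0_iff) auto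
  then show ?thesis
    using st unfolding stationary_distribution_def by (intro ext) metis
qed

text \<open>The sums bounded by \<open>R1\<close> and \<open>R\<close> are \<open>d\<close> times
  the defect of \<open>\<pi>\<close> in the stationarity equation. Contraction with rate
  \<open>1 - A / d\<close> bounds the error in l1 by \<open>R1 / A\<close>; solving coordinate
  \<open>j\<close> of the equation for the error at \<open>j\<close> then divides by the row sum,
  which is at least \<open>D\<close>. The overlap omits the columns \<open>i\<close> and
  \<open>k\<close>, so that only off-diagonal entries enter.\<close>

lemma stationary_perturbation:
  fixes X :: "nat \<Rightarrow> nat \<Rightarrow> real" and \<pi> :: "nat \<Rightarrow> real"
  assumes n: "n \<ge> 2" and d: "d \<ge> real n"
    and X01: "\<And>i j. i \<in> {1..n} \<Longrightarrow> j \<in> {1..n} \<Longrightarrow> i \<noteq> j \<Longrightarrow> 0 \<le> X i j \<and> X i j \<le> 1"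
    and X_swap: "\<And>i j. i \<in> {1..n} \<Longrightarrow> j \<in> {1..n} \<Longrightarrow> i \<noteq> j \<Longrightarrow> X j i = 1 - X i j"
    and P_off: "\<And>i j. i \<in> {1..n} \<Longrightarrow> j \<in> {1..n} \<Longrightarrow> i \<noteq> j \<Longrightarrow> P i j = X i j / d"
    and P_diag: "\<And>i. i \<in> {1..n} \<Longrightarrow> P i i = 1 - (\<Sum>k\<in>{1..n} - {i}. P i k)"
    and \<pi>: "\<And>i. i \<in> {1..n} \<Longrightarrow> 0 < \<pi> i" "(\<Sum>i\<in>{1..n}. \<pi> i) = 1"
    and overlap: "\<And>i k. i \<in> {1..n} \<Longrightarrow> k \<in> {1..n} \<Longrightarrow> i \<noteq> k \<Longrightarrow>
                    A \<le> (\<Sum>j\<in>{1..n} - {i, k}. min (X i j) (X k j))"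
    and A: "A > 0"
    and rowsum: "\<And>j. j \<in> {1..n} \<Longrightarrow> D \<le> (\<Sum>i\<in>{1..n} - {j}. X j i)"
    and D: "D > 0"
    and R1: "(\<Sum>j\<in>{1..n}. \<bar>\<Sum>i\<in>{1..n} - {j}. (\<pi> i + \<pi> j) * (X i j - \<pi> j / (\<pi> i + \<pi> j))\<bar>) \<le> R1"
    and R: "\<And>j. j \<in> {1..n} \<Longrightarrow>
              \<bar>\<Sum>i\<in>{1..n} - {j}. (\<pi> i + \<pi> j) * (X i j - \<pi> j / (\<pi> i + \<pi> j))\<bar> \<le> R"
  shows "\<exists>!\<rho>. stationary_distribution n P \<rho>"
    and "stationary_distribution n P \<rho> \<Longrightarrow> j \<in> {1..n} \<Longrightarrow> \<bar>\<rho> j - \<pi> j\<bar> \<le> (R1 / A + R) / D"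
proof -
  let ?V = "{1..n}"
  have d0: "d > 0" using n d by simp
  have off_sum: "(\<Sum>k\<in>?V - {i}. P i k) = (\<Sum>k\<in>?V - {i}. X i k) / d" if "i \<in> ?V" for i
    unfolding sum_divide_distrib using that by (intro sum.cong P_off refl) auto
  have row: "(\<Sum>j\<in>?V. P i j) = 1" if "i \<in> ?V" for i
    using that P_diag[OF that] by (subst sum.remove[of _ i]) auto
  have nonneg: "0 \<le> P i j" if "i \<in> ?V" "j \<in> ?V" for i j
  proof (cases "i = j")
    case True
    have "(\<Sum>k\<in>?V - {i}. X i k) \<le> (\<Sum>k\<in>?V - {i}. 1)"
      using that X01 by (intro sum_mono) auto
    also have "\<dots> \<le> real n" using that by simp
    finally have "(\<Sum>k\<in>?V - {i}. X i k) / d \<le> 1" using d d0 by simp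
    then show ?thesis using True that P_diag off_sum by simp
  qed (use that X01 P_off d0 in auto)
  have overlap': "A / d \<le> (\<Sum>j\<in>?V. min (P i j) (P k j))" if "i \<in> ?V" "k \<in> ?V" "i \<noteq> k" for i k
  proof -
    have "A / d \<le> (\<Sum>j\<in>?V - {i, k}. min (X i j) (X k j)) / d"
      using overlap[OF that] d0 by (intro divide_right_mono) auto
    also have "\<dots> = (\<Sum>j\<in>?V - {i, k}. min (P i j) (P k j))"
      unfolding sum_divide_distrib using that d0
      by (intro sum.cong refl) (auto simp: P_off min_def divide_le_cancel)
    also have "\<dots> \<le> (\<Sum>j\<in>?V. min (P i j) (P k j))"
      using that nonneg by (intro sum_mono2) auto
    finally show ?thesis .
  qed
  have Ad: "A / d > 0" using A d0 by simp
  obtain \<rho>0 where "stationary_distribution n P \<rho>0"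
    using stationary_distribution_exists[of n P "A / d"] n nonneg row overlap' Ad by blast
  then show "\<exists>!\<rho>. stationary_distribution n P \<rho>"
    using stationary_distribution_unique[of n P "A / d"] row overlap' Ad by blast
  assume st: "stationary_distribution n P \<rho>" and j: "j \<in> ?V"
  define r where "r j = (\<Sum>i\<in>?V - {j}. (\<pi> i + \<pi> j) * (X i j - \<pi> j / (\<pi> i + \<pi> j)))" for j
  define x where "x i = \<rho> i - \<pi> i" for i
  have x0: "(\<Sum>i\<in>?V. x i) = 0"
    using st \<pi> by (simp add: x_def sum_subtractf stationary_distribution_def)
  \<comment> \<open>Detailed balance: the net flow \<open>\<pi> i * X i j - \<pi> j * X j i\<close>
    vanishes when \<open>X i j\<close> is the exact BTL probability, and by
    \<open>X j i = 1 - X i j\<close> it is linear in the deviation from it.\<close>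
  have \<pi>P: "d * ((\<Sum>i\<in>?V. \<pi> i * P i j) - \<pi> j) = r j" if j: "j \<in> ?V" for j
  proof -
    have "(\<Sum>i\<in>?V. \<pi> i * P i j) - \<pi> j = (\<Sum>i\<in>?V - {j}. \<pi> i * P i j) - \<pi> j * (\<Sum>i\<in>?V - {j}. P j i)"
      using sum.remove[of ?V j "\<lambda>i. \<pi> i * P i j"] j
      by (simp add: P_diag[OF j] algebra_simps del: One_nat_def)
    also have "\<dots> = (\<Sum>i\<in>?V - {j}. \<pi> i * X i j / d) - \<pi> j * (\<Sum>i\<in>?V - {j}. X j i / d)"
      using j by (intro arg_cong2[of _ _ _ _ minus] arg_cong2[of _ _ _ _ times] sum.cong refl)
        (auto simp: P_off)
    also have "\<dots> = (\<Sum>i\<in>?V - {j}. \<pi> i * X i j - \<pi> j * X j i) / d"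
      unfolding sum_subtractf sum_distrib_left sum_divide_distrib diff_divide_distrib by simp
    also have "(\<Sum>i\<in>?V - {j}. \<pi> i * X i j - \<pi> j * X j i) = r j"
      unfolding r_def
    proof (intro sum.cong refl)
      fix i assume "i \<in> ?V - {j}"
      then have "X j i = 1 - X i j" "\<pi> i + \<pi> j \<noteq> 0"
        using j X_swap[of i j] \<pi>(1)[of i] \<pi>(1)[of j] by auto
      then show "\<pi> i * X i j - \<pi> j * X j i = (\<pi> i + \<pi> j) * (X i j - \<pi> j / (\<pi> i + \<pi> j))"
        by (simp add: right_diff_distrib) (simp add: algebra_simps)
    qed
    finally show ?thesis using d0 by simp
  qed
  have x_eq: "x j = (\<Sum>i\<in>?V. x i * P i j) + r j / d" if j: "j \<in> ?V" for j
  proof -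
    have "x j = (\<Sum>i\<in>?V. \<rho> i * P i j) - \<pi> j"
      using st j by (simp add: x_def stationary_distribution_def)
    also have "\<dots> = (\<Sum>i\<in>?V. x i * P i j) + ((\<Sum>i\<in>?V. \<pi> i * P i j) - \<pi> j)"
      by (simp add: x_def left_diff_distrib sum_subtractf)
    moreover have "(\<Sum>i\<in>?V. \<pi> i * P i j) - \<pi> j = r j / d"
      using \<pi>P[OF j] d0 by (simp add: field_simps)
    ultimately show ?thesis by simp
  qed
  let ?S = "\<Sum>i\<in>?V. \<bar>x i\<bar>"
  have "?S \<le> (\<Sum>j\<in>?V. \<bar>\<Sum>i\<in>?V. x i * P i j\<bar> + \<bar>r j\<bar> / d)"
  proof (intro sum_mono)
    fix j assume "j \<in> ?V"
    from x_eq[OF this] show "\<bar>x j\<bar> \<le> \<bar>\<Sum>i\<in>?V. x i * P i j\<bar> + \<bar>r j\<bar> / d"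
      using d0 abs_triangle_ineq[of "\<Sum>i\<in>?V. x i * P i j" "r j / d"] by (simp add: abs_divide)
  qed
  also have "\<dots> \<le> (1 - A / d) * ?S + R1 / d"
    using dobrushin_contraction[OF _ row overlap' x0] R1 d0
    by (auto simp: sum.distrib r_def divide_right_mono simp flip: sum_divide_distrib intro!: add_mono)
  finally have "A / d * ?S \<le> R1 / d" by (simp add: algebra_simps)
  then have S: "?S \<le> R1 / A" using A d0 by (simp add: field_simps)
  let ?D = "\<Sum>i\<in>?V - {j}. X j i"
  \<comment> \<open>The diagonal entry \<open>P j j = 1 - ?D / d\<close> cancels \<open>x j\<close>
    on the left and leaves \<open>?D / d\<close> as its coefficient; multiplying by \<open>d\<close>
    removes the normalisation.\<close>
  have "x j * ?D = (\<Sum>i\<in>?V - {j}. x i * X i j) + r j"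
  proof -
    have "x j = x j * P j j + (\<Sum>i\<in>?V - {j}. x i * P i j) + r j / d"
      using x_eq[OF j] j by (subst (asm) sum.remove[of _ j]) auto
    also have "P j j = 1 - ?D / d" using P_diag[OF j] off_sum[OF j] by simp
    also have "(\<Sum>i\<in>?V - {j}. x i * P i j) = (\<Sum>i\<in>?V - {j}. x i * X i j) / d"
      unfolding sum_divide_distrib using j by (intro sum.cong refl) (auto simp: P_off)
    finally show ?thesis using d0 by (simp add: field_simps)
  qed
  moreover have "\<bar>\<Sum>i\<in>?V - {j}. x i * X i j\<bar> \<le> ?S"
  proof -
    have "\<bar>\<Sum>i\<in>?V - {j}. x i * X i j\<bar> \<le> (\<Sum>i\<in>?V - {j}. \<bar>x i\<bar>)"
      using j X01 by (intro order.trans[OF sum_abs] sum_mono) (auto simp: abs_mult mult_left_le)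
    also have "\<dots> \<le> ?S" by (intro sum_mono2) auto
    finally show ?thesis .
  qed
  ultimately have "\<bar>x j * ?D\<bar> \<le> R1 / A + R"
    using S R[OF j] by (simp add: r_def)
  moreover have "\<bar>x j\<bar> * D \<le> \<bar>x j * ?D\<bar>"
    unfolding abs_mult using rowsum[OF j] D by (intro mult_left_mono) auto
  ultimately show "\<bar>\<rho> j - \<pi> j\<bar> \<le> (R1 / A + R) / D"
    using D by (simp add: x_def field_simps)
qed

subsection \<open>Independence and tail bounds for finite products\<close>

text \<open>For negative arguments the bound is inverted: \<open>1 - u + u\<^sup>2\<close> times the
  quadratic Taylor polynomial of \<open>exp u\<close> is at least 1.\<close>

lemma exp_le_quadratic:
  fixes x :: real
  assumes "\<bar>x\<bar> \<le> 1"
  shows "exp x \<le> 1 + x + x\<^sup>2"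
proof (cases "x \<ge> 0")
  case True
  then show ?thesis using assms exp_bound by simp
next
  case False
  define u where "u = - x"
  have u: "0 \<le> u" using False by (simp add: u_def)
  have "1 \<le> (1 - u + u\<^sup>2) * (1 + u + u\<^sup>2 / 2)"
  proof -
    have "(1 - u + u\<^sup>2) * (1 + u + u\<^sup>2 / 2) = 1 + u\<^sup>2 / 2 + u ^ 3 / 2 + u ^ 4 / 2"
      by (simp add: field_simps power2_eq_square power3_eq_cube power4_eq_xxxx)
    then show ?thesis using u by simp
  qed
  also have "\<dots> \<le> (1 - u + u\<^sup>2) * exp u"
  proof (rule mult_left_mono)
    show "0 \<le> 1 - u + u\<^sup>2" using assms False by (simp add: u_def)
  qed (use u exp_lower_Taylor_quadratic in auto)
  finally show ?thesis
    by (simp add: u_def exp_minus field_simps)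
qed

text \<open>A Bernstein-type bound: keeping the variance \<open>p * (1 - p)\<close> in the exponent
  costs the restriction to bounded \<open>s\<close>. The linear terms cancel because the variable is
  centered.\<close>

lemma bernoulli_mgf_le:
  assumes "0 \<le> p" "p \<le> 1" "\<bar>s\<bar> \<le> 1"
  shows "measure_pmf.expectation (bernoulli_pmf p) (\<lambda>y. exp (s * (of_bool y - p)))
           \<le> exp (s\<^sup>2 * (p * (1 - p)))"
proof -
  have small: "\<bar>s * (1 - p)\<bar> \<le> 1" "\<bar>- s * p\<bar> \<le> 1"
    using assms by (auto simp: abs_mult intro!: mult_le_one)
  have "measure_pmf.expectation (bernoulli_pmf p) (\<lambda>y. exp (s * (of_bool y - p)))
      = p * exp (s * (1 - p)) + (1 - p) * exp (- s * p)"
    using assms by simp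
  also have "\<dots> \<le> p * (1 + s * (1 - p) + (s * (1 - p))\<^sup>2) + (1 - p) * (1 + - s * p + (- s * p)\<^sup>2)"
    using assms small by (intro add_mono mult_left_mono exp_le_quadratic) auto
  also have "\<dots> = 1 + s\<^sup>2 * (p * (1 - p))"
    by (simp add: algebra_simps power2_eq_square)
  also have "\<dots> \<le> exp (s\<^sup>2 * (p * (1 - p)))" by (rule exp_ge_add_one_self)
  finally show ?thesis .
qed

text \<open>Markov's inequality for \<open>exp Z\<close>; the Chernoff parameter is understood to be
  part of \<open>Z\<close>.\<close>

lemma pmf_Chernoff:
  fixes Z :: "'a \<Rightarrow> real"
  assumes fin: "finite (set_pmf Q)"
    and mgf: "measure_pmf.expectation Q (\<lambda>\<omega>. exp (Z \<omega>)) \<le> exp u"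
  shows "measure_pmf.prob Q {\<omega>. x \<le> Z \<omega>} \<le> exp (u - x)"
proof -
  have "measure_pmf.prob Q {\<omega> \<in> space (measure_pmf Q). exp x \<le> exp (Z \<omega>)}
      \<le> measure_pmf.expectation Q (\<lambda>\<omega>. exp (Z \<omega>)) / exp x"
    using fin by (intro integral_Markov_inequality_measure[where A = "{}"] integrable_measure_pmf_finite) auto
  also have "\<dots> \<le> exp u / exp x" using mgf by (intro divide_right_mono) auto
  finally show ?thesis by (simp add: exp_diff)
qed

lemma finite_set_Pi_pmf:
  assumes "finite I" "\<And>x. x \<in> I \<Longrightarrow> finite (set_pmf (p x))"
  shows "finite (set_pmf (Pi_pmf I dflt p))"
  using assms finite_PiE_dflt[of I "set_pmf \<circ> p" dflt] by (simp add: set_Pi_pmf)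

lemma expectation_pair_pmf_mult:
  fixes f :: "'a \<Rightarrow> real" and g :: "'b \<Rightarrow> real"
  assumes "finite (set_pmf A)" "finite (set_pmf B)"
  shows "measure_pmf.expectation (pair_pmf A B) (\<lambda>(x, y). f x * g y)
         = measure_pmf.expectation A f * measure_pmf.expectation B g"
proof -
  have "measure_pmf.expectation (pair_pmf A B) (\<lambda>(x, y). f x * g y)
      = (\<Sum>z\<in>set_pmf A \<times> set_pmf B. pmf (pair_pmf A B) z * (case z of (x, y) \<Rightarrow> f x * g y))"
    using assms by (subst integral_measure_pmf[of "set_pmf A \<times> set_pmf B"]) auto
  also have "\<dots> = (\<Sum>x\<in>set_pmf A. \<Sum>y\<in>set_pmf B. (pmf A x * f x) * (pmf B y * g y))"
    by (subst sum.cartesian_product) (auto intro!: sum.cong simp: pmf_pair)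
  also have "\<dots> = (\<Sum>x\<in>set_pmf A. pmf A x * f x) * (\<Sum>y\<in>set_pmf B. pmf B y * g y)"
    by (simp add: sum_product)
  also have "\<dots> = measure_pmf.expectation A f * measure_pmf.expectation B g"
    using assms by (subst (1 2) integral_measure_pmf) auto
  finally show ?thesis .
qed

text \<open>Independence of functions of disjoint coordinate sets. That a function depends only on
  some coordinates is expressed as a congruence, so it suffices to split the product into the
  coordinates in \<open>A\<close> and all others.\<close>

lemma expectation_Pi_pmf_mult:
  fixes f g :: "('i \<Rightarrow> 'b) \<Rightarrow> real"
  assumes I: "finite I" and A: "A \<subseteq> I" and B: "B \<subseteq> I" "A \<inter> B = {}"
    and fin: "\<And>x. x \<in> I \<Longrightarrow> finite (set_pmf (p x))"
    and f: "\<And>Y Y'. (\<And>x. x \<in> A \<Longrightarrow> Y x = Y' x) \<Longrightarrow> f Y = f Y'"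
    and g: "\<And>Y Y'. (\<And>x. x \<in> B \<Longrightarrow> Y x = Y' x) \<Longrightarrow> g Y = g Y'"
  shows "measure_pmf.expectation (Pi_pmf I dflt p) (\<lambda>Y. f Y * g Y)
         = measure_pmf.expectation (Pi_pmf I dflt p) f * measure_pmf.expectation (Pi_pmf I dflt p) g"
proof -
  define merge where "merge = (\<lambda>(Y, Y') x. if x \<in> A then Y x else Y' x :: 'b)"
  let ?A = "Pi_pmf A dflt p" and ?B = "Pi_pmf (I - A) dflt p"
  have finA: "finite (set_pmf ?A)" "finite (set_pmf ?B)"
    using I A fin by (auto intro!: finite_set_Pi_pmf intro: finite_subset)
  have union: "Pi_pmf I dflt p = map_pmf merge (pair_pmf ?A ?B)"
    using Pi_pmf_union[of A "I - A" dflt p] I A finite_subset[OF A I]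
    by (simp add: merge_def Un_absorb1)
  have fm: "f (merge (Y, Y')) = f Y" for Y Y' by (rule f) (simp add: merge_def)
  have gm: "g (merge (Y, Y')) = g Y'" for Y Y' by (rule g) (use B in \<open>auto simp: merge_def\<close>)
  have E: "measure_pmf.expectation (Pi_pmf I dflt p) h
         = measure_pmf.expectation (pair_pmf ?A ?B) (\<lambda>(Y, Y'). h (merge (Y, Y')))"
    for h :: "('i \<Rightarrow> 'b) \<Rightarrow> real"
    unfolding union by (simp add: case_prod_unfold)
  show ?thesis
    unfolding E[of f] E[of g] E[of "\<lambda>Y. f Y * g Y"] fm gm
    using expectation_pair_pmf_mult[OF finA, of f g]
      expectation_pair_pmf_mult[OF finA, of f "\<lambda>_. 1"] expectation_pair_pmf_mult[OF finA, of "\<lambda>_. 1" g]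
    by simp
qed

text \<open>Induction on \<open>J\<close>, separating one block from the union of the rest. This
  factorisation of expectations is the form in which independence enters the Chernoff
  bounds.\<close>

lemma expectation_Pi_pmf_prod_blocks:
  fixes h :: "'j \<Rightarrow> ('i \<Rightarrow> 'b) \<Rightarrow> real"
  assumes I: "finite I" and J: "finite J"
    and fin: "\<And>x. x \<in> I \<Longrightarrow> finite (set_pmf (p x))"
    and B: "\<And>j. j \<in> J \<Longrightarrow> B j \<subseteq> I" "\<And>j j'. j \<in> J \<Longrightarrow> j' \<in> J \<Longrightarrow> j \<noteq> j' \<Longrightarrow> B j \<inter> B j' = {}"
    and h: "\<And>j Y Y'. j \<in> J \<Longrightarrow> (\<And>x. x \<in> B j \<Longrightarrow> Y x = Y' x) \<Longrightarrow> h j Y = h j Y'"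
  shows "measure_pmf.expectation (Pi_pmf I dflt p) (\<lambda>Y. \<Prod>j\<in>J. h j Y)
         = (\<Prod>j\<in>J. measure_pmf.expectation (Pi_pmf I dflt p) (h j))"
  using J B h
proof (induction J)
  case empty
  then show ?case by simp
next
  case (insert j J)
  have "measure_pmf.expectation (Pi_pmf I dflt p) (\<lambda>Y. h j Y * (\<Prod>j\<in>J. h j Y))
      = measure_pmf.expectation (Pi_pmf I dflt p) (h j)
        * measure_pmf.expectation (Pi_pmf I dflt p) (\<lambda>Y. \<Prod>j\<in>J. h j Y)"
  proof (rule expectation_Pi_pmf_mult[OF I, of "B j" "\<Union>j\<in>J. B j"])
    show "B j \<inter> (\<Union>j\<in>J. B j) = {}"
      using insert.hyps(2) insert.prems(2)[of j] by blast
    show "(\<Prod>j\<in>J. h j Y) = (\<Prod>j\<in>J. h j Y')" if "\<And>x. x \<in> (\<Union>j\<in>J. B j) \<Longrightarrow> Y x = Y' x" for Y Y'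
      using that by (intro prod.cong refl insert.prems(3)) auto
    show "h j Y = h j Y'" if "\<And>x. x \<in> B j \<Longrightarrow> Y x = Y' x" for Y Y'
      using that by (intro insert.prems(3)) auto
  qed (use insert.prems(1) fin in auto)
  also have "measure_pmf.expectation (Pi_pmf I dflt p) (\<lambda>Y. \<Prod>j\<in>J. h j Y)
      = (\<Prod>j\<in>J. measure_pmf.expectation (Pi_pmf I dflt p) (h j))"
  proof (rule insert.IH)
    show "h j Y = h j Y'" if "j \<in> J" "\<And>x. x \<in> B j \<Longrightarrow> Y x = Y' x" for j Y Y'
      using that by (intro insert.prems(3)) simp_all
  qed (use insert.prems(1,2) in \<open>simp_all\<close>)
  finally show ?case using insert.hyps by simp
qed

text \<open>Chernoff's bound with parameter 1. Since \<open>exp (- z) \<le> 1 - z / 2\<close> on the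
  unit interval, half of the mean survives in the exponent, and the threshold \<open>S / 4\<close>
  uses up half of that. The variables need not be Boolean, so the bound serves both edge counts and
  minima of two averages.\<close>

lemma lower_tail_prod:
  fixes Z :: "'j \<Rightarrow> 'a \<Rightarrow> real"
  assumes fin: "finite (set_pmf Q)" and J: "finite J"
    and Z01: "\<And>j \<omega>. j \<in> J \<Longrightarrow> 0 \<le> Z j \<omega> \<and> Z j \<omega> \<le> 1"
    and indep: "measure_pmf.expectation Q (\<lambda>\<omega>. \<Prod>j\<in>J. exp (- Z j \<omega>))
                = (\<Prod>j\<in>J. measure_pmf.expectation Q (\<lambda>\<omega>. exp (- Z j \<omega>)))"
    and S: "S \<le> (\<Sum>j\<in>J. measure_pmf.expectation Q (Z j))"
  shows "measure_pmf.prob Q {\<omega>. (\<Sum>j\<in>J. Z j \<omega>) \<le> S / 4} \<le> exp (- S / 4)"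
proof -
  have chord: "exp (- z) \<le> 1 - z / 2" if "0 \<le> z" "z \<le> 1" for z :: real
  proof -
    have "exp (- z) \<le> 1 - z + z\<^sup>2 / 2"
    proof -
      have "(1 + z + z\<^sup>2 / 2) * (1 - z + z\<^sup>2 / 2) = 1 + z ^ 4 / 4"
        by (simp add: field_simps power2_eq_square power4_eq_xxxx)
      then have "1 \<le> (1 + z + z\<^sup>2 / 2) * (1 - z + z\<^sup>2 / 2)" using that by simp
      also have "\<dots> \<le> exp z * (1 - z + z\<^sup>2 / 2)"
        using that exp_lower_Taylor_quadratic by (intro mult_right_mono) auto
      finally show ?thesis by (simp add: exp_minus field_simps)
    qed
    moreover have "z\<^sup>2 \<le> z" using that by (simp add: power2_eq_square mult_left_le)
    ultimately show ?thesis by simp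
  qed
  have each: "measure_pmf.expectation Q (\<lambda>\<omega>. exp (- Z j \<omega>))
        \<le> exp (- measure_pmf.expectation Q (Z j) / 2)" if "j \<in> J" for j
  proof -
    have "measure_pmf.expectation Q (\<lambda>\<omega>. exp (- Z j \<omega>)) \<le> measure_pmf.expectation Q (\<lambda>\<omega>. 1 - Z j \<omega> / 2)"
      using fin Z01[OF that] chord
      by (intro integral_mono integrable_measure_pmf_finite) auto
    also have "\<dots> = 1 - measure_pmf.expectation Q (Z j) / 2"
      using fin by (subst Bochner_Integration.integral_diff) (auto intro: integrable_measure_pmf_finite)
    also have "\<dots> \<le> exp (- measure_pmf.expectation Q (Z j) / 2)"
      using exp_ge_add_one_self[of "- measure_pmf.expectation Q (Z j) / 2"] by simp
    finally show ?thesis .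
  qed
  have "measure_pmf.expectation Q (\<lambda>\<omega>. exp (- (\<Sum>j\<in>J. Z j \<omega>)))
      = (\<Prod>j\<in>J. measure_pmf.expectation Q (\<lambda>\<omega>. exp (- Z j \<omega>)))"
    unfolding indep[symmetric] sum_negf[symmetric] exp_sum[OF J] ..
  also have "\<dots> \<le> (\<Prod>j\<in>J. exp (- measure_pmf.expectation Q (Z j) / 2))"
    using each by (intro prod_mono) (auto intro: Bochner_Integration.integral_nonneg)
  also have "\<dots> = exp (- (\<Sum>j\<in>J. measure_pmf.expectation Q (Z j)) / 2)"
    unfolding sum_negf[symmetric] sum_divide_distrib exp_sum[OF J] ..
  also have "\<dots> \<le> exp (- S / 2)" using S by simp
  finally have "measure_pmf.prob Q {\<omega>. - S / 4 \<le> - (\<Sum>j\<in>J. Z j \<omega>)} \<le> exp (- S / 2 - (- S / 4))"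
    by (intro pmf_Chernoff[OF fin])
  moreover have "{\<omega>. - S / 4 \<le> - (\<Sum>j\<in>J. Z j \<omega>)} = {\<omega>. (\<Sum>j\<in>J. Z j \<omega>) \<le> S / 4}" by auto
  ultimately show ?thesis by simp
qed

subsection \<open>Random comparison matrices\<close>

text \<open>\<open>K\<close> stands for a lower bound on the number of outcomes averaged in an
  entry, and \<open>v i j\<close> for the average variance of one of them. Since
  \<open>X j i\<close> is determined by \<open>X i j\<close>, independence is recorded only for
  families of distinct pairs: a column, the overlap of two rows, and two entries of a
  column.\<close>

locale comparison_matrix =
  fixes Q :: "'a pmf" and n :: nat and K :: real
    and X :: "nat \<Rightarrow> nat \<Rightarrow> 'a \<Rightarrow> real" and \<mu> v :: "nat \<Rightarrow> nat \<Rightarrow> real"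
  assumes fin: "finite (set_pmf Q)"
    and K: "K \<ge> 1"
    and X01: "\<And>i j \<omega>. i \<in> {1..n} \<Longrightarrow> j \<in> {1..n} \<Longrightarrow> i \<noteq> j \<Longrightarrow> 0 \<le> X i j \<omega> \<and> X i j \<omega> \<le> 1"
    and X_swap: "\<And>i j \<omega>. i \<in> {1..n} \<Longrightarrow> j \<in> {1..n} \<Longrightarrow> i \<noteq> j \<Longrightarrow> X j i \<omega> = 1 - X i j \<omega>"
    and mean: "\<And>i j. i \<in> {1..n} \<Longrightarrow> j \<in> {1..n} \<Longrightarrow> i \<noteq> j \<Longrightarrow> measure_pmf.expectation Q (X i j) = \<mu> i j"
    and var: "\<And>i j. i \<in> {1..n} \<Longrightarrow> j \<in> {1..n} \<Longrightarrow> i \<noteq> j \<Longrightarrow> 0 \<le> v i j \<and> v i j \<le> 1 / 4"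
    and mgf: "\<And>i j s. i \<in> {1..n} \<Longrightarrow> j \<in> {1..n} \<Longrightarrow> i \<noteq> j \<Longrightarrow> \<bar>s\<bar> \<le> K \<Longrightarrow>
      measure_pmf.expectation Q (\<lambda>\<omega>. exp (s * (X i j \<omega> - \<mu> i j))) \<le> exp (s\<^sup>2 * v i j / K)"
    and indep_column: "\<And>j s. j \<in> {1..n} \<Longrightarrow>
      measure_pmf.expectation Q (\<lambda>\<omega>. \<Prod>i\<in>{1..n} - {j}. exp (s i * (X i j \<omega> - \<mu> i j)))
      = (\<Prod>i\<in>{1..n} - {j}. measure_pmf.expectation Q (\<lambda>\<omega>. exp (s i * (X i j \<omega> - \<mu> i j))))"
    and indep_overlap: "\<And>i k. i \<in> {1..n} \<Longrightarrow> k \<in> {1..n} \<Longrightarrow> i \<noteq> k \<Longrightarrow>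
      measure_pmf.expectation Q (\<lambda>\<omega>. \<Prod>j\<in>{1..n} - {i, k}. exp (- min (X i j \<omega>) (X k j \<omega>)))
      = (\<Prod>j\<in>{1..n} - {i, k}. measure_pmf.expectation Q (\<lambda>\<omega>. exp (- min (X i j \<omega>) (X k j \<omega>))))"
    and indep_mult: "\<And>i j k. i \<in> {1..n} \<Longrightarrow> j \<in> {1..n} \<Longrightarrow> k \<in> {1..n} \<Longrightarrow> i \<noteq> j \<Longrightarrow> k \<noteq> j \<Longrightarrow> i \<noteq> k \<Longrightarrow>
      measure_pmf.expectation Q (\<lambda>\<omega>. X i j \<omega> * X k j \<omega>) = \<mu> i j * \<mu> k j"
begin

lemma integrable [simp]: "integrable (measure_pmf Q) (f :: 'a \<Rightarrow> real)"
  by (rule integrable_measure_pmf_finite[OF fin])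

lemma mgf_column:
  assumes j: "j \<in> {1..n}" and s: "\<And>i. i \<in> {1..n} - {j} \<Longrightarrow> \<bar>s i\<bar> \<le> K"
  shows "measure_pmf.expectation Q (\<lambda>\<omega>. exp (\<Sum>i\<in>{1..n} - {j}. s i * (X i j \<omega> - \<mu> i j)))
           \<le> exp ((\<Sum>i\<in>{1..n} - {j}. (s i)\<^sup>2 * v i j) / K)"
proof -
  have "measure_pmf.expectation Q (\<lambda>\<omega>. exp (\<Sum>i\<in>{1..n} - {j}. s i * (X i j \<omega> - \<mu> i j)))
      = (\<Prod>i\<in>{1..n} - {j}. measure_pmf.expectation Q (\<lambda>\<omega>. exp (s i * (X i j \<omega> - \<mu> i j))))"
    unfolding indep_column[OF j, symmetric] by (subst exp_sum) simp_all
  also have "\<dots> \<le> (\<Prod>i\<in>{1..n} - {j}. exp ((s i)\<^sup>2 * v i j / K))"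
    using j s mgf by (intro prod_mono conjI Bochner_Integration.integral_nonneg) auto
  also have "\<dots> = exp ((\<Sum>i\<in>{1..n} - {j}. (s i)\<^sup>2 * v i j) / K)"
    unfolding sum_divide_distrib by (rule exp_sum[symmetric]) simp
  finally show ?thesis .
qed

text \<open>Chernoff's bound for both signs, with parameter \<open>l\<close>; the condition
  \<open>l * a i \<le> K\<close> keeps every factor in the range where the moment generating
  function is controlled.\<close>

lemma column_tail:
  assumes j: "j \<in> {1..n}" and l: "l \<ge> 0"
    and a: "\<And>i. i \<in> {1..n} - {j} \<Longrightarrow> 0 \<le> a i \<and> l * a i \<le> K"
    and W: "(\<Sum>i\<in>{1..n} - {j}. (a i)\<^sup>2 * v i j) \<le> W"
  shows "measure_pmf.prob Q {\<omega>. x \<le> \<bar>\<Sum>i\<in>{1..n} - {j}. a i * (X i j \<omega> - \<mu> i j)\<bar>}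
           \<le> 2 * exp (l\<^sup>2 * W / K - l * x)"
proof -
  let ?S = "\<lambda>\<omega>. \<Sum>i\<in>{1..n} - {j}. a i * (X i j \<omega> - \<mu> i j)"
  have one_sided: "measure_pmf.prob Q {\<omega>. l * x \<le> \<epsilon> * l * ?S \<omega>} \<le> exp (l\<^sup>2 * W / K - l * x)"
    if \<epsilon>: "\<epsilon> = 1 \<or> \<epsilon> = -1" for \<epsilon> :: real
  proof (rule pmf_Chernoff[OF fin])
    have "measure_pmf.expectation Q (\<lambda>\<omega>. exp (\<epsilon> * l * ?S \<omega>))
        = measure_pmf.expectation Q (\<lambda>\<omega>. exp (\<Sum>i\<in>{1..n} - {j}. (\<epsilon> * l * a i) * (X i j \<omega> - \<mu> i j)))"
      unfolding sum_distrib_left by (simp add: mult.assoc)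
    also have "\<dots> \<le> exp ((\<Sum>i\<in>{1..n} - {j}. (\<epsilon> * l * a i)\<^sup>2 * v i j) / K)"
      using j a l \<epsilon> by (intro mgf_column) (auto simp: abs_mult)
    also have "(\<Sum>i\<in>{1..n} - {j}. (\<epsilon> * l * a i)\<^sup>2 * v i j) = l\<^sup>2 * (\<Sum>i\<in>{1..n} - {j}. (a i)\<^sup>2 * v i j)"
      using \<epsilon> by (auto simp: power_mult_distrib sum_distrib_left mult.assoc)
    also have "exp (l\<^sup>2 * (\<Sum>i\<in>{1..n} - {j}. (a i)\<^sup>2 * v i j) / K) \<le> exp (l\<^sup>2 * W / K)"
      using W K by (auto intro!: divide_right_mono mult_left_mono)
    finally show "measure_pmf.expectation Q (\<lambda>\<omega>. exp (\<epsilon> * l * ?S \<omega>)) \<le> exp (l\<^sup>2 * W / K)" .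
  qed
  have "{\<omega>. x \<le> \<bar>?S \<omega>\<bar>} \<subseteq> {\<omega>. l * x \<le> 1 * l * ?S \<omega>} \<union> {\<omega>. l * x \<le> (-1) * l * ?S \<omega>}"
  proof
    fix \<omega> assume "\<omega> \<in> {\<omega>. x \<le> \<bar>?S \<omega>\<bar>}"
    then have "x \<le> ?S \<omega> \<or> x \<le> - ?S \<omega>" by auto
    then have "l * x \<le> l * ?S \<omega> \<or> l * x \<le> l * (- ?S \<omega>)" using l mult_left_mono by blast
    then show "\<omega> \<in> {\<omega>. l * x \<le> 1 * l * ?S \<omega>} \<union> {\<omega>. l * x \<le> (-1) * l * ?S \<omega>}" by simp
  qed
  then have "measure_pmf.prob Q {\<omega>. x \<le> \<bar>?S \<omega>\<bar>}
      \<le> measure_pmf.prob Q ({\<omega>. l * x \<le> 1 * l * ?S \<omega>} \<union> {\<omega>. l * x \<le> (-1) * l * ?S \<omega>})"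
    by (intro measure_pmf.finite_measure_mono) auto
  also have "\<dots> \<le> measure_pmf.prob Q {\<omega>. l * x \<le> 1 * l * ?S \<omega>} + measure_pmf.prob Q {\<omega>. l * x \<le> (-1) * l * ?S \<omega>}"
    by (intro measure_Un_le) auto
  also have "\<dots> \<le> exp (l\<^sup>2 * W / K - l * x) + exp (l\<^sup>2 * W / K - l * x)"
    by (intro add_mono one_sided) auto
  finally show ?thesis by simp
qed

text \<open>The moment generating functions at sqrt K and -sqrt K suffice, by |x| \<le> exp x + exp
  (-x). These arguments are admissible because K \<ge> 1, and v \<le> 1/4 bounds each of the two
  values by 2.\<close>

lemma mean_abs_dev:
  assumes ij: "i \<in> {1..n}" "j \<in> {1..n}" "i \<noteq> j"
  shows "measure_pmf.expectation Q (\<lambda>\<omega>. \<bar>X i j \<omega> - \<mu> i j\<bar>) \<le> 4 / sqrt K"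
proof -
  let ?z = "\<lambda>\<omega>. X i j \<omega> - \<mu> i j"
  have s: "\<bar>sqrt K\<bar> \<le> K" "\<bar>- sqrt K\<bar> \<le> K" using K by (auto intro: real_le_lsqrt simp: power2_eq_square)
  have e: "exp ((sqrt K)\<^sup>2 * v i j / K) \<le> 2"
  proof -
    have "exp ((sqrt K)\<^sup>2 * v i j / K) \<le> exp (1 / 4)" using K var[OF ij] by simp
    also have "\<dots> \<le> 2" using exp_le_quadratic[of "1/4"] by (simp add: power2_eq_square)
    finally show ?thesis .
  qed
  have exp_abs: "\<bar>x\<bar> \<le> exp x + exp (- x)" for x :: real
    using exp_ge_add_one_self[of x] exp_ge_add_one_self[of "- x"] exp_gt_zero[of x] exp_gt_zero[of "- x"]
    by linarith
  have "sqrt K * measure_pmf.expectation Q (\<lambda>\<omega>. \<bar>?z \<omega>\<bar>)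
      = measure_pmf.expectation Q (\<lambda>\<omega>. sqrt K * \<bar>?z \<omega>\<bar>)" by simp
  also have "\<dots> \<le> measure_pmf.expectation Q (\<lambda>\<omega>. exp (sqrt K * ?z \<omega>) + exp (- sqrt K * ?z \<omega>))"
  proof (intro integral_mono integrable)
    fix \<omega> show "sqrt K * \<bar>?z \<omega>\<bar> \<le> exp (sqrt K * ?z \<omega>) + exp (- sqrt K * ?z \<omega>)"
      using exp_abs[of "sqrt K * ?z \<omega>"] K by (simp add: abs_mult)
  qed
  also have "\<dots> = measure_pmf.expectation Q (\<lambda>\<omega>. exp (sqrt K * ?z \<omega>))
      + measure_pmf.expectation Q (\<lambda>\<omega>. exp (- sqrt K * ?z \<omega>))"
    by (intro Bochner_Integration.integral_add integrable)
  also have "\<dots> \<le> exp ((sqrt K)\<^sup>2 * v i j / K) + exp ((- sqrt K)\<^sup>2 * v i j / K)"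
    using mgf[OF ij] s by (intro add_mono)
  also have "\<dots> \<le> 4" using e by simp
  finally show ?thesis using K by (simp add: field_simps)
qed

text \<open>For K \<ge> (64 b)^2 each entry is on average within 1 / (16 b) of its mean, and two
  such losses leave half of 1 / (4 b). For smaller K the minimum of two numbers in the unit interval
  is at least their product, whose expectation factors.\<close>

lemma mean_min_ge:
  assumes i: "i \<in> {1..n}" "k \<in> {1..n}" "i \<noteq> k" and j: "j \<in> {1..n} - {i, k}"
    and b: "b \<ge> 1" and \<mu>: "1 / (4 * b) \<le> \<mu> i j" "1 / (4 * b) \<le> \<mu> k j"
  shows "(if 4096 * b\<^sup>2 \<le> K then 1 / (8 * b) else 1 / (16 * b\<^sup>2))
           \<le> measure_pmf.expectation Q (\<lambda>\<omega>. min (X i j \<omega>) (X k j \<omega>))"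
proof (cases "4096 * b\<^sup>2 \<le> K")
  case True
  have "sqrt (4096 * b\<^sup>2) \<le> sqrt K" using True by simp
  then have "64 * b \<le> sqrt K" using b by (simp add: real_sqrt_mult)
  then have "8 / sqrt K \<le> 8 / (64 * b)" using b K by (intro divide_left_mono mult_pos_pos) auto
  then have "1 / (8 * b) \<le> 1 / (4 * b) - 4 / sqrt K - 4 / sqrt K"
    using b by (simp add: field_simps)
  also have "\<dots> \<le> 1 / (4 * b) - measure_pmf.expectation Q (\<lambda>\<omega>. \<bar>X i j \<omega> - \<mu> i j\<bar>)
        - measure_pmf.expectation Q (\<lambda>\<omega>. \<bar>X k j \<omega> - \<mu> k j\<bar>)"
    using i j by (intro diff_mono mean_abs_dev order_refl) auto
  also have "\<dots> = measure_pmf.expectation Q (\<lambda>\<omega>. 1 / (4 * b) - \<bar>X i j \<omega> - \<mu> i j\<bar> - \<bar>X k j \<omega> - \<mu> k j\<bar>)"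
    by simp
  also have "\<dots> \<le> measure_pmf.expectation Q (\<lambda>\<omega>. min (X i j \<omega>) (X k j \<omega>))"
    using \<mu> by (intro integral_mono integrable) (auto simp: min_def)
  finally show ?thesis using True by simp
next
  case False
  have "1 / (16 * b\<^sup>2) = (1 / (4 * b)) * (1 / (4 * b))" by (simp add: power2_eq_square)
  also have "\<dots> \<le> \<mu> i j * \<mu> k j"
  proof (intro mult_mono \<mu>)
    have "0 \<le> 1 / (4 * b)" using b by simp
    then show "0 \<le> \<mu> i j" using \<mu>(1) by linarith
  qed (use b in simp)
  also have "\<dots> = measure_pmf.expectation Q (\<lambda>\<omega>. X i j \<omega> * X k j \<omega>)"
    using i j by (intro indep_mult[symmetric]) auto
  also have "\<dots> \<le> measure_pmf.expectation Q (\<lambda>\<omega>. min (X i j \<omega>) (X k j \<omega>))"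
  proof (intro integral_mono integrable)
    fix \<omega>
    have "0 \<le> X i j \<omega> \<and> X i j \<omega> \<le> 1" "0 \<le> X k j \<omega> \<and> X k j \<omega> \<le> 1"
      using i j X01[of i j \<omega>] X01[of k j \<omega>] by auto
    then show "X i j \<omega> * X k j \<omega> \<le> min (X i j \<omega>) (X k j \<omega>)"
      by (simp add: mult_left_le mult_left_le_one_le)
  qed
  finally show ?thesis using False by simp
qed

end


section \<open>Concentration and error for BTL means with a small bias\<close>

text \<open>Cauchy-Schwarz. Noise of order sqrt (\<pi> j) at coordinate \<open>j\<close> thereby has
  an l1 norm free of powers of b.\<close>

lemma sum_sqrt_le:
  fixes \<pi> :: "'a \<Rightarrow> real"
  assumes "finite V" "\<And>i. i \<in> V \<Longrightarrow> 0 \<le> \<pi> i" "(\<Sum>i\<in>V. \<pi> i) = 1"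
  shows "(\<Sum>i\<in>V. sqrt (\<pi> i)) \<le> sqrt (real (card V))"
proof (rule real_le_rsqrt)
  have "(\<Sum>i\<in>V. sqrt (\<pi> i) * 1)\<^sup>2 \<le> (\<Sum>i\<in>V. (sqrt (\<pi> i))\<^sup>2) * (\<Sum>i\<in>V. 1\<^sup>2)"
    by (rule Cauchy_Schwarz_ineq_sum)
  then show "(\<Sum>i\<in>V. sqrt (\<pi> i))\<^sup>2 \<le> real (card V)"
    using assms by simp
qed

lemma pmf_prob_UN_le:
  assumes "finite I" "\<And>i. i \<in> I \<Longrightarrow> measure_pmf.prob Q (A i) \<le> c" "real (card I) \<le> N" "0 \<le> c"
  shows "measure_pmf.prob Q (\<Union>i\<in>I. A i) \<le> N * c"
proof -
  have "measure_pmf.prob Q (\<Union>i\<in>I. A i) \<le> (\<Sum>i\<in>I. measure_pmf.prob Q (A i))"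
    using assms by (intro measure_UNION_le) auto
  also have "\<dots> \<le> (\<Sum>i\<in>I. c)" using assms by (intro sum_mono)
  also have "\<dots> \<le> N * c" using assms by (simp add: mult_right_mono)
  finally show ?thesis .
qed

text \<open>In the application \<open>m\<close> is the sup norm of \<open>\<pi>\<close> and
  \<open>\<beta>\<close> bounds the bias from nearby times. The factor 2 in \<open>v_le\<close>
  absorbs the effect of that bias on the exact variance of one outcome. The constant in
  \<open>n_large\<close> is chosen to exceed 224^2, which the row sums require.\<close>

locale btl_comparison_matrix = comparison_matrix +
  fixes \<pi> :: "nat \<Rightarrow> real" and m b \<beta> :: real
  assumes n2: "n \<ge> 2"
    and \<pi>_pos: "\<And>i. i \<in> {1..n} \<Longrightarrow> 0 < \<pi> i"
    and \<pi>_sum: "(\<Sum>i\<in>{1..n}. \<pi> i) = 1"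
    and \<pi>_le: "\<And>i. i \<in> {1..n} \<Longrightarrow> \<pi> i \<le> m"
    and m_le: "\<And>i. i \<in> {1..n} \<Longrightarrow> m \<le> b * \<pi> i"
    and b1: "b \<ge> 1"
    and bias: "\<And>i j. i \<in> {1..n} \<Longrightarrow> j \<in> {1..n} \<Longrightarrow> i \<noteq> j \<Longrightarrow> \<bar>\<mu> i j - \<pi> j / (\<pi> i + \<pi> j)\<bar> \<le> \<beta>"
    and \<beta>_le: "\<beta> \<le> 1 / (16 * b)"
    and v_le: "\<And>i j. i \<in> {1..n} \<Longrightarrow> j \<in> {1..n} \<Longrightarrow> i \<noteq> j \<Longrightarrow> v i j \<le> 2 * (\<pi> i * \<pi> j / (\<pi> i + \<pi> j)\<^sup>2)"
    and n_large: "60000 * b\<^sup>2 * ln (real n) \<le> real n"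
begin

lemma n_pos: "0 < real n" and ln_pos: "0 < ln (real n)"
  using n2 by auto

lemma m_pos: "0 < m"
  using \<pi>_pos[of 1] \<pi>_le[of 1] n2 by fastforce

lemma nm_le: "real n * m \<le> b"
proof -
  have "(\<Sum>i\<in>{1..n}. m) \<le> (\<Sum>i\<in>{1..n}. b * \<pi> i)" by (intro sum_mono m_le)
  then show ?thesis by (simp only: sum_distrib_left[symmetric] \<pi>_sum) simp
qed

lemma sq_b: "b \<le> b\<^sup>2"
  using b1 by (simp add: power2_eq_square)

lemma b_le_n: "4 * b \<le> real n" "4 * b\<^sup>2 \<le> real n"
proof -
  have "ln 2 \<le> ln (real n)" using n2 by simp
  then have "1 / 2 \<le> ln (real n)" using ln2_ge_two_thirds by linarith
  then have "b\<^sup>2 * (1 / 2) \<le> b\<^sup>2 * ln (real n)" by (intro mult_left_mono) auto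
  then show "4 * b\<^sup>2 \<le> real n" using n_large zero_le_power2[of b] unfolding mult.assoc by linarith
  then show "4 * b \<le> real n" using sq_b by simp
qed

lemma \<mu>_ge:
  assumes "i \<in> {1..n}" "j \<in> {1..n}" "i \<noteq> j"
  shows "1 / (4 * b) \<le> \<mu> i j"
proof -
  have "\<pi> i \<le> b * \<pi> j" using \<pi>_le[OF assms(1)] m_le[OF assms(2)] by simp
  moreover have "\<pi> j \<le> b * \<pi> j" using \<pi>_pos[OF assms(2)] b1 by simp
  ultimately have "\<pi> i + \<pi> j \<le> 2 * (b * \<pi> j)" by simp
  then have "1 / (2 * b) \<le> \<pi> j / (\<pi> i + \<pi> j)"
    using \<pi>_pos[OF assms(1)] \<pi>_pos[OF assms(2)] b1 by (simp add: field_simps)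
  then have "1 / (2 * b) - 1 / (16 * b) \<le> \<mu> i j" using bias[OF assms] \<beta>_le by simp
  moreover have "1 / (4 * b) \<le> 1 / (2 * b) - 1 / (16 * b)" using b1 by (simp add: field_simps)
  ultimately show ?thesis by simp
qed

text \<open>The expected overlap of two rows per column, as bounded below by
  \<open>mean_min_ge\<close>.\<close>

definition q :: real where
  "q = (if 4096 * b\<^sup>2 \<le> K then 1 / (8 * b) else 1 / (16 * b\<^sup>2))"

lemma q_ge: "1 / (16 * b\<^sup>2) \<le> q"
  using b1 sq_b by (auto simp: q_def intro!: divide_left_mono)

text \<open>The clauses control, in turn, the noise in the stationarity defect, the row sums by
  which the defect is divided, and the overlap that gives the contraction. The level
  \<open>real n * q / 8\<close> is a quarter of the lower bound \<open>real n * q / 2\<close> for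
  the expected overlap.\<close>

definition good :: "'a \<Rightarrow> bool" where
  "good \<omega> \<longleftrightarrow>
     (\<forall>j\<in>{1..n}. \<bar>\<Sum>i\<in>{1..n} - {j}. (\<pi> i + \<pi> j) * (X i j \<omega> - \<mu> i j)\<bar> < 14 * sqrt (\<pi> j * ln (real n) / K)) \<and>
     (\<forall>j\<in>{1..n}. \<bar>\<Sum>i\<in>{1..n} - {j}. X i j \<omega> - \<mu> i j\<bar> < 14 * sqrt (real n * ln (real n) / K)) \<and>
     (\<forall>i\<in>{1..n}. \<forall>k\<in>{1..n}. i \<noteq> k \<longrightarrow> real n * q / 8 < (\<Sum>j\<in>{1..n} - {i, k}. min (X i j \<omega>) (X k j \<omega>)))"

lemma exp_12: "exp (- 12 * ln (real n)) = 1 / real n ^ 12"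
proof -
  have "exp (12 * ln (real n)) = real n ^ 12"
    using exp_of_nat_mult[of 12 "ln (real n)"] n_pos by simp
  then show ?thesis by (simp add: exp_minus divide_inverse)
qed

text \<open>With \<open>l = sqrt (K * ln n / W)\<close> the exponent is 2 ln n - 14 ln n, and the
  condition on \<open>a i\<close> says that this \<open>l\<close> is admissible. The power n^(-12)
  leaves n^(-10) after a union over all pairs of rows.\<close>

lemma column_tail_ln:
  assumes j: "j \<in> {1..n}" and W0: "W > 0"
    and a: "\<And>i. i \<in> {1..n} - {j} \<Longrightarrow> 0 \<le> a i \<and> (a i)\<^sup>2 * ln (real n) \<le> W * K"
    and W: "(\<Sum>i\<in>{1..n} - {j}. (a i)\<^sup>2 * v i j) \<le> 2 * W"
  shows "measure_pmf.prob Q {\<omega>. 14 * sqrt (W * ln (real n) / K) \<le> \<bar>\<Sum>i\<in>{1..n} - {j}. a i * (X i j \<omega> - \<mu> i j)\<bar>}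
           \<le> 2 / real n ^ 12"
proof -
  define l where "l = sqrt (K * ln (real n) / W)"
  have "l * a i \<le> K" if "i \<in> {1..n} - {j}" for i
  proof -
    have "l * a i = sqrt (K * ln (real n) / W * (a i)\<^sup>2)"
      unfolding l_def real_sqrt_mult[of "K * ln (real n) / W"] using a[OF that] by simp
    also have "K * ln (real n) / W * (a i)\<^sup>2 = ((a i)\<^sup>2 * ln (real n)) * (K / W)" by simp
    also have "sqrt \<dots> \<le> sqrt ((W * K) * (K / W))"
      using a[OF that] W0 K by (intro real_sqrt_le_mono mult_right_mono) auto
    also have "(W * K) * (K / W) = K\<^sup>2" using W0 by (simp add: power2_eq_square)
    finally show ?thesis using K by simp
  qed
  moreover have "l \<ge> 0" using K ln_pos W0 by (simp add: l_def)
  ultimately have "measure_pmf.prob Q {\<omega>. 14 * sqrt (W * ln (real n) / K) \<le> \<bar>\<Sum>i\<in>{1..n} - {j}. a i * (X i j \<omega> - \<mu> i j)\<bar>}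
      \<le> 2 * exp (l\<^sup>2 * (2 * W) / K - l * (14 * sqrt (W * ln (real n) / K)))"
    using j a W by (intro column_tail) auto
  also have "l\<^sup>2 * (2 * W) / K = 2 * ln (real n)"
    using K ln_pos W0 by (simp add: l_def)
  also have "l * (14 * sqrt (W * ln (real n) / K)) = 14 * sqrt (K * ln (real n) / W * (W * ln (real n) / K))"
    unfolding l_def real_sqrt_mult by simp
  also have "K * ln (real n) / W * (W * ln (real n) / K) = (ln (real n))\<^sup>2"
    using K W0 by (simp add: power2_eq_square)
  also have "2 * exp (2 * ln (real n) - 14 * sqrt ((ln (real n))\<^sup>2)) = 2 / real n ^ 12"
    using exp_12 ln_pos by simp
  finally show ?thesis .
qed

lemma prob_good: "1 - 5 / real n ^ 10 \<le> measure_pmf.prob Q {\<omega>. good \<omega>}"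
proof -
  let ?V = "{1..n}"
  define B1 where "B1 j = {\<omega>. 14 * sqrt (\<pi> j * ln (real n) / K)
      \<le> \<bar>\<Sum>i\<in>?V - {j}. (\<pi> i + \<pi> j) * (X i j \<omega> - \<mu> i j)\<bar>}" for j
  define B2 where "B2 j = {\<omega>. 14 * sqrt (real n * ln (real n) / K)
      \<le> \<bar>\<Sum>i\<in>?V - {j}. 1 * (X i j \<omega> - \<mu> i j)\<bar>}" for j
  define B3 where "B3 = (\<lambda>(i, k). {\<omega>. (\<Sum>j\<in>?V - {i, k}. min (X i j \<omega>) (X k j \<omega>)) \<le> (real n * q / 2) / 4})"
  define I where "I = {(i, k) \<in> ?V \<times> ?V. i \<noteq> k}"
  have B1: "measure_pmf.prob Q (B1 j) \<le> 2 / real n ^ 12" if j: "j \<in> ?V" for j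
    unfolding B1_def
  proof (rule column_tail_ln[OF j \<pi>_pos[OF j]])
    fix i assume i: "i \<in> ?V - {j}"
    have "(\<pi> i + \<pi> j)\<^sup>2 \<le> (2 * m)\<^sup>2"
      using \<pi>_le[of i] \<pi>_le[OF j] \<pi>_pos[of i] \<pi>_pos[OF j] i by (intro power_mono) auto
    also have "\<dots> = 4 * m * m" by (simp add: power2_eq_square)
    also have "\<dots> \<le> 4 * m * (b * \<pi> j)" using m_pos m_le[OF j] by (intro mult_left_mono) auto
    finally have "(\<pi> i + \<pi> j)\<^sup>2 * ln (real n) \<le> 4 * m * (b * \<pi> j) * ln (real n)"
      using ln_pos by (intro mult_right_mono) auto
    also have "\<dots> = \<pi> j * (4 * b * m * ln (real n))" by simp
    also have "\<dots> \<le> \<pi> j * 1"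
    proof (intro mult_left_mono)
      have "real n * (4 * b * m * ln (real n)) = 4 * b * ln (real n) * (real n * m)" by simp
      also have "\<dots> \<le> 4 * b * ln (real n) * b" using nm_le b1 ln_pos by (intro mult_left_mono) auto
      also have "\<dots> = 4 * (b\<^sup>2 * ln (real n))" by (simp add: power2_eq_square)
      also have "\<dots> \<le> real n * 1"
        using n_large mult_nonneg_nonneg[of "b\<^sup>2" "ln (real n)"] ln_pos by simp
      finally show "4 * b * m * ln (real n) \<le> 1" using n_pos by simp
    qed (use \<pi>_pos[OF j] in simp)
    also have "\<dots> \<le> \<pi> j * K" using \<pi>_pos[OF j] K by (intro mult_left_mono) auto
    finally show "0 \<le> \<pi> i + \<pi> j \<and> (\<pi> i + \<pi> j)\<^sup>2 * ln (real n) \<le> \<pi> j * K"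
      using \<pi>_pos[of i] \<pi>_pos[OF j] i by auto
  next
    \<comment> \<open>The variance cancels the squared weight, so the sum is at most
      \<open>2 * \<pi> j\<close>. With \<open>1 / 4\<close> in place of \<open>v i j\<close> it
      could be larger by a factor of order \<open>b\<close>.\<close>
    have "(\<Sum>i\<in>?V - {j}. (\<pi> i + \<pi> j)\<^sup>2 * v i j) \<le> (\<Sum>i\<in>?V - {j}. 2 * \<pi> j * \<pi> i)"
    proof (intro sum_mono)
      fix i assume i: "i \<in> ?V - {j}"
      then have "\<pi> i + \<pi> j \<noteq> 0" using \<pi>_pos[of i] \<pi>_pos[OF j] by auto
      have "(\<pi> i + \<pi> j)\<^sup>2 * v i j \<le> (\<pi> i + \<pi> j)\<^sup>2 * (2 * (\<pi> i * \<pi> j / (\<pi> i + \<pi> j)\<^sup>2))"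
        using i j by (intro mult_left_mono v_le) auto
      also have "\<dots> = 2 * \<pi> j * \<pi> i" using \<open>\<pi> i + \<pi> j \<noteq> 0\<close> by simp
      finally show "(\<pi> i + \<pi> j)\<^sup>2 * v i j \<le> 2 * \<pi> j * \<pi> i" .
    qed
    also have "\<dots> \<le> (\<Sum>i\<in>?V. 2 * \<pi> j * \<pi> i)"
      using \<pi>_pos[OF j] \<pi>_pos by (intro sum_mono2) (auto intro!: mult_nonneg_nonneg less_imp_le)
    also have "\<dots> = 2 * \<pi> j" by (simp only: sum_distrib_left[symmetric] \<pi>_sum mult_1_right)
    finally show "(\<Sum>i\<in>?V - {j}. (\<pi> i + \<pi> j)\<^sup>2 * v i j) \<le> 2 * \<pi> j" .
  qed
  have B2: "measure_pmf.prob Q (B2 j) \<le> 2 / real n ^ 12" if j: "j \<in> ?V" for j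
    unfolding B2_def
  proof (rule column_tail_ln[OF j n_pos])
    have "ln (real n) \<le> real n * 1" using n_pos ln_le_minus_one[of "real n"] by linarith
    also have "\<dots> \<le> real n * K" using K by (intro mult_left_mono) auto
    finally show "0 \<le> (1::real) \<and> 1\<^sup>2 * ln (real n) \<le> real n * K" by simp
    have "(\<Sum>i\<in>?V - {j}. 1\<^sup>2 * v i j) \<le> (\<Sum>i\<in>?V - {j}. 1 / 4)"
      using var j by (intro sum_mono) auto
    also have "\<dots> \<le> (\<Sum>i\<in>?V. 1 / 4)" by (intro sum_mono2) auto
    finally show "(\<Sum>i\<in>?V - {j}. 1\<^sup>2 * v i j) \<le> 2 * real n" by simp
  qed
  have B3: "measure_pmf.prob Q (B3 e) \<le> 1 / real n ^ 12" if e: "e \<in> I" for e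
  proof -
    obtain i k where e': "e = (i, k)" "i \<in> ?V" "k \<in> ?V" "i \<noteq> k" using e by (auto simp: I_def)
    have "measure_pmf.prob Q (B3 e) \<le> exp (- (real n * q / 2) / 4)"
      unfolding B3_def e'(1) prod.case
    proof (rule lower_tail_prod[OF fin])
      show "0 \<le> min (X i j \<omega>) (X k j \<omega>) \<and> min (X i j \<omega>) (X k j \<omega>) \<le> 1" if "j \<in> ?V - {i, k}" for j \<omega>
        using X01[of i j \<omega>] X01[of k j \<omega>] e' that by auto
      have q0: "0 \<le> q" using b1 by (simp add: q_def)
      \<comment> \<open>Omitting the columns \<open>i\<close> and \<open>k\<close> costs at most
        half of them, because \<open>n \<ge> 4\<close>.\<close>
      have "real n * q / 2 \<le> (\<Sum>j\<in>?V - {i, k}. q)"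
      proof -
        have "card (?V - {i, k}) = n - 2" using e' by (subst card_Diff_subset) auto
        moreover have "4 \<le> real n" using b_le_n b1 by linarith
        then have "real n / 2 * q \<le> real (n - 2) * q" using q0 by (intro mult_right_mono) auto
        ultimately show ?thesis by simp
      qed
      also have "\<dots> \<le> (\<Sum>j\<in>?V - {i, k}. measure_pmf.expectation Q (\<lambda>\<omega>. min (X i j \<omega>) (X k j \<omega>)))"
        unfolding q_def using e' b1 by (intro sum_mono mean_min_ge \<mu>_ge) auto
      finally show "real n * q / 2 \<le> (\<Sum>j\<in>?V - {i, k}. measure_pmf.expectation Q (\<lambda>\<omega>. min (X i j \<omega>) (X k j \<omega>)))" .
    qed (use e' indep_overlap in auto)
    also have "\<dots> \<le> exp (- 12 * ln (real n))"
    proof -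
      \<comment> \<open>1536 = 96 * 16: the exponent \<open>real n * q / 8\<close> must reach
        \<open>12 * ln (real n)\<close>, and \<open>q\<close> is at least
        \<open>1 / (16 * b\<^sup>2)\<close>.\<close>
      have "1536 * b\<^sup>2 * ln (real n) \<le> real n" using n_large ln_pos mult_nonneg_nonneg[of "b\<^sup>2" "ln (real n)"] by simp
      then have "96 * ln (real n) \<le> real n * (1 / (16 * b\<^sup>2))" using b1 by (simp add: field_simps)
      also have "\<dots> \<le> real n * q" using q_ge by (intro mult_left_mono) auto
      finally show ?thesis by simp
    qed
    finally show ?thesis unfolding exp_12 .
  qed
  have "card I \<le> card (?V \<times> ?V)" by (intro card_mono) (auto simp: I_def)
  then have I: "real (card I) \<le> real n ^ 2" "finite I"
    by (auto simp: I_def power2_eq_square simp flip: of_nat_mult intro: finite_subset[of _ "?V \<times> ?V"])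
  have "measure_pmf.prob Q {\<omega>. \<not> good \<omega>} \<le> measure_pmf.prob Q ((\<Union>j\<in>?V. B1 j) \<union> ((\<Union>j\<in>?V. B2 j) \<union> (\<Union>e\<in>I. B3 e)))"
    by (intro measure_pmf.finite_measure_mono)
       (auto simp: good_def B1_def B2_def B3_def I_def not_less simp del: atLeastAtMost_iff)
  also have "\<dots> \<le> measure_pmf.prob Q (\<Union>j\<in>?V. B1 j)
      + (measure_pmf.prob Q (\<Union>j\<in>?V. B2 j) + measure_pmf.prob Q (\<Union>e\<in>I. B3 e))"
    by (intro order.trans[OF measure_Un_le] add_left_mono measure_Un_le) auto
  also have "\<dots> \<le> real n * (2 / real n ^ 12) + (real n * (2 / real n ^ 12) + real n ^ 2 * (1 / real n ^ 12))"
    using B1 B2 B3 I by (intro add_mono pmf_prob_UN_le) auto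
  also have "\<dots> \<le> real n ^ 2 * (2 / real n ^ 12) + (real n ^ 2 * (2 / real n ^ 12) + real n ^ 2 * (1 / real n ^ 12))"
    using n2 by (intro add_mono mult_right_mono) (auto simp: power2_eq_square)
  also have "\<dots> = 5 / real n ^ 10"
    using n_pos by (simp add: field_simps flip: power_add)
  finally have "measure_pmf.prob Q {\<omega>. \<not> good \<omega>} \<le> 5 / real n ^ 10" .
  moreover have "measure_pmf.prob Q {\<omega>. \<not> good \<omega>} = 1 - measure_pmf.prob Q {\<omega>. good \<omega>}"
    using measure_pmf.prob_compl[of "{\<omega>. good \<omega>}" Q] by (simp add: Collect_neg_eq Compl_eq_Diff_UNIV)
  ultimately show ?thesis by simp
qed

text \<open>The defect splits into noise, of size sqrt (n \<pi> j) \<eta>, and bias, of size (1 + n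
  \<pi> j) \<beta>. Summed over j they give n (14 \<eta> + 2 \<beta>), and individually, by n \<pi>
  j \<le> b, they give b (14 \<eta> + 2 \<beta>). The row sums are at least 1 / (8 m), which
  produces the factor m and hence a bound on the relative error.\<close>

lemma good_stationary:
  assumes good: "good \<omega>" and d: "d \<ge> real n"
    and P_off: "\<And>i j. i \<in> {1..n} \<Longrightarrow> j \<in> {1..n} \<Longrightarrow> i \<noteq> j \<Longrightarrow> P i j = X i j \<omega> / d"
    and P_diag: "\<And>i. i \<in> {1..n} \<Longrightarrow> P i i = 1 - (\<Sum>k\<in>{1..n} - {i}. P i k)"
  defines "\<eta> \<equiv> sqrt (ln (real n) / (real n * K))"
  shows "\<exists>!\<rho>. stationary_distribution n P \<rho>"
    and "stationary_distribution n P \<rho> \<Longrightarrow> j \<in> {1..n} \<Longrightarrow>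
           \<bar>\<rho> j - \<pi> j\<bar> \<le> 8 * m * (8 * (14 * \<eta> + 2 * \<beta>) / q + b * (14 * \<eta> + 2 * \<beta>))"
proof -
  let ?V = "{1..n}"
  have \<beta>0: "0 \<le> \<beta>"
    using bias[of 1 2] n2 by (auto intro: order.trans[OF abs_ge_zero])
  have \<eta>0: "0 \<le> \<eta>" using K ln_pos n_pos by (simp add: \<eta>_def)
  have q0: "0 < q" using b1 by (simp add: q_def)
  define r where "r j = (\<Sum>i\<in>?V - {j}. (\<pi> i + \<pi> j) * (X i j \<omega> - \<pi> j / (\<pi> i + \<pi> j)))" for j
  have n\<eta>: "sqrt (real n * ln (real n) / K) = real n * \<eta>"
  proof -
    have "real n * ln (real n) / K = (real n)\<^sup>2 * (ln (real n) / (real n * K))"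
      using n_pos by (simp add: power2_eq_square)
    then show ?thesis using n_pos by (simp only: real_sqrt_mult \<eta>_def) simp
  qed
  have sqrt_\<eta>: "sqrt (u * ln (real n) / K) = sqrt (real n * u) * \<eta>" for u
  proof -
    have "u * ln (real n) / K = (real n * u) * (ln (real n) / (real n * K))"
      using n_pos by simp
    then show ?thesis by (simp only: real_sqrt_mult \<eta>_def)
  qed
  have r_le: "\<bar>r j\<bar> \<le> 14 * (sqrt (real n * \<pi> j) * \<eta>) + (1 + real n * \<pi> j) * \<beta>" if j: "j \<in> ?V" for j
  proof -
    have "r j = (\<Sum>i\<in>?V - {j}. (\<pi> i + \<pi> j) * (X i j \<omega> - \<mu> i j))
        + (\<Sum>i\<in>?V - {j}. (\<pi> i + \<pi> j) * (\<mu> i j - \<pi> j / (\<pi> i + \<pi> j)))"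
      unfolding r_def sum.distrib[symmetric] by (simp add: algebra_simps)
    moreover have "\<bar>\<Sum>i\<in>?V - {j}. (\<pi> i + \<pi> j) * (\<mu> i j - \<pi> j / (\<pi> i + \<pi> j))\<bar> \<le> (1 + real n * \<pi> j) * \<beta>"
    proof -
      have "\<bar>\<Sum>i\<in>?V - {j}. (\<pi> i + \<pi> j) * (\<mu> i j - \<pi> j / (\<pi> i + \<pi> j))\<bar>
          \<le> (\<Sum>i\<in>?V - {j}. (\<pi> i + \<pi> j) * \<beta>)"
      proof (intro order.trans[OF sum_abs] sum_mono)
        fix i assume i: "i \<in> ?V - {j}"
        then have "0 < \<pi> i + \<pi> j" using \<pi>_pos[of i] \<pi>_pos[OF j] by simp
        then show "\<bar>(\<pi> i + \<pi> j) * (\<mu> i j - \<pi> j / (\<pi> i + \<pi> j))\<bar> \<le> (\<pi> i + \<pi> j) * \<beta>"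
          unfolding abs_mult using i j bias[of i j] by (simp add: mult_left_mono)
      qed
      also have "\<dots> \<le> (\<Sum>i\<in>?V. (\<pi> i + \<pi> j) * \<beta>)"
      proof (intro sum_mono2)
        fix i assume "i \<in> ?V - (?V - {j})"
        then show "0 \<le> (\<pi> i + \<pi> j) * \<beta>" using \<pi>_pos[OF j] j \<beta>0 by auto
      qed auto
      also have "\<dots> = (1 + real n * \<pi> j) * \<beta>"
        by (simp only: sum_distrib_right[symmetric] sum.distrib \<pi>_sum) simp
      finally show ?thesis .
    qed
    moreover have "\<bar>\<Sum>i\<in>?V - {j}. (\<pi> i + \<pi> j) * (X i j \<omega> - \<mu> i j)\<bar> \<le> 14 * (sqrt (real n * \<pi> j) * \<eta>)"
      using good j unfolding good_def sqrt_\<eta> by (auto intro: less_imp_le)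
    ultimately show ?thesis by linarith
  qed
  define R1 where "R1 = real n * (14 * \<eta> + 2 * \<beta>)"
  define R where "R = b * (14 * \<eta> + 2 * \<beta>)"
  have R1: "(\<Sum>j\<in>?V. \<bar>r j\<bar>) \<le> R1"
  proof -
    have "(\<Sum>j\<in>?V. \<bar>r j\<bar>) \<le> (\<Sum>j\<in>?V. 14 * (sqrt (real n * \<pi> j) * \<eta>) + (1 + real n * \<pi> j) * \<beta>)"
      by (intro sum_mono r_le)
    also have "\<dots> = 14 * \<eta> * sqrt (real n) * (\<Sum>j\<in>?V. sqrt (\<pi> j)) + real n * \<beta> + real n * \<beta> * (\<Sum>j\<in>?V. \<pi> j)"
    proof -
      have "(\<Sum>j\<in>?V. 14 * (sqrt (real n * \<pi> j) * \<eta>) + (1 + real n * \<pi> j) * \<beta>)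
          = (\<Sum>j\<in>?V. 14 * \<eta> * sqrt (real n) * sqrt (\<pi> j) + \<beta> + real n * \<beta> * \<pi> j)"
        by (intro sum.cong refl) (simp add: real_sqrt_mult algebra_simps)
      then show ?thesis unfolding sum.distrib sum_distrib_left[symmetric] by simp
    qed
    also have "\<dots> \<le> 14 * \<eta> * sqrt (real n) * sqrt (real n) + real n * \<beta> + real n * \<beta>"
      using sum_sqrt_le[of ?V \<pi>] \<pi>_pos \<pi>_sum \<eta>0
      by (intro add_mono mult_left_mono) (auto intro: less_imp_le simp del: One_nat_def)
    also have "\<dots> = R1" by (simp add: R1_def algebra_simps)
    finally show ?thesis .
  qed
  have R: "\<bar>r j\<bar> \<le> R" if j: "j \<in> ?V" for j
  proof -
    have nb: "real n * \<pi> j \<le> b"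
      by (rule order.trans[OF mult_left_mono[OF \<pi>_le[OF j]] nm_le]) simp
    also have "b \<le> b\<^sup>2" by (rule sq_b)
    finally have "sqrt (real n * \<pi> j) \<le> b" using b1 by (intro real_le_lsqrt) auto
    then have "14 * (sqrt (real n * \<pi> j) * \<eta>) + (1 + real n * \<pi> j) * \<beta> \<le> 14 * (b * \<eta>) + (b + b) * \<beta>"
      using nb b1 \<eta>0 \<beta>0 by (intro add_mono mult_left_mono mult_right_mono) auto
    then show ?thesis using r_le[OF j] by (simp add: R_def algebra_simps)
  qed
  have overlap: "real n * q / 8 \<le> (\<Sum>j\<in>?V - {i, k}. min (X i j \<omega>) (X k j \<omega>))"
    if "i \<in> ?V" "k \<in> ?V" "i \<noteq> k" for i k
    using good that unfolding good_def by (auto intro: less_imp_le)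
  \<comment> \<open>The exact row sum of \<pi> i / (\<pi> i + \<pi> j) is at least (1 - \<pi> j) /
    (2 m) \<ge> 1 / (4 m); noise and bias take at most 1 / (16 m) each.\<close>
  have rowsum: "1 / (8 * m) \<le> (\<Sum>i\<in>?V - {j}. X j i \<omega>)" if j: "j \<in> ?V" for j
  proof -
    have nb: "real n / b \<le> 1 / m" using nm_le m_pos b1 by (simp add: field_simps)
    have "\<pi> j \<le> 1 / 2"
    proof -
      have "\<pi> j \<le> m" by (rule \<pi>_le[OF j])
      also have "m \<le> b / real n" using nm_le n_pos by (simp add: field_simps)
      also have "\<dots> \<le> 1 / 2" using b_le_n b1 n_pos by (simp add: field_simps)
      finally show ?thesis .
    qed
    then have "1 / (4 * m) \<le> (1 - \<pi> j) / (2 * m)" using m_pos by (simp add: field_simps)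
    also have "1 - \<pi> j = (\<Sum>i\<in>?V - {j}. \<pi> i)" using j \<pi>_sum by (subst sum_diff1) auto
    also have "(\<Sum>i\<in>?V - {j}. \<pi> i) / (2 * m) \<le> (\<Sum>i\<in>?V - {j}. 1 - \<mu> i j + \<beta>)"
      unfolding sum_divide_distrib
    proof (intro sum_mono)
      fix i assume i: "i \<in> ?V - {j}"
      have pos: "0 < \<pi> i" "0 < \<pi> j" using i j \<pi>_pos by auto
      have "\<pi> i / (2 * m) \<le> \<pi> i / (\<pi> i + \<pi> j)"
        using pos m_pos \<pi>_le[of i] \<pi>_le[OF j] i by (intro divide_left_mono) auto
      also have "\<dots> = 1 - \<pi> j / (\<pi> i + \<pi> j)" using pos by (simp add: field_simps)
      also have "\<dots> \<le> 1 - \<mu> i j + \<beta>" using bias[of i j] i j by auto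
      finally show "\<pi> i / (2 * m) \<le> 1 - \<mu> i j + \<beta>" .
    qed
    also have "\<dots> = (\<Sum>i\<in>?V - {j}. X j i \<omega>) + (\<Sum>i\<in>?V - {j}. X i j \<omega> - \<mu> i j) + (\<Sum>i\<in>?V - {j}. \<beta>)"
      unfolding sum.distrib[symmetric] using X_swap[of _ j \<omega>] j by (intro sum.cong) auto
    also have "(\<Sum>i\<in>?V - {j}. X i j \<omega> - \<mu> i j) \<le> 14 * sqrt (real n * ln (real n) / K)"
    proof -
      have "\<bar>\<Sum>i\<in>?V - {j}. X i j \<omega> - \<mu> i j\<bar> < 14 * sqrt (real n * ln (real n) / K)"
        using good j unfolding good_def by blast
      then show ?thesis by linarith
    qed
    also have "\<dots> \<le> 1 / (16 * m)"
    proof -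
      \<comment> \<open>50176 = (14 * 16)^2, from the noise level 14 and the allowance 1 / (16
        m).\<close>
      have "50176 * b\<^sup>2 * ln (real n) \<le> real n"
        using n_large mult_nonneg_nonneg[of "b\<^sup>2" "ln (real n)"] ln_pos by simp
      then have "(14 * 16 * b)\<^sup>2 * (real n * ln (real n)) \<le> (real n)\<^sup>2"
        using n_pos by (simp add: power2_eq_square mult_ac)
      moreover have "real n * ln (real n) / K \<le> real n * ln (real n)"
        using K n_pos ln_pos divide_left_mono[of 1 K "real n * ln (real n)"] by simp
      then have "(14 * 16 * b)\<^sup>2 * (real n * ln (real n) / K) \<le> (14 * 16 * b)\<^sup>2 * (real n * ln (real n))"
        by (intro mult_left_mono) auto
      ultimately have "sqrt ((14 * 16 * b)\<^sup>2 * (real n * ln (real n) / K)) \<le> sqrt ((real n)\<^sup>2)"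
        by (intro real_sqrt_le_mono) linarith
      moreover have "sqrt ((14 * 16 * b)\<^sup>2 * (real n * ln (real n) / K)) = 224 * b * sqrt (real n * ln (real n) / K)"
        unfolding real_sqrt_mult[of "(14 * 16 * b)\<^sup>2"] real_sqrt_abs using b1 by simp
      ultimately have "224 * b * sqrt (real n * ln (real n) / K) \<le> real n" by simp
      then have "14 * sqrt (real n * ln (real n) / K) \<le> (real n / b) / 16"
        using b1 by (simp add: field_simps)
      also have "\<dots> \<le> (1 / m) / 16" using nb by (intro divide_right_mono) auto
      finally show ?thesis by simp
    qed
    also have "(\<Sum>i\<in>?V - {j}. \<beta>) \<le> 1 / (16 * m)"
    proof -
      have "(\<Sum>i\<in>?V - {j}. \<beta>) \<le> (\<Sum>i\<in>?V. \<beta>)" using \<beta>0 by (intro sum_mono2) auto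
      also have "\<dots> \<le> real n * (1 / (16 * b))" using mult_left_mono[OF \<beta>_le, of "real n"] by simp
      also have "\<dots> = (real n / b) / 16" by simp
      also have "\<dots> \<le> (1 / m) / 16" using nb by (intro divide_right_mono) auto
      finally show ?thesis by simp
    qed
    finally have "1 / (4 * m) \<le> (\<Sum>i\<in>?V - {j}. X j i \<omega>) + 1 / (16 * m) + 1 / (16 * m)" by simp
    moreover have "1 / (4 * m) = 4 * (1 / (16 * m))" "1 / (8 * m) = 2 * (1 / (16 * m))" using m_pos by auto
    ultimately show ?thesis by linarith
  qed
  have A: "0 < real n * q / 8" and D: "0 < 1 / (8 * m)" using n_pos q0 m_pos by auto
  note pert = stationary_perturbation[of n d "\<lambda>i j. X i j \<omega>" P \<pi> "real n * q / 8" "1 / (8 * m)" R1 R,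
      OF n2 d X01 X_swap P_off P_diag \<pi>_pos \<pi>_sum overlap A rowsum D R1[unfolded r_def] R[unfolded r_def]]
  show "\<exists>!\<rho>. stationary_distribution n P \<rho>" by (rule pert(1))
  assume "stationary_distribution n P \<rho>" "j \<in> ?V"
  then have "\<bar>\<rho> j - \<pi> j\<bar> \<le> (R1 / (real n * q / 8) + R) / (1 / (8 * m))" by - (rule pert(2))
  also have "\<dots> = 8 * m * (8 * (14 * \<eta> + 2 * \<beta>) / q + b * (14 * \<eta> + 2 * \<beta>))"
    using n_pos q0 m_pos by (simp add: R1_def R_def field_simps)
  finally show "\<bar>\<rho> j - \<pi> j\<bar> \<le> 8 * m * (8 * (14 * \<eta> + 2 * \<beta>) / q + b * (14 * \<eta> + 2 * \<beta>))" .
qed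

end

subsection \<open>Outcomes on fixed graphs\<close>

lemma finite_grid: "finite (grid T)"
  by (simp add: grid_def)

lemma grid_subset: "T \<ge> 1 \<Longrightarrow> grid T \<subseteq> {0..1}"
  by (auto simp: grid_def)

lemma btl_prob_swap:
  assumes "w s i > 0" "w s j > 0"
  shows "btl_prob w s j i = 1 - btl_prob w s i j"
  using assms by (simp add: btl_prob_def field_simps)

lemma btl_prob_bounds:
  assumes "w s i > 0" "w s j > 0"
  shows "0 \<le> btl_prob w s i j" "btl_prob w s i j \<le> 1"
  using assms by (auto simp: btl_prob_def)

text \<open>The graphs are fixed here, so that the outcomes are the only randomness. Each pair is
  compared at no fewer than \<open>k\<close> times of the neighborhood, hence
  \<open>real L * k\<close> takes the role of \<open>K\<close>.\<close>

locale btl_sample =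
  fixes n T L :: nat and w :: "real \<Rightarrow> nat \<Rightarrow> real" and G :: "real \<Rightarrow> nat set set" and \<delta> t k :: real
  assumes T: "T \<ge> 1" and L: "L \<ge> 1" and k: "k > 0" and Lk: "real L * k \<ge> 1"
    and w_pos: "\<And>s i. s \<in> {0..1} \<Longrightarrow> i \<in> {1..n} \<Longrightarrow> w s i > 0"
    and card_nbhd: "\<And>i j. i \<in> {1..n} \<Longrightarrow> j \<in> {1..n} \<Longrightarrow> i \<noteq> j \<Longrightarrow> k \<le> real (card (nbhd_edge T G \<delta> t i j))"
begin

abbreviation "V \<equiv> {1..n}"
abbreviation "N i j \<equiv> nbhd_edge T G \<delta> t i j"

definition I where "I = comparisons n T L G"

definition Q where "Q = outcomes_law n T L w G"

definition X :: "nat \<Rightarrow> nat \<Rightarrow> outcomes \<Rightarrow> real" where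
  "X i j Y = (1 / real (card (N i j))) * (\<Sum>t'\<in>N i j. outcome_mean L Y t' i j)"

definition \<mu> where "\<mu> i j = (1 / real (card (N i j))) * (\<Sum>t'\<in>N i j. btl_prob w t' i j)"

definition v where
  "v i j = (1 / real (card (N i j))) * (\<Sum>t'\<in>N i j. btl_prob w t' i j * (1 - btl_prob w t' i j))"

text \<open>The coordinates of the outcome function that \<open>X i j\<close> reads;
  \<open>min\<close> and \<open>max\<close> give the ordering under which a pair is stored.\<close>

definition block where
  "block i j = (\<lambda>(t', l). (t', min i j, max i j, l)) ` (N i j \<times> {1..L})"

lemma N_grid: "N i j \<subseteq> grid T"
  by (auto simp: nbhd_edge_def nbhd_def)

lemma finite_N: "finite (N i j)"
  using finite_subset[OF N_grid finite_grid] .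

lemma N_commute: "N j i = N i j"
  by (simp add: nbhd_edge_def insert_commute)

lemma N_unit: "s \<in> N i j \<Longrightarrow> s \<in> {0..1}"
  using N_grid grid_subset[OF T] by blast

lemma card_pos: "i \<in> V \<Longrightarrow> j \<in> V \<Longrightarrow> i \<noteq> j \<Longrightarrow> 0 < real (card (N i j))"
  using card_nbhd k by fastforce

lemma finite_I: "finite I"
proof -
  have "I \<subseteq> grid T \<times> V \<times> V \<times> {1..L}" by (auto simp: I_def comparisons_def)
  then show ?thesis by (rule finite_subset) (auto simp: finite_grid)
qed

lemma Q_eq: "Q = Pi_pmf I False (\<lambda>(t', i, j, l). bernoulli_pmf (btl_prob w t' i j))"
  by (simp add: Q_def outcomes_law_def I_def)

lemma fin_bernoulli: "finite (set_pmf (case x of (t', i, j, l) \<Rightarrow> bernoulli_pmf (btl_prob w t' i j)))"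
  for x :: "real \<times> nat \<times> nat \<times> nat"
  by (rule finite_subset[OF subset_UNIV]) simp

lemma finite_Q: "finite (set_pmf Q)"
  unfolding Q_eq by (intro finite_set_Pi_pmf finite_I fin_bernoulli)

lemma integrable_Q: "integrable (measure_pmf Q) (f :: _ \<Rightarrow> real)"
  by (rule integrable_measure_pmf_finite[OF finite_Q])

lemma block_subset: "i \<in> V \<Longrightarrow> j \<in> V \<Longrightarrow> i \<noteq> j \<Longrightarrow> block i j \<subseteq> I"
  by (auto simp: block_def I_def comparisons_def nbhd_edge_def nbhd_def min_def max_def insert_commute)

lemma block_disjoint: "{i, j} \<noteq> {i', j'} \<Longrightarrow> block i j \<inter> block i' j' = {}"
  by (auto simp: block_def min_def max_def split: if_splits)

lemma X_cong:
  assumes "i \<noteq> j" "\<And>x. x \<in> block i j \<Longrightarrow> Y x = Y' x"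
  shows "X i j Y = X i j Y'"
proof -
  have "outcome_value Y t' i j l = outcome_value Y' t' i j l" if "t' \<in> N i j" "l \<in> {1..L}" for t' l
  proof -
    have "(t', min i j, max i j, l) \<in> block i j" using that by (force simp: block_def)
    from assms(2)[OF this] show ?thesis using assms(1) by (auto simp: outcome_value_def min_def max_def)
  qed
  then show ?thesis by (simp add: X_def outcome_mean_def)
qed

lemma X_swap:
  assumes "i \<in> V" "j \<in> V" "i \<noteq> j"
  shows "X j i Y = 1 - X i j Y"
proof -
  have val: "outcome_value Y t' j i l = 1 - outcome_value Y t' i j l" for t' l
    using assms(3) by (auto simp: outcome_value_def)
  have mean: "outcome_mean L Y t' j i = 1 - outcome_mean L Y t' i j" for t'
    using L by (simp add: outcome_mean_def val sum_subtractf right_diff_distrib)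
  show ?thesis
    using card_pos[OF assms] by (simp add: X_def N_commute[of j i] mean sum_subtractf right_diff_distrib)
qed

lemma X01:
  assumes "i \<in> V" "j \<in> V" "i \<noteq> j"
  shows "0 \<le> X i j Y \<and> X i j Y \<le> 1"
proof -
  have val: "0 \<le> outcome_value Y t' i j l" "outcome_value Y t' i j l \<le> 1" for t' l
    by (auto simp: outcome_value_def of_bool_def)
  have mean: "0 \<le> outcome_mean L Y t' i j" "outcome_mean L Y t' i j \<le> 1" for t'
    using val(1) sum_mono[of "{1..L}" "\<lambda>l. outcome_value Y t' i j l" "\<lambda>_. 1"] val(2) L
    by (auto simp: outcome_mean_def sum_nonneg divide_le_eq)
  show ?thesis
    using mean(1) sum_mono[of "N i j" "\<lambda>t'. outcome_mean L Y t' i j" "\<lambda>_. 1"] mean(2) card_pos[OF assms]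
    by (auto simp: X_def sum_nonneg divide_le_eq)
qed

lemma average_swap:
  assumes "i \<in> V" "j \<in> V" "i \<noteq> j"
  shows "\<mu> j i = 1 - \<mu> i j" "v j i = v i j"
proof -
  have p: "btl_prob w t' j i = 1 - btl_prob w t' i j" if "t' \<in> N i j" for t'
    using that assms N_unit w_pos by (intro btl_prob_swap) auto
  show "\<mu> j i = 1 - \<mu> i j"
    using card_pos[OF assms] by (simp add: \<mu>_def N_commute[of j i] p sum_subtractf right_diff_distrib)
  show "v j i = v i j"
    using p by (simp add: v_def N_commute[of j i] mult.commute)
qed

lemma component_expectation:
  assumes x: "x \<in> I"
  shows "measure_pmf.expectation Q (\<lambda>Y. f (Y x)) =
         measure_pmf.expectation (case x of (t', i, j, l) \<Rightarrow> bernoulli_pmf (btl_prob w t' i j)) (f :: _ \<Rightarrow> real)"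
proof -
  have "measure_pmf.expectation Q (\<lambda>Y. f (Y x)) = measure_pmf.expectation (map_pmf (\<lambda>Y. Y x) Q) f"
    by simp
  then show ?thesis unfolding Q_eq Pi_pmf_component[OF finite_I] using x by simp
qed

text \<open>For \<open>i < j\<close> every outcome is directly a coordinate of \<open>Y\<close>; the
  other order is reduced to this one by \<open>X_swap\<close>.\<close>

lemma X_eq_sum:
  assumes "i < j"
  shows "X i j Y = (\<Sum>(t', l)\<in>N i j \<times> {1..L}. of_bool (Y (t', i, j, l))) / (real L * real (card (N i j)))"
  using assms
  by (simp add: X_def outcome_mean_def outcome_value_def sum.cartesian_product[symmetric]
      sum_divide_distrib[symmetric] sum_distrib_left[symmetric])

lemma \<mu>_eq_sum:
  "\<mu> i j = (\<Sum>(t', l)\<in>N i j \<times> {1..L}. btl_prob w t' i j) / (real L * real (card (N i j)))"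
  using L by (simp add: \<mu>_def sum.cartesian_product[symmetric] sum_distrib_left[symmetric])

lemma v_eq_sum:
  "v i j = (\<Sum>(t', l)\<in>N i j \<times> {1..L}. btl_prob w t' i j * (1 - btl_prob w t' i j)) / (real L * real (card (N i j)))"
  using L by (simp add: v_def sum.cartesian_product[symmetric] sum_distrib_left[symmetric])

lemma mem_I:
  assumes "i \<in> V" "j \<in> V" "i < j" "(t', l) \<in> N i j \<times> {1..L}"
  shows "(t', i, j, l) \<in> I"
  using assms by (auto simp: I_def comparisons_def nbhd_edge_def nbhd_def)

lemma mean_less:
  assumes ij: "i \<in> V" "j \<in> V" "i < j"
  shows "measure_pmf.expectation Q (X i j) = \<mu> i j"
proof -
  have "measure_pmf.expectation Q (X i j)
      = (\<Sum>(t', l)\<in>N i j \<times> {1..L}. measure_pmf.expectation Q (\<lambda>Y. of_bool (Y (t', i, j, l)))) / (real L * real (card (N i j)))"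
    unfolding X_eq_sum[OF ij(3)] by (simp add: case_prod_unfold integrable_Q Bochner_Integration.integral_sum)
  also have "(\<Sum>(t', l)\<in>N i j \<times> {1..L}. measure_pmf.expectation Q (\<lambda>Y. of_bool (Y (t', i, j, l))))
      = (\<Sum>(t', l)\<in>N i j \<times> {1..L}. btl_prob w t' i j)"
  proof (intro sum.cong refl, clarify)
    fix t' l assume tl: "t' \<in> N i j" "l \<in> {1..L}"
    have p: "0 \<le> btl_prob w t' i j" "btl_prob w t' i j \<le> 1"
      using tl ij N_unit w_pos by (auto intro!: btl_prob_bounds)
    show "measure_pmf.expectation Q (\<lambda>Y. of_bool (Y (t', i, j, l))) = btl_prob w t' i j"
      using component_expectation[of "(t', i, j, l)" of_bool] mem_I[OF ij] tl p by simp
  qed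
  finally show ?thesis unfolding \<mu>_eq_sum .
qed

lemma mean:
  assumes "i \<in> V" "j \<in> V" "i \<noteq> j"
  shows "measure_pmf.expectation Q (X i j) = \<mu> i j"
proof (cases "i < j")
  case True
  then show ?thesis using mean_less assms by blast
next
  case False
  have "measure_pmf.expectation Q (X i j) = measure_pmf.expectation Q (\<lambda>Y. 1 - X j i Y)"
    by (intro Bochner_Integration.integral_cong refl X_swap) (use assms in auto)
  also have "\<dots> = 1 - measure_pmf.expectation Q (X j i)" by (simp add: integrable_Q)
  also have "\<dots> = \<mu> i j" using mean_less[of j i] average_swap(1)[of j i] assms False by simp
  finally show ?thesis .
qed

lemma v_nonneg:
  assumes "i \<in> V" "j \<in> V"
  shows "0 \<le> v i j"
proof -
  have "0 \<le> btl_prob w t' i j * (1 - btl_prob w t' i j)" if "t' \<in> N i j" for t'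
    using btl_prob_bounds[of w t' i j] w_pos N_unit that assms by simp
  then show ?thesis by (simp add: v_def sum_nonneg)
qed

lemma average_le:
  assumes "i \<in> V" "j \<in> V" "i \<noteq> j" and c: "\<And>t'. t' \<in> N i j \<Longrightarrow> f t' \<le> c"
  shows "(1 / real (card (N i j))) * (\<Sum>t'\<in>N i j. f t') \<le> c"
proof -
  have "(\<Sum>t'\<in>N i j. f t') \<le> (\<Sum>t'\<in>N i j. c)"
    by (intro sum_mono c)
  then show ?thesis using card_pos[OF assms(1-3)] by (simp add: field_simps)
qed

text \<open>The exponent is a sum of independent centered Bernoulli variables with coefficient
  \<open>s / M\<close>, where \<open>M\<close> is the true number of outcomes of the pair. Since
  \<open>M \<ge> L k\<close>, the coefficient is at most 1 in absolute value, and \<open>M\<close>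
  may be replaced by \<open>L k\<close> in the bound.\<close>

lemma mgf_less:
  assumes ij: "i \<in> V" "j \<in> V" "i < j" and s: "\<bar>s\<bar> \<le> real L * k"
  shows "measure_pmf.expectation Q (\<lambda>Y. exp (s * (X i j Y - \<mu> i j))) \<le> exp (s\<^sup>2 * v i j / (real L * k))"
proof -
  let ?S = "N i j \<times> {1..L}"
  define M where "M = real L * real (card (N i j))"
  have "real L * k \<le> M"
    unfolding M_def using ij by (intro mult_left_mono card_nbhd) auto
  then have M: "real L * k \<le> M" "M > 0" using Lk by auto
  define h where "h = (\<lambda>(t', l) (Y :: outcomes). exp (s / M * (of_bool (Y (t', i, j, l)) - btl_prob w t' i j)))"
  have "measure_pmf.expectation Q (\<lambda>Y. exp (s * (X i j Y - \<mu> i j))) = measure_pmf.expectation Q (\<lambda>Y. \<Prod>x\<in>?S. h x Y)"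
  proof (rule Bochner_Integration.integral_cong[OF refl])
    fix Y
    have "s * (X i j Y - \<mu> i j) = (\<Sum>(t', l)\<in>?S. s / M * (of_bool (Y (t', i, j, l)) - btl_prob w t' i j))"
      unfolding X_eq_sum[OF ij(3)] \<mu>_eq_sum M_def[symmetric]
      by (simp add: case_prod_unfold sum_subtractf sum_distrib_left sum_divide_distrib right_diff_distrib diff_divide_distrib)
    then show "exp (s * (X i j Y - \<mu> i j)) = (\<Prod>x\<in>?S. h x Y)"
      using finite_N by (simp add: exp_sum h_def case_prod_unfold)
  qed
  also have "\<dots> = (\<Prod>x\<in>?S. measure_pmf.expectation Q (h x))"
    unfolding Q_eq
    by (rule expectation_Pi_pmf_prod_blocks[where B = "\<lambda>(t', l). {(t', i, j, l)}"])
       (use finite_I fin_bernoulli finite_N mem_I[OF ij] in \<open>auto simp: h_def\<close>)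
  also have "\<dots> \<le> (\<Prod>(t', l)\<in>?S. exp ((s / M)\<^sup>2 * (btl_prob w t' i j * (1 - btl_prob w t' i j))))"
  proof (intro prod_mono, clarify, intro conjI)
    fix t' l assume tl: "t' \<in> N i j" "l \<in> {1..L}"
    show "0 \<le> measure_pmf.expectation Q (h (t', l))" by (simp add: h_def)
    have p: "0 \<le> btl_prob w t' i j" "btl_prob w t' i j \<le> 1"
      using tl ij N_unit w_pos by (auto intro!: btl_prob_bounds)
    have "measure_pmf.expectation Q (h (t', l))
        = measure_pmf.expectation (bernoulli_pmf (btl_prob w t' i j)) (\<lambda>y. exp (s / M * (of_bool y - btl_prob w t' i j)))"
      using component_expectation[of "(t', i, j, l)" "\<lambda>y. exp (s / M * (of_bool y - btl_prob w t' i j))"] mem_I[OF ij] tl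
      unfolding h_def prod.case by blast
    also have "\<dots> \<le> exp ((s / M)\<^sup>2 * (btl_prob w t' i j * (1 - btl_prob w t' i j)))"
      using p s M by (intro bernoulli_mgf_le) auto
    finally show "measure_pmf.expectation Q (h (t', l)) \<le> exp ((s / M)\<^sup>2 * (btl_prob w t' i j * (1 - btl_prob w t' i j)))" .
  qed
  also have "\<dots> = exp (\<Sum>(t', l)\<in>?S. (s / M)\<^sup>2 * (btl_prob w t' i j * (1 - btl_prob w t' i j)))"
    using finite_N by (simp add: exp_sum case_prod_unfold)
  also have "(\<Sum>(t', l)\<in>?S. (s / M)\<^sup>2 * (btl_prob w t' i j * (1 - btl_prob w t' i j))) = s\<^sup>2 * v i j / M"
    unfolding v_eq_sum M_def[symmetric] using M(2)
    by (simp add: case_prod_unfold sum_distrib_left[symmetric] sum_divide_distrib[symmetric] power2_eq_square)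
  also have "exp (s\<^sup>2 * v i j / M) \<le> exp (s\<^sup>2 * v i j / (real L * k))"
  proof -
    have "0 \<le> v i j" using v_nonneg ij by simp
    then show ?thesis using M Lk by (auto intro!: divide_left_mono)
  qed
  finally show ?thesis .
qed

lemma mgf:
  assumes ij: "i \<in> V" "j \<in> V" "i \<noteq> j" and s: "\<bar>s\<bar> \<le> real L * k"
  shows "measure_pmf.expectation Q (\<lambda>Y. exp (s * (X i j Y - \<mu> i j))) \<le> exp (s\<^sup>2 * v i j / (real L * k))"
proof (cases "i < j")
  case True
  then show ?thesis using mgf_less assms by blast
next
  case False
  have "s * (X i j Y - \<mu> i j) = - s * (X j i Y - \<mu> j i)" for Y
  proof -
    have "X i j Y - \<mu> i j = - (X j i Y - \<mu> j i)"
      using X_swap[OF ij, of Y] average_swap(1)[OF ij] by simp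
    then show ?thesis by (simp add: right_diff_distrib)
  qed
  then show ?thesis
    using mgf_less[of j i "- s"] average_swap(2)[OF ij] False ij s by simp
qed

sublocale comparison_matrix Q n "real L * k" X \<mu> v
proof
  show "finite (set_pmf Q)" by (rule finite_Q)
  show "1 \<le> real L * k" by (rule Lk)
  show "0 \<le> X i j Y \<and> X i j Y \<le> 1" if "i \<in> V" "j \<in> V" "i \<noteq> j" for i j Y
    using that by (rule X01)
  show "X j i Y = 1 - X i j Y" if "i \<in> V" "j \<in> V" "i \<noteq> j" for i j Y
    using that by (rule X_swap)
  show "measure_pmf.expectation Q (X i j) = \<mu> i j" if "i \<in> V" "j \<in> V" "i \<noteq> j" for i j
    using that by (rule mean)
  show "0 \<le> v i j \<and> v i j \<le> 1 / 4" if "i \<in> V" "j \<in> V" "i \<noteq> j" for i j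
  proof -
    have "p * (1 - p) \<le> 1 / 4" for p :: real
      using zero_le_power2[of "p - 1 / 2"] by (simp add: power2_eq_square algebra_simps)
    then have "v i j \<le> 1 / 4" unfolding v_def by (intro average_le that)
    then show ?thesis using v_nonneg that by simp
  qed
  show "measure_pmf.expectation Q (\<lambda>Y. exp (s * (X i j Y - \<mu> i j))) \<le> exp (s\<^sup>2 * v i j / (real L * k))"
    if "i \<in> V" "j \<in> V" "i \<noteq> j" "\<bar>s\<bar> \<le> real L * k" for i j s
    using that by (rule mgf)
  show "measure_pmf.expectation Q (\<lambda>Y. \<Prod>i\<in>V - {j}. exp (s i * (X i j Y - \<mu> i j)))
      = (\<Prod>i\<in>V - {j}. measure_pmf.expectation Q (\<lambda>Y. exp (s i * (X i j Y - \<mu> i j))))" if j: "j \<in> V" for j s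
    unfolding Q_eq
  proof (rule expectation_Pi_pmf_prod_blocks[OF finite_I])
    show "block i j \<subseteq> I" if "i \<in> V - {j}" for i using that j by (intro block_subset) auto
    show "block i j \<inter> block i' j = {}" if "i \<in> V - {j}" "i' \<in> V - {j}" "i \<noteq> i'" for i i'
      using that by (intro block_disjoint) (auto simp: doubleton_eq_iff)
    show "exp (s i * (X i j Y - \<mu> i j)) = exp (s i * (X i j Y' - \<mu> i j))"
      if "i \<in> V - {j}" "\<And>x. x \<in> block i j \<Longrightarrow> Y x = Y' x" for i Y Y'
      using X_cong[of i j Y Y'] that by simp
  qed (use fin_bernoulli in auto)
  show "measure_pmf.expectation Q (\<lambda>Y. \<Prod>j\<in>V - {i, k'}. exp (- min (X i j Y) (X k' j Y)))
      = (\<Prod>j\<in>V - {i, k'}. measure_pmf.expectation Q (\<lambda>Y. exp (- min (X i j Y) (X k' j Y))))"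
    if ik: "i \<in> V" "k' \<in> V" "i \<noteq> k'" for i k'
    unfolding Q_eq
  proof (rule expectation_Pi_pmf_prod_blocks[OF finite_I])
    show "block i j \<union> block k' j \<subseteq> I" if "j \<in> V - {i, k'}" for j
      using that ik block_subset[of i j] block_subset[of k' j] by auto
    \<comment> \<open>Each factor reads two pairs, {i, j} and {k', j}. As j and j' are distinct and
      avoid i and k', these pairs differ from those of the factor for j'.\<close>
    show "(block i j \<union> block k' j) \<inter> (block i j' \<union> block k' j') = {}"
      if "j \<in> V - {i, k'}" "j' \<in> V - {i, k'}" "j \<noteq> j'" for j j'
    proof -
      have "block a j \<inter> block a' j' = {}" if "a \<in> {i, k'}" "a' \<in> {i, k'}" for a a'
        using that \<open>j \<in> V - {i, k'}\<close> \<open>j' \<in> V - {i, k'}\<close> \<open>j \<noteq> j'\<close>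
        by (intro block_disjoint) (auto simp: doubleton_eq_iff)
      then show ?thesis by blast
    qed
    show "exp (- min (X i j Y) (X k' j Y)) = exp (- min (X i j Y') (X k' j Y'))"
      if "j \<in> V - {i, k'}" "\<And>x. x \<in> block i j \<union> block k' j \<Longrightarrow> Y x = Y' x" for j Y Y'
      using X_cong[of i j Y Y'] X_cong[of k' j Y Y'] that by simp
  qed (use fin_bernoulli in auto)
  show "measure_pmf.expectation Q (\<lambda>Y. X i j Y * X k' j Y) = \<mu> i j * \<mu> k' j"
    if ijk: "i \<in> V" "j \<in> V" "k' \<in> V" "i \<noteq> j" "k' \<noteq> j" "i \<noteq> k'" for i j k'
  proof -
    have "measure_pmf.expectation Q (\<lambda>Y. X i j Y * X k' j Y)
        = measure_pmf.expectation Q (X i j) * measure_pmf.expectation Q (X k' j)"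
      unfolding Q_eq
    proof (rule expectation_Pi_pmf_mult[OF finite_I])
      show "block i j \<subseteq> I" "block k' j \<subseteq> I" using block_subset[OF ijk(1,2,4)] block_subset[OF ijk(3,2,5)] .
      show "block i j \<inter> block k' j = {}" using ijk by (intro block_disjoint) (auto simp: doubleton_eq_iff)
      show "X i j Y = X i j Y'" if "\<And>x. x \<in> block i j \<Longrightarrow> Y x = Y' x" for Y Y'
        using ijk(4) that by (rule X_cong)
      show "X k' j Y = X k' j Y'" if "\<And>x. x \<in> block k' j \<Longrightarrow> Y x = Y' x" for Y Y'
        using ijk(5) that by (rule X_cong)
    qed (use fin_bernoulli in auto)
    then show ?thesis using mean ijk by simp
  qed
qed

end

subsection \<open>Random graphs and weights\<close>

text \<open>Clipping the interval of radius \<delta> around tT to [0, T] leaves length at least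
  \<delta>, even when t is an endpoint. It contains at least \<delta> - 1 integers, and \<delta>
  \<ge> 2 makes this at least \<delta> / 2.\<close>

lemma card_nbhd_ge:
  assumes T: "T \<ge> 1" and t: "t \<in> {0..1}" and \<delta>: "2 \<le> \<delta>" "\<delta> \<le> real T"
  shows "\<delta> / 2 \<le> real (card (nbhd T \<delta> t))"
proof -
  define lo hi where "lo = max 0 (t * real T - \<delta>)" and "hi = min (real T) (t * real T + \<delta>)"
  have tT: "0 \<le> t * real T" "t * real T \<le> real T" using t by (auto simp: mult_left_le_one_le)
  have lohi: "0 \<le> lo" "hi \<le> real T" "\<delta> \<le> hi - lo"
    using \<delta> tT by (auto simp: lo_def hi_def max_def min_def)
  let ?S = "{nat \<lceil>lo\<rceil>..nat \<lfloor>hi\<rfloor>}"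
  have "(\<lambda>i. real i / real T) ` ?S \<subseteq> nbhd T \<delta> t"
  proof clarify
    fix i assume i: "i \<in> ?S"
    have "lo \<le> real i" using i by (simp add: nat_le_iff ceiling_le_iff)
    moreover have "real i \<le> hi"
    proof -
      have "int i \<le> \<lfloor>hi\<rfloor>" using i lohi \<delta> by (simp add: le_nat_iff)
      then show ?thesis by (simp add: le_floor_iff)
    qed
    ultimately have "\<bar>t * real T - real i\<bar> \<le> \<delta>" "i \<le> T"
      using lohi by (auto simp: lo_def hi_def)
    moreover have "t - real i / real T = (t * real T - real i) / real T"
      using T by (simp add: field_simps)
    then have "\<bar>t - real i / real T\<bar> = \<bar>t * real T - real i\<bar> / real T"
      by (simp add: abs_divide)
    ultimately show "real i / real T \<in> nbhd T \<delta> t"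
      using T by (auto simp: nbhd_def grid_def divide_right_mono)
  qed
  then have "card ((\<lambda>i. real i / real T) ` ?S) \<le> card (nbhd T \<delta> t)"
    by (intro card_mono) (auto simp: nbhd_def finite_grid)
  moreover have "inj_on (\<lambda>i. real i / real T) ?S" using T by (auto simp: inj_on_def)
  ultimately have "real (card ?S) \<le> real (card (nbhd T \<delta> t))" by (simp only: card_image of_nat_le_iff)
  moreover have "hi - lo - 1 \<le> real (card ?S)"
  proof -
    have "hi - lo - 1 \<le> of_int (\<lfloor>hi\<rfloor> - \<lceil>lo\<rceil> + 1)" by linarith
    also have "\<lfloor>hi\<rfloor> - \<lceil>lo\<rceil> + 1 \<le> int (card ?S)" using lohi by simp linarith
    finally show ?thesis by simp
  qed
  ultimately show ?thesis using lohi \<delta> by linarith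
qed

lemma finite_all_pairs: "finite (all_pairs n)"
  by (rule finite_subset[of _ "Pow {1..n}"]) (auto simp: all_pairs_def)

lemma erdos_renyi_edge:
  assumes "e \<in> all_pairs n"
  shows "map_pmf (\<lambda>g. e \<in> g) (erdos_renyi n q) = bernoulli_pmf q"
proof -
  have "map_pmf (\<lambda>g. e \<in> g) (erdos_renyi n q)
      = map_pmf (\<lambda>f. f e) (Pi_pmf (all_pairs n) False (\<lambda>_. bernoulli_pmf q))"
    using assms by (simp add: erdos_renyi_def map_pmf_comp)
  then show ?thesis using assms by (simp add: Pi_pmf_component[OF finite_all_pairs])
qed

lemma finite_erdos_renyi: "finite (set_pmf (erdos_renyi n q))"
  unfolding erdos_renyi_def set_map_pmf
  by (intro finite_imageI finite_set_Pi_pmf finite_all_pairs finite)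

text \<open>The edge indicators at different times are independent because the graphs form a product
  measure, so the lower tail bound applies to their sum.\<close>

lemma prob_few_comparisons:
  assumes ij: "i \<in> {1..n}" "j \<in> {1..n}" "i \<noteq> j"
    and p: "\<And>t'. t' \<in> grid T \<Longrightarrow> 0 \<le> p t' \<and> p t' \<le> 1"
    and S: "S \<le> (\<Sum>t'\<in>nbhd T \<delta> t. p t')"
  shows "measure_pmf.prob (graphs_law n T p) {G. real (card (nbhd_edge T G \<delta> t i j)) \<le> S / 4} \<le> exp (- S / 4)"
proof -
  let ?N = "nbhd T \<delta> t"
  let ?Z = "\<lambda>t' (G :: real \<Rightarrow> nat set set). of_bool ({i, j} \<in> G t') :: real"
  have N: "?N \<subseteq> grid T" "finite ?N" by (auto simp: nbhd_def finite_grid)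
  have fin: "finite (set_pmf (graphs_law n T p))"
    unfolding graphs_law_def by (intro finite_set_Pi_pmf finite_grid finite_erdos_renyi)
  have pair: "{i, j} \<in> all_pairs n" using ij by (auto simp: all_pairs_def)
  have card: "(\<Sum>t'\<in>?N. ?Z t' G) = real (card (nbhd_edge T G \<delta> t i j))" for G
    using N by (simp add: nbhd_edge_def sum.If_cases of_bool_def Int_def)
  have "measure_pmf.prob (graphs_law n T p) {G. (\<Sum>t'\<in>?N. ?Z t' G) \<le> S / 4} \<le> exp (- S / 4)"
  proof (rule lower_tail_prod[OF fin N(2)])
    show "measure_pmf.expectation (graphs_law n T p) (\<lambda>G. \<Prod>t'\<in>?N. exp (- ?Z t' G))
        = (\<Prod>t'\<in>?N. measure_pmf.expectation (graphs_law n T p) (\<lambda>G. exp (- ?Z t' G)))"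
      unfolding graphs_law_def
      by (rule expectation_Pi_pmf_prod_blocks[OF finite_grid N(2) finite_erdos_renyi, where B = "\<lambda>t'. {t'}"])
         (use N in auto)
    have "measure_pmf.expectation (graphs_law n T p) (?Z t') = p t'" if t': "t' \<in> ?N" for t'
    proof -
      have "map_pmf (\<lambda>G. {i, j} \<in> G t') (graphs_law n T p)
          = map_pmf (\<lambda>g. {i, j} \<in> g) (map_pmf (\<lambda>G. G t') (graphs_law n T p))"
        by (simp add: map_pmf_comp)
      also have "\<dots> = bernoulli_pmf (p t')"
        using t' N by (subst graphs_law_def)
          (auto simp: Pi_pmf_component[OF finite_grid] erdos_renyi_edge[OF pair])
      finally have "measure_pmf.expectation (map_pmf (\<lambda>G. {i, j} \<in> G t') (graphs_law n T p)) of_bool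
          = measure_pmf.expectation (bernoulli_pmf (p t')) (of_bool :: bool \<Rightarrow> real)" by simp
      then show ?thesis using p[of t'] t' N by auto
    qed
    then show "S \<le> (\<Sum>t'\<in>?N. measure_pmf.expectation (graphs_law n T p) (?Z t'))" using S by simp
  qed auto
  then show ?thesis unfolding card .
qed

text \<open>The inner probability is integrated over the good set \<open>A\<close> only. The case
  \<open>\<epsilon> > 1\<close> is separate because the product argument multiplies by
  \<open>1 - \<epsilon>\<close>.\<close>

lemma prob_bind_pmf_ge:
  assumes B: "\<And>x. x \<in> A \<Longrightarrow> 1 - \<epsilon> \<le> measure_pmf.prob (N x) {y. R x y}"
    and A: "1 - \<epsilon>' \<le> measure_pmf.prob M A" and \<epsilon>: "0 \<le> \<epsilon>" "0 \<le> \<epsilon>'"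
  shows "1 - \<epsilon> - \<epsilon>' \<le> measure_pmf.prob (do {x \<leftarrow> M; y \<leftarrow> N x; return_pmf (x, y)}) {(x, y). R x y}"
proof (cases "\<epsilon> \<le> 1")
  case False
  then show ?thesis using \<epsilon> by (auto intro: order.trans[OF _ measure_nonneg])
next
  case True
  let ?D = "do {x \<leftarrow> M; y \<leftarrow> N x; return_pmf (x, y)}"
  have inner: "emeasure (measure_pmf (do {y \<leftarrow> N x; return_pmf (x, y)})) {(x, y). R x y} = emeasure (N x) {y. R x y}" for x
  proof -
    have "emeasure (measure_pmf (do {y \<leftarrow> N x; return_pmf (x, y)})) {(x, y). R x y} = emeasure (map_pmf (Pair x) (N x)) {(x, y). R x y}"
      by (simp add: map_pmf_def)
    also have "\<dots> = emeasure (N x) {y. R x y}" by (simp add: vimage_def)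
    finally show ?thesis .
  qed
  have "ennreal ((1 - \<epsilon>) * measure_pmf.prob M A) = (\<integral>\<^sup>+ x. ennreal (1 - \<epsilon>) * indicator A x \<partial>measure_pmf M)"
    using True by (simp add: nn_integral_cmult_indicator ennreal_mult measure_pmf.emeasure_eq_measure)
  also have "\<dots> \<le> (\<integral>\<^sup>+ x. emeasure (N x) {y. R x y} \<partial>measure_pmf M)"
  proof (intro nn_integral_mono)
    fix x show "ennreal (1 - \<epsilon>) * indicator A x \<le> emeasure (measure_pmf (N x)) {y. R x y}"
      using B[of x] by (cases "x \<in> A") (auto simp: measure_pmf.emeasure_eq_measure ennreal_leI)
  qed
  also have "\<dots> = emeasure ?D {(x, y). R x y}" by (simp only: emeasure_bind_pmf[of M] inner)
  also have "\<dots> = ennreal (measure_pmf.prob ?D {(x, y). R x y})" by (simp add: measure_pmf.emeasure_eq_measure)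
  finally have "(1 - \<epsilon>) * measure_pmf.prob M A \<le> measure_pmf.prob ?D {(x, y). R x y}"
    by (simp add: ennreal_le_iff)
  moreover have "1 - \<epsilon> - \<epsilon>' \<le> (1 - \<epsilon>) * (1 - \<epsilon>')" using \<epsilon> by (simp add: algebra_simps)
  moreover have "(1 - \<epsilon>) * (1 - \<epsilon>') \<le> (1 - \<epsilon>) * measure_pmf.prob M A"
    using True A by (intro mult_left_mono) auto
  ultimately show ?thesis by linarith
qed

lemma cond_number_ge:
  assumes "i \<in> {1..n}" "j \<in> {1..n}"
  shows "w s i / w s j \<le> cond_number n w s"
  unfolding cond_number_def using assms by (intro Max_ge) force+

lemma btl_prob_lower_bound:
  assumes n: "i \<in> {1..n}" "j \<in> {1..n}" "i \<noteq> j" and M: "M \<ge> 0" and smooth: "btl_smooth n M w"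
    and w: "\<And>s i. s \<in> {0..1} \<Longrightarrow> i \<in> {1..n} \<Longrightarrow> w s i > 0"
  shows "\<exists>c>0. \<forall>s\<in>{0..1}. c \<le> btl_prob w s i j"
proof -
  have "continuous_on {0..1} (\<lambda>s. btl_prob w s i j)"
    using n smooth M unfolding btl_smooth_def
    by (intro lipschitz_on_continuous_on[of M] lipschitz_onI) (auto simp: dist_real_def)
  then obtain s0 where s0: "s0 \<in> {0..1}" "\<forall>s\<in>{0..1}. btl_prob w s0 i j \<le> btl_prob w s i j"
    using continuous_attains_inf[of "{0..1::real}" "\<lambda>s. btl_prob w s i j"] by auto
  moreover have "0 < btl_prob w s0 i j"
    using w[OF s0(1)] n by (simp add: btl_prob_def add_pos_pos)
  ultimately show ?thesis by blast
qed

text \<open>A supremum of reals bounds its elements only when the set is bounded above. A ratio of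
  weights is at most the reciprocal of a BTL probability, and that probability is continuous and
  positive on a compact interval, hence bounded away from 0.\<close>

lemma cond_number_le_max:
  assumes n: "n \<ge> 1" and M: "M \<ge> 0" and smooth: "btl_smooth n M w" and t: "t \<in> {0..1}"
    and w: "\<And>s i. s \<in> {0..1} \<Longrightarrow> i \<in> {1..n} \<Longrightarrow> w s i > 0"
  shows "cond_number n w t \<le> cond_number_max n w"
proof -
  let ?V = "{1..n}"
  have "\<exists>B. \<forall>s\<in>{0..1}. (case e of (i, j) \<Rightarrow> w s i / w s j) \<le> B" if e: "e \<in> ?V \<times> ?V" for e
  proof -
    obtain i j where e': "e = (i, j)" "i \<in> ?V" "j \<in> ?V" using e by auto
    show ?thesis
    proof (cases "i = j")
      case True
      then show ?thesis using e' w by (intro exI[of _ 1]) (auto simp: divide_le_eq_1)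
    next
      case False
      obtain c where c: "c > 0" "\<forall>s\<in>{0..1}. c \<le> btl_prob w s i j"
        using btl_prob_lower_bound[OF e'(2,3) False M smooth w] by blast
      have "w s i / w s j \<le> 1 / c" if s: "s \<in> {0..1}" for s
      proof -
        have pos: "w s i > 0" "w s j > 0" using w s e' by auto
        have "w s i / w s j \<le> 1 / btl_prob w s i j" using pos by (simp add: btl_prob_def field_simps)
        also have "\<dots> \<le> 1 / c" using c s by (intro divide_left_mono mult_pos_pos) (auto intro: less_le_trans)
        finally show ?thesis .
      qed
      then show ?thesis using e' by (intro exI[of _ "1 / c"]) simp
    qed
  qed
  then obtain B where B: "\<And>e s. e \<in> ?V \<times> ?V \<Longrightarrow> s \<in> {0..1} \<Longrightarrow> (case e of (i, j) \<Rightarrow> w s i / w s j) \<le> B e"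
    by metis
  have "cond_number n w s \<le> Max (B ` (?V \<times> ?V))" if s: "s \<in> {0..1}" for s
    unfolding cond_number_def
  proof (rule Max.boundedI)
    fix a assume "a \<in> (\<lambda>(i, j). w s i / w s j) ` (?V \<times> ?V)"
    then obtain e where e: "e \<in> ?V \<times> ?V" "a = (case e of (i, j) \<Rightarrow> w s i / w s j)" by auto
    then have "a \<le> B e" using B s by simp
    also have "\<dots> \<le> Max (B ` (?V \<times> ?V))" using e by (intro Max_ge) auto
    finally show "a \<le> Max (B ` (?V \<times> ?V))" .
  qed (use n in auto)
  then have "bdd_above (cond_number n w ` {0..1})" by (rule bdd_aboveI2)
  then show ?thesis unfolding cond_number_max_def using t by (rule cSUP_upper2) simp
qed

subsection \<open>Error given the graphs\<close>

lemma pi_star_props: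
  assumes n: "n \<ge> 2" and w: "\<And>i. i \<in> {1..n} \<Longrightarrow> w t i > 0"
  shows "\<And>i. i \<in> {1..n} \<Longrightarrow> 0 < pi_star n w t i"
    and "(\<Sum>i\<in>{1..n}. pi_star n w t i) = 1"
    and "\<And>i. i \<in> {1..n} \<Longrightarrow> pi_star n w t i \<le> norm_inf n (pi_star n w t)"
    and "\<And>i. i \<in> {1..n} \<Longrightarrow> norm_inf n (pi_star n w t) \<le> cond_number n w t * pi_star n w t i"
    and "\<And>i j. i \<in> {1..n} \<Longrightarrow> j \<in> {1..n} \<Longrightarrow> i \<noteq> j \<Longrightarrow>
           pi_star n w t j / (pi_star n w t i + pi_star n w t j) = btl_prob w t i j"
proof -
  let ?W = "\<Sum>k\<in>{1..n}. w t k"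
  have W: "0 < ?W" using n w by (intro sum_pos) auto
  show pos: "0 < pi_star n w t i" if "i \<in> {1..n}" for i
    using that w W by (simp add: pi_star_def)
  show "(\<Sum>i\<in>{1..n}. pi_star n w t i) = 1"
    using W by (simp add: pi_star_def flip: sum_divide_distrib)
  show "pi_star n w t i \<le> norm_inf n (pi_star n w t)" if "i \<in> {1..n}" for i
    unfolding norm_inf_def using that by (intro order.trans[OF abs_ge_self Max_ge]) auto
  show "norm_inf n (pi_star n w t) \<le> cond_number n w t * pi_star n w t i" if i: "i \<in> {1..n}" for i
  proof -
    have "norm_inf n (pi_star n w t) \<in> (\<lambda>i. \<bar>pi_star n w t i\<bar>) ` {1..n}"
      unfolding norm_inf_def using n by (intro Max_in) auto
    then obtain i0 where i0: "i0 \<in> {1..n}" "norm_inf n (pi_star n w t) = \<bar>pi_star n w t i0\<bar>" by blast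
    have "w t i0 / w t i \<le> cond_number n w t" using i0(1) i by (rule cond_number_ge)
    then have "w t i0 \<le> cond_number n w t * w t i" using w[OF i] by (simp add: divide_le_eq)
    then have "w t i0 / ?W \<le> cond_number n w t * w t i / ?W" using W by (intro divide_right_mono) auto
    then show ?thesis using i0 pos[OF i0(1)] by (simp add: pi_star_def)
  qed
  show "pi_star n w t j / (pi_star n w t i + pi_star n w t j) = btl_prob w t i j"
    if "i \<in> {1..n}" "j \<in> {1..n}" "i \<noteq> j" for i j
    using W unfolding pi_star_def btl_prob_def add_divide_distrib[symmetric] by simp
qed

text \<open>Smoothness bounds both the bias and the change of the variance of an outcome by
  \<open>\<beta>\<close>. Since the variance at time \<open>t\<close> is at least
  \<open>\<beta>\<close>, the average variance is at most twice the exact one, which verifies the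
  interface of the abstract error bound.\<close>

lemma conditional_error_bound:
  assumes n: "n \<ge> 2" and T: "T \<ge> 1" and L: "L \<ge> 1" and M: "M \<ge> 0" and t: "t \<in> {0..1}"
    and w: "\<And>s i. s \<in> {0..1} \<Longrightarrow> i \<in> {1..n} \<Longrightarrow> w s i > 0"
    and smooth: "btl_smooth n M w"
    and k: "k > 0" "real L * k \<ge> 1"
    and card: "\<And>i j. i \<in> {1..n} \<Longrightarrow> j \<in> {1..n} \<Longrightarrow> i \<noteq> j \<Longrightarrow> k \<le> real (card (nbhd_edge T G \<delta> t i j))"
    and d: "d \<ge> real n"
  defines "b \<equiv> cond_number n w t" and "\<beta> \<equiv> M * (\<delta> / real T)"
    and "\<eta> \<equiv> sqrt (ln (real n) / (real n * (real L * k)))"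
  assumes \<beta>: "\<beta> \<le> 1 / (16 * b)" and n_large: "60000 * b\<^sup>2 * ln (real n) \<le> real n"
    and q: "q = (if 4096 * b\<^sup>2 \<le> real L * k then 1 / (8 * b) else 1 / (16 * b\<^sup>2))"
  shows "1 - 5 / real n ^ 10 \<le> measure_pmf.prob (outcomes_law n T L w G)
           {Y. (\<exists>!\<pi>. stationary_distribution n (P_hat n T L \<delta> d G Y t) \<pi>) \<and>
               norm_inf n (\<lambda>i. the_stationary n (P_hat n T L \<delta> d G Y t) i - pi_star n w t i)
                 / norm_inf n (pi_star n w t)
               \<le> 8 * (8 * (14 * \<eta> + 2 * \<beta>) / q + b * (14 * \<eta> + 2 * \<beta>))}"
proof -
  note wt = w[OF t]
  interpret S: btl_sample n T L w G \<delta> t k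
    by unfold_locales (use T L k w card in auto)
  have b1: "1 \<le> b"
    using cond_number_ge[of 1 n 1 w t] n wt[of 1] unfolding b_def by simp
  have prob_dev: "\<bar>btl_prob w t' i j - btl_prob w t i j\<bar> \<le> \<beta>"
    if ij: "i \<in> {1..n}" "j \<in> {1..n}" "i \<noteq> j" and t': "t' \<in> nbhd_edge T G \<delta> t i j" for i j t'
  proof -
    have "\<bar>btl_prob w t i j - btl_prob w t' i j\<bar> \<le> M * \<bar>t - t'\<bar>"
      using smooth ij t S.N_unit[OF t'] unfolding btl_smooth_def by blast
    also have "\<dots> \<le> \<beta>"
      unfolding \<beta>_def using M t' by (intro mult_left_mono) (auto simp: nbhd_edge_def nbhd_def)
    finally show ?thesis by (simp add: abs_minus_commute)
  qed
  have var_lower: "\<beta> \<le> btl_prob w t i j * (1 - btl_prob w t i j)"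
    if ij: "i \<in> {1..n}" "j \<in> {1..n}" "i \<noteq> j" for i j
  proof -
    have "1 / (2 * b) \<le> btl_prob w t i' j'" if "i' \<in> {1..n}" "j' \<in> {1..n}" for i' j'
    proof -
      have "w t i' \<le> b * w t j'"
        using cond_number_ge[OF that, of w t] wt that unfolding b_def by (simp add: divide_le_eq)
      moreover have "w t j' \<le> b * w t j'" using b1 wt[OF that(2)] by simp
      ultimately have "w t i' + w t j' \<le> 2 * (b * w t j')" by simp
      then show ?thesis using b1 wt[OF that(1)] wt[OF that(2)] by (simp add: btl_prob_def field_simps)
    qed
    then have low: "1 / (2 * b) \<le> btl_prob w t i j" "1 / (2 * b) \<le> 1 - btl_prob w t i j"
      using ij btl_prob_swap[of w t i j] wt by fastforce+
    \<comment> \<open>One of the probability and its complement is at least 1/2, the other at least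
      1 / (2 b).\<close>
    have "1 / (4 * b) \<le> btl_prob w t i j * (1 - btl_prob w t i j)"
    proof (cases "btl_prob w t i j \<le> 1 / 2")
      case True
      then have "1 / (2 * b) * (1 / 2) \<le> btl_prob w t i j * (1 - btl_prob w t i j)"
        using low b1 by (intro mult_mono) (auto intro: order.trans[OF _ low(1)])
      then show ?thesis by simp
    next
      case False
      then have "1 / 2 * (1 / (2 * b)) \<le> btl_prob w t i j * (1 - btl_prob w t i j)"
        using low b1 by (intro mult_mono) auto
      then show ?thesis by simp
    qed
    moreover have "1 / (16 * b) \<le> 1 / (4 * b)" using b1 by (intro divide_left_mono) auto
    ultimately show ?thesis using \<beta> by linarith
  qed
  define m where "m = norm_inf n (pi_star n w t)"
  have \<pi>_pos: "0 < pi_star n w t i" if "i \<in> {1..n}" for i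
    using n wt that by (rule pi_star_props(1))
  have \<pi>_pair: "pi_star n w t j / (pi_star n w t i + pi_star n w t j) = btl_prob w t i j"
    if "i \<in> {1..n}" "j \<in> {1..n}" "i \<noteq> j" for i j
    using n wt that by (rule pi_star_props(5))
  interpret B: btl_comparison_matrix S.Q n "real L * k" S.X S.\<mu> S.v "pi_star n w t" m b \<beta>
  proof
    fix i j assume ij: "i \<in> {1..n}" "j \<in> {1..n}" "i \<noteq> j"
    let ?y = "btl_prob w t i j"
    have "btl_prob w t' i j \<le> ?y + \<beta>" "- btl_prob w t' i j \<le> \<beta> - ?y" if "t' \<in> S.N i j" for t'
      using prob_dev[OF ij that] by linarith+
    then have "S.\<mu> i j \<le> ?y + \<beta>" "(1 / real (card (S.N i j))) * (\<Sum>t'\<in>S.N i j. - btl_prob w t' i j) \<le> \<beta> - ?y"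
      unfolding S.\<mu>_def by (intro S.average_le ij; simp)+
    then have "S.\<mu> i j \<le> ?y + \<beta>" "- S.\<mu> i j \<le> \<beta> - ?y" by (simp_all add: sum_negf S.\<mu>_def)
    then show "\<bar>S.\<mu> i j - pi_star n w t j / (pi_star n w t i + pi_star n w t j)\<bar> \<le> \<beta>"
      unfolding \<pi>_pair[OF ij] by linarith
    have "S.v i j \<le> 2 * (?y * (1 - ?y))"
      unfolding S.v_def
    proof (intro S.average_le ij)
      fix t' assume t': "t' \<in> S.N i j"
      let ?y' = "btl_prob w t' i j"
      have unit: "0 \<le> ?y" "?y \<le> 1" "0 \<le> ?y'" "?y' \<le> 1"
        using ij wt w S.N_unit[OF t'] by (auto intro!: btl_prob_bounds)
      \<comment> \<open>The map p (1 - p) is 1-Lipschitz on the unit interval.\<close>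
      have "?y' * (1 - ?y') - ?y * (1 - ?y) = (?y' - ?y) * (1 - ?y - ?y')" by (simp add: algebra_simps)
      also have "\<dots> \<le> \<bar>?y' - ?y\<bar> * \<bar>1 - ?y - ?y'\<bar>" by (simp flip: abs_mult)
      also have "\<dots> \<le> \<bar>?y' - ?y\<bar> * 1" using unit by (intro mult_left_mono) auto
      also have "\<dots> \<le> \<beta>" using prob_dev[OF ij t'] by simp
      finally show "?y' * (1 - ?y') \<le> 2 * (?y * (1 - ?y))" using var_lower[OF ij] by linarith
    qed
    also have "?y * (1 - ?y) = pi_star n w t i * pi_star n w t j / (pi_star n w t i + pi_star n w t j)\<^sup>2"
    proof -
      have "0 < pi_star n w t i + pi_star n w t j"
        using \<pi>_pos ij by (intro add_pos_pos)
      then have "p * pj / (p + pj)\<^sup>2 = (pj / (p + pj)) * (1 - pj / (p + pj))"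
        if "p = pi_star n w t i" "pj = pi_star n w t j" for p pj
        using that by (simp add: power2_eq_square field_simps)
      then show ?thesis unfolding \<pi>_pair[OF ij, symmetric] by simp
    qed
    finally show "S.v i j \<le> 2 * (pi_star n w t i * pi_star n w t j / (pi_star n w t i + pi_star n w t j)\<^sup>2)" .
  next
    show "(\<Sum>i\<in>{1..n}. pi_star n w t i) = 1" using n wt by (rule pi_star_props(2))
    show "pi_star n w t i \<le> m" if "i \<in> {1..n}" for i
      unfolding m_def using n wt that by (rule pi_star_props(3))
    show "m \<le> b * pi_star n w t i" if "i \<in> {1..n}" for i
      unfolding m_def b_def using n wt that by (rule pi_star_props(4))
  qed (use n \<pi>_pos b1 \<beta> n_large in \<open>auto simp del: One_nat_def\<close>)
  have m: "m > 0" by (rule B.m_pos)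
  have "norm_inf n (\<lambda>i. the_stationary n (P_hat n T L \<delta> d G Y t) i - pi_star n w t i) / m
          \<le> 8 * (8 * (14 * \<eta> + 2 * \<beta>) / q + b * (14 * \<eta> + 2 * \<beta>))
        \<and> (\<exists>!\<pi>. stationary_distribution n (P_hat n T L \<delta> d G Y t) \<pi>)"
    if good: "B.good Y" for Y
  proof -
    let ?P = "P_hat n T L \<delta> d G Y t"
    let ?R = "8 * (14 * \<eta> + 2 * \<beta>) / q + b * (14 * \<eta> + 2 * \<beta>)"
    \<comment> \<open>Every pair is compared at some time of the neighborhood, so the default entry
      0 of the estimator does not occur.\<close>
    have off: "P_hat_off T L \<delta> d G Y t i j = S.X i j Y / d"
      if ij: "i \<in> {1..n}" "j \<in> {1..n}" "i \<noteq> j" for i j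
    proof -
      have "S.N i j \<noteq> {}" using S.card_pos[OF ij] by auto
      then have "{i, j} \<in> union_edges T G \<delta> t" by (auto simp: nbhd_edge_def union_edges_def)
      then show ?thesis by (simp add: P_hat_off_def S.X_def)
    qed
    have P: "?P i j = S.X i j Y / d" if "i \<in> {1..n}" "j \<in> {1..n}" "i \<noteq> j" for i j
      using off[OF that] that by (simp add: P_hat_def)
    have P_diag: "?P i i = 1 - (\<Sum>k\<in>{1..n} - {i}. ?P i k)" if "i \<in> {1..n}" for i
      by (simp add: P_hat_def)
    have ex1: "\<exists>!\<pi>. stationary_distribution n ?P \<pi>"
      using good d P P_diag by (rule B.good_stationary(1))
    then have stat: "stationary_distribution n ?P (the_stationary n ?P)"
      unfolding the_stationary_def by (rule theI')
    have dev: "\<bar>the_stationary n ?P j - pi_star n w t j\<bar> \<le> 8 * m * ?R" if "j \<in> {1..n}" for j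
      unfolding \<eta>_def q B.q_def[symmetric] using good d P P_diag stat that
      by (rule B.good_stationary(2))
    have "norm_inf n (\<lambda>i. the_stationary n ?P i - pi_star n w t i) \<le> 8 * m * ?R"
      unfolding norm_inf_def using n dev by (intro Max.boundedI) auto
    then show ?thesis using ex1 m by (simp add: divide_le_eq mult_ac)
  qed
  then have "measure_pmf.prob S.Q {Y. B.good Y} \<le> measure_pmf.prob S.Q
           {Y. (\<exists>!\<pi>. stationary_distribution n (P_hat n T L \<delta> d G Y t) \<pi>) \<and>
               norm_inf n (\<lambda>i. the_stationary n (P_hat n T L \<delta> d G Y t) i - pi_star n w t i) / m
               \<le> 8 * (8 * (14 * \<eta> + 2 * \<beta>) / q + b * (14 * \<eta> + 2 * \<beta>))}"
    by (intro measure_pmf.finite_measure_mono Collect_mono impI conjI) simp_all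
  then show ?thesis using B.prob_good unfolding S.Q_def m_def by linarith
qed


section \<open>Powers in the optimal bandwidth\<close>

text \<open>With N = n and \<Lambda> = L pmin, this \<delta> minimises \<gamma> sqrt (l / (N
  \<Lambda> \<delta>)) + M N b^(7/2) \<delta> / T, the sum of the noise and bias terms of the final
  bound; setting the derivative to zero is the origin of the factor 2 in 2M.\<close>

lemma bandwidth_powr:
  fixes \<gamma> l N b \<Lambda> M T :: real
  assumes pos: "\<gamma> > 0" "l > 0" "N > 0" "b > 0" "\<Lambda> > 0" "M > 0" "T > 0"
  defines "\<delta> \<equiv> \<gamma> powr (2/3) * l powr (1/3) / ((2 * M) powr (2/3) * N * b powr (7/3) * \<Lambda> powr (1/3)) * T powr (2/3)"
  shows "M * (\<delta> / T) = \<gamma> powr (2/3) * (M * l) powr (1/3) / (2 powr (2/3) * N * b powr (7/3) * \<Lambda> powr (1/3)) * (1 / T powr (1/3))"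
    and "\<delta> / T = \<gamma> powr (2/3) * l powr (1/3) / ((2 * M) powr (2/3) * N * b powr (7/3) * \<Lambda> powr (1/3) * T powr (1/3))"
    and "1 / sqrt \<delta> = (2 * M) powr (1/3) * N powr (1/2) * b powr (7/6) * \<Lambda> powr (1/6) / (\<gamma> powr (1/3) * l powr (1/6) * T powr (1/3))"
proof -
  have T: "T powr (2/3) = T / T powr (1/3)" using powr_diff[of T 1 "1/3"] pos by simp
  have M: "M powr (1/3) = M / M powr (2/3)" using powr_diff[of M 1 "2/3"] pos by simp
  show "\<delta> / T = \<gamma> powr (2/3) * l powr (1/3) / ((2 * M) powr (2/3) * N * b powr (7/3) * \<Lambda> powr (1/3) * T powr (1/3))"
    using pos unfolding \<delta>_def T by simp
  then show "M * (\<delta> / T) = \<gamma> powr (2/3) * (M * l) powr (1/3) / (2 powr (2/3) * N * b powr (7/3) * \<Lambda> powr (1/3)) * (1 / T powr (1/3))"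
    using pos by (simp add: powr_mult M mult_ac)
  have "0 < \<delta>" using pos by (simp add: \<delta>_def)
  then have "sqrt \<delta> = \<delta> powr (1/2)" by (simp add: powr_half_sqrt)
  also have "\<dots> = \<gamma> powr (1/3) * l powr (1/6) / ((2 * M) powr (1/3) * N powr (1/2) * b powr (7/6) * \<Lambda> powr (1/6)) * T powr (1/3)"
    using pos unfolding \<delta>_def by (simp add: powr_mult powr_divide powr_powr)
  finally show "1 / sqrt \<delta> = (2 * M) powr (1/3) * N powr (1/2) * b powr (7/6) * \<Lambda> powr (1/6) / (\<gamma> powr (1/3) * l powr (1/6) * T powr (1/3))"
    using pos by simp
qed

text \<open>In terms of \<open>\<delta>\<close>, the three minima and maxima in the theorem are \<open>M \<delta> / T\<close>, \<open>\<delta> / T\<close> and \<open>1 / sqrt \<delta>\<close>.\<close>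

lemma bandwidth_props:
  fixes n T L :: nat and M b pmin :: real
  assumes n: "n \<ge> 2" and T: "T \<ge> 1" and L: "L \<ge> 1" and M: "M \<ge> 0" and b: "b \<ge> 1" and p: "pmin > 0"
  defines "\<gamma> \<equiv> gamma_fac n b" and "\<delta> \<equiv> bandwidth n T L M b pmin"
  shows "1 \<le> \<gamma>" and "\<delta> > 0" and "\<delta> \<le> real T"
    and "M * (\<delta> / real T) =
         min (\<gamma> powr (2/3) * (M * ln (real n)) powr (1/3) /
                (2 powr (2/3) * real n * b powr (7/3) * (real L * pmin) powr (1/3)) *
                (1 / real T powr (1/3))) M"
    and "\<delta> / real T =
         (if M = 0 then 1
          else min (\<gamma> powr (2/3) * ln (real n) powr (1/3) /
                 ((2 * M) powr (2/3) * real n * b powr (7/3) *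
                  (real L * pmin) powr (1/3) * real T powr (1/3))) 1)"
    and "1 / sqrt \<delta> \<le>
         max ((2 * M) powr (1/3) * real n powr (1/2) * b powr (7/6) *
                (real L * pmin) powr (1/6) /
                (\<gamma> powr (1/3) * ln (real n) powr (1/6) * real T powr (1/3)))
             (1 / sqrt (real T))"
proof -
  have l: "ln (real n) > 0" using n by simp
  show g: "1 \<le> \<gamma>" using l by (simp add: \<gamma>_def gamma_fac_def le_max_iff_disj)
  have pos: "\<gamma> > 0" "ln (real n) > 0" "real n > 0" "b > 0" "real L * pmin > 0" "real T > 0"
    using g l n b L p T by auto
  define \<delta>0 where "\<delta>0 = \<gamma> powr (2/3) * ln (real n) powr (1/3) /
    ((2 * M) powr (2/3) * real n * b powr (7/3) * (real L * pmin) powr (1/3)) * real T powr (2/3)"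
  have \<delta>: "\<delta> = (if M = 0 then real T else min \<delta>0 (real T))"
    by (simp add: \<delta>_def bandwidth_def \<delta>0_def \<gamma>_def)
  \<comment> \<open>For \<open>M = 0\<close> the quotient is a division by zero with value 0, so
    positivity is claimed only for \<open>M \<noteq> 0\<close>.\<close>
  have \<delta>0: "M \<noteq> 0 \<Longrightarrow> \<delta>0 > 0" using pos M p L by (simp add: \<delta>0_def)
  show "\<delta> > 0" "\<delta> \<le> real T" using \<delta>0 pos by (auto simp: \<delta>)
  have min_div: "min x (real T) / real T = min (x / real T) 1" for x
    using pos(6) by (auto simp: min_def field_simps)
  have scaled: "\<delta> / real T = (if M = 0 then 1 else min (\<delta>0 / real T) 1)"
    using pos(6) by (simp add: \<delta> min_div)
  have eqs: "M * (\<delta>0 / real T) = \<gamma> powr (2/3) * (M * ln (real n)) powr (1/3) /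
                (2 powr (2/3) * real n * b powr (7/3) * (real L * pmin) powr (1/3)) *
                (1 / real T powr (1/3))" (is ?A)
    "\<delta>0 / real T = \<gamma> powr (2/3) * ln (real n) powr (1/3) /
                 ((2 * M) powr (2/3) * real n * b powr (7/3) *
                  (real L * pmin) powr (1/3) * real T powr (1/3))" (is ?B)
    "1 / sqrt \<delta>0 = (2 * M) powr (1/3) * real n powr (1/2) * b powr (7/6) *
                (real L * pmin) powr (1/6) /
                (\<gamma> powr (1/3) * ln (real n) powr (1/6) * real T powr (1/3))" (is ?C)
    if "M \<noteq> 0"
  proof -
    have "0 < M" using that M by simp
    note powr = bandwidth_powr[OF pos(1-5) this pos(6), folded \<delta>0_def]
    show ?A ?B ?C by (fact powr)+
  qed
  show "\<delta> / real T =
         (if M = 0 then 1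
          else min (\<gamma> powr (2/3) * ln (real n) powr (1/3) /
                 ((2 * M) powr (2/3) * real n * b powr (7/3) *
                  (real L * pmin) powr (1/3) * real T powr (1/3))) 1)"
    using scaled eqs(2) by simp
  show "M * (\<delta> / real T) =
         min (\<gamma> powr (2/3) * (M * ln (real n)) powr (1/3) /
                (2 powr (2/3) * real n * b powr (7/3) * (real L * pmin) powr (1/3)) *
                (1 / real T powr (1/3))) M"
  proof (cases "M = 0")
    case True
    then show ?thesis by simp
  next
    case False
    have "M * (\<delta> / real T) = min (M * (\<delta>0 / real T)) M"
      unfolding scaled using False M min_mult_distrib_left[of M "\<delta>0 / real T" 1] by simp
    then show ?thesis unfolding eqs(1)[OF False] .
  qed
  show "1 / sqrt \<delta> \<le>
         max ((2 * M) powr (1/3) * real n powr (1/2) * b powr (7/6) *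
                (real L * pmin) powr (1/6) /
                (\<gamma> powr (1/3) * ln (real n) powr (1/6) * real T powr (1/3)))
             (1 / sqrt (real T))"
  proof (cases "\<delta> = real T")
    case False
    then have "M \<noteq> 0" "\<delta> = \<delta>0" by (auto simp: \<delta> min_def split: if_splits)
    then show ?thesis using eqs(3) by simp
  qed simp
qed

text \<open>The expected number of comparisons of a pair is at least pmin \<delta> / 2, and falling
  to a quarter of that has probability at most exp (- pmin \<delta> / 8). The constant 96 turns this
  into n^(-12), enough for a union over all pairs. The second claim makes \<open>d\<close> an
  admissible normalisation: the product of the 1 - p is at most exp (-1), so the union probability
  is at least 1/2.\<close>

lemma prob_graphs_connected:
  fixes p :: "real \<Rightarrow> real"
  assumes n: "n \<ge> 2" and T: "T \<ge> 1" and t: "t \<in> {0..1}"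
    and p: "\<And>t'. t' \<in> grid T \<Longrightarrow> 0 \<le> p t' \<and> p t' \<le> 1"
    and pmin: "\<And>t'. t' \<in> grid T \<Longrightarrow> pmin \<le> p t'" "pmin > 0"
    and \<delta>: "\<delta> \<ge> 96 * (ln (real n) / pmin)" "2 \<le> \<delta>" "\<delta> \<le> real T"
  shows "1 - 1 / real n ^ 10 \<le> measure_pmf.prob (graphs_law n T p)
           {G. \<forall>i\<in>{1..n}. \<forall>j\<in>{1..n}. i \<noteq> j \<longrightarrow> pmin * \<delta> / 8 \<le> real (card (nbhd_edge T G \<delta> t i j))}"
    and "real n \<le> 3 * real n * p_union T p \<delta> t"
proof -
  let ?N = "nbhd T \<delta> t" and ?I = "{(i, j) \<in> {1..n} \<times> {1..n}. i \<noteq> j}"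
  have N: "?N \<subseteq> grid T" by (auto simp: nbhd_def)
  have l: "ln (real n) > 0" using n by simp
  have S: "pmin * \<delta> / 2 \<le> (\<Sum>t'\<in>?N. p t')"
  proof -
    have "pmin * (\<delta> / 2) \<le> pmin * real (card ?N)"
      using pmin card_nbhd_ge[OF T t \<delta>(2,3)] by (intro mult_left_mono) auto
    also have "\<dots> = (\<Sum>t'\<in>?N. pmin)" by simp
    also have "\<dots> \<le> (\<Sum>t'\<in>?N. p t')" using pmin N by (intro sum_mono) auto
    finally show ?thesis by simp
  qed
  have large: "96 * ln (real n) \<le> pmin * \<delta>"
    using \<delta>(1) pmin by (simp add: divide_le_eq mult.commute)
  define bad where "bad = (\<lambda>(i, j). {G. real (card (nbhd_edge T G \<delta> t i j)) \<le> (pmin * \<delta> / 2) / 4})"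
  have bad: "measure_pmf.prob (graphs_law n T p) (bad e) \<le> 1 / real n ^ 12" if e: "e \<in> ?I" for e
  proof -
    obtain i j where ij: "e = (i, j)" "i \<in> {1..n}" "j \<in> {1..n}" "i \<noteq> j" using e by auto
    have "measure_pmf.prob (graphs_law n T p) (bad e) \<le> exp (- (pmin * \<delta> / 2) / 4)"
      unfolding bad_def ij(1) prod.case using ij(2-4) p S by (rule prob_few_comparisons)
    also have "\<dots> \<le> exp (- (12 * ln (real n)))" using large by simp
    also have "\<dots> = 1 / real n ^ 12"
      using exp_of_nat_mult[of 12 "ln (real n)"] n by (simp add: exp_minus divide_inverse)
    finally show ?thesis .
  qed
  have fin: "finite ?I" by (rule finite_subset[of _ "{1..n} \<times> {1..n}"]) auto
  have "card ?I \<le> card ({1..n} \<times> {1..n})" by (intro card_mono) auto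
  then have card_I: "real (card ?I) \<le> real n ^ 2"
    by (simp add: power2_eq_square flip: of_nat_mult)
  let ?good = "{G. \<forall>i\<in>{1..n}. \<forall>j\<in>{1..n}. i \<noteq> j \<longrightarrow> pmin * \<delta> / 8 \<le> real (card (nbhd_edge T G \<delta> t i j))}"
  have "- ?good \<subseteq> (\<Union>e\<in>?I. bad e)"
  proof
    fix G assume "G \<in> - ?good"
    then obtain i j where "(i, j) \<in> ?I" "\<not> pmin * \<delta> / 8 \<le> real (card (nbhd_edge T G \<delta> t i j))" by blast
    moreover from this have "G \<in> bad (i, j)" by (simp add: bad_def)
    ultimately show "G \<in> (\<Union>e\<in>?I. bad e)" by blast
  qed
  then have "measure_pmf.prob (graphs_law n T p) (- ?good) \<le> measure_pmf.prob (graphs_law n T p) (\<Union>e\<in>?I. bad e)"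
    by (intro measure_pmf.finite_measure_mono) auto
  also have "\<dots> \<le> real n ^ 2 * (1 / real n ^ 12)"
    using fin bad card_I by (intro pmf_prob_UN_le) auto
  also have "\<dots> = 1 / real n ^ 10" using n by (simp add: field_simps flip: power_add)
  finally show "1 - 1 / real n ^ 10 \<le> measure_pmf.prob (graphs_law n T p) ?good"
    using measure_pmf.prob_compl[of ?good "graphs_law n T p"] by (simp add: Compl_eq_Diff_UNIV)
  have "(\<Prod>t'\<in>?N. 1 - p t') \<le> (\<Prod>t'\<in>?N. exp (- p t'))"
  proof (intro prod_mono conjI)
    fix t' assume "t' \<in> ?N"
    then show "0 \<le> 1 - p t'" using p N by auto
    show "1 - p t' \<le> exp (- p t')" using exp_ge_add_one_self[of "- p t'"] by simp
  qed
  also have "\<dots> = exp (- (\<Sum>t'\<in>?N. p t'))"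
    using finite_subset[OF N finite_grid] by (simp add: exp_sum flip: sum_negf)
  also have "\<dots> \<le> exp (- 1)"
  proof -
    have "1 / 2 \<le> ln (real n)"
    proof -
      have "ln 2 \<le> ln (real n)" using n by simp
      then show ?thesis using ln2_ge_two_thirds by linarith
    qed
    then show ?thesis using S large by simp
  qed
  also have "\<dots> \<le> 1 / 2" using exp_ge_add_one_self[of 1] by (simp add: exp_minus field_simps)
  finally have "1 / 2 \<le> p_union T p \<delta> t" by (simp add: p_union_def)
  then have "real n * 1 \<le> real n * (3 * p_union T p \<delta> t)" by (intro mult_left_mono) auto
  then show "real n \<le> 3 * real n * p_union T p \<delta> t" by simp
qed

subsection \<open>The error bound\<close>

lemma powr_ge_self:
  fixes b a :: real
  assumes "b \<ge> 1" "a \<ge> 1"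
  shows "b \<le> b powr a"
  using powr_mono[of 1 a b] assms by simp

text \<open>The square of 250 is 62500, which exceeds 60000, and b^(5/2) is at least b.\<close>

lemma small_noise_imp:
  fixes b \<beta> :: real
  assumes n: "n \<ge> 2" and b: "b \<ge> 1" and \<beta>: "\<beta> \<ge> 0"
    and small: "\<beta> + sqrt (ln (real n) / real n) \<le> 1 / 250 * (1 / b powr (5/2))"
  shows "\<beta> \<le> 1 / (16 * b)" and "60000 * b\<^sup>2 * ln (real n) \<le> real n"
proof -
  have l: "0 < ln (real n)" and n0: "0 < real n" using n by auto
  have "1 / b powr (5/2) \<le> 1 / b" using b by (intro divide_left_mono powr_ge_self) auto
  then have le: "\<beta> + sqrt (ln (real n) / real n) \<le> 1 / (250 * b)" using small by simp
  moreover have "0 \<le> sqrt (ln (real n) / real n)" using l by simp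
  moreover have "1 / (250 * b) \<le> 1 / (16 * b)" using b by (intro divide_left_mono) auto
  ultimately show "\<beta> \<le> 1 / (16 * b)" by linarith
  have "sqrt (ln (real n) / real n) \<le> 1 / (250 * b)" using le \<beta> by linarith
  then have "(sqrt (ln (real n) / real n))\<^sup>2 \<le> (1 / (250 * b))\<^sup>2" using l by (intro power_mono) auto
  then have "ln (real n) / real n \<le> 1 / (62500 * b\<^sup>2)"
    using l by (simp add: power_divide power_mult_distrib)
  then have "62500 * (b\<^sup>2 * ln (real n)) \<le> real n" using b n0 by (simp add: field_simps)
  moreover have "0 \<le> b\<^sup>2 * ln (real n)" using l by simp
  ultimately show "60000 * b\<^sup>2 * ln (real n) \<le> real n" unfolding mult.assoc by linarith
qed

text \<open>If the comparisons of a pair are too few for its empirical mean to be accurate to within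
  a multiple of \<open>1 / b\<close>, then \<open>ln n\<close> is at most \<open>b\<^sup>2\<close>, and the factor \<open>\<gamma>\<close> exceeds the
  factor \<open>b\<close> that is lost.\<close>

lemma overlap_cost:
  fixes b K :: real
  assumes n: "n \<ge> 2" and b: "b \<ge> 1" and K: "4096 * ln (real n) \<le> K"
  defines "q \<equiv> (if 4096 * b\<^sup>2 \<le> K then 1 / (8 * b) else 1 / (16 * b\<^sup>2))"
  shows "1 / q \<le> 16 * (b * gamma_fac n b)" and "1 / q \<le> 16 * b\<^sup>2"
proof -
  have l: "0 < ln (real n)" using n by simp
  have bb: "b \<le> b\<^sup>2" using b by (simp add: power2_eq_square)
  show "1 / q \<le> 16 * b\<^sup>2" using b bb by (simp add: q_def)
  show "1 / q \<le> 16 * (b * gamma_fac n b)"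
  proof (cases "4096 * b\<^sup>2 \<le> K")
    case True
    have "1 \<le> gamma_fac n b" using l by (simp add: gamma_fac_def le_max_iff_disj)
    then have "b * 1 \<le> b * gamma_fac n b" using b by (intro mult_left_mono) auto
    then show ?thesis using True b by (simp add: q_def)
  next
    case False
    then have "ln (real n) \<le> b\<^sup>2" using K by simp
    then have "sqrt (ln (real n)) \<le> b" using b by (intro real_le_lsqrt) auto
    then have "1 \<le> b powr (5/2) / sqrt (ln (real n))"
      using l powr_ge_self[OF b, of "5/2"] by (simp add: le_divide_eq)
    then have "1 * b\<^sup>2 \<le> b powr (5/2) / sqrt (ln (real n)) * max (b\<^sup>2) (ln (real n) / sqrt (real n))"
      using b by (intro mult_mono) auto
    then have "b \<le> gamma_fac n b" using bb by (simp add: gamma_fac_def)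
    then have "b * b \<le> b * gamma_fac n b" using b by (intro mult_left_mono) auto
    then show ?thesis using False by (simp add: q_def power2_eq_square)
  qed
qed

text \<open>Noise is multiplied by 1 / q \<le> 16 b \<gamma> and bias by 1 / q \<le> 16 b^2. One
  factor b is given to bmax divided by a number in (0, 1]; the b left over in the bias is below n
  b^(7/2).\<close>

lemma error_le:
  fixes n L :: nat and M b bmax pmin \<delta> \<tau> \<eta> q B1 B2 :: real
  assumes n: "n \<ge> 2" and L: "L \<ge> 1" and M: "M \<ge> 0" and b: "b \<ge> 1" and bmax: "b \<le> bmax"
    and s: "bmax * sqrt (ln (real n) / real n) < 1"
    and p: "pmin > 0" and \<delta>: "\<delta> > 0" and \<tau>: "\<tau> \<ge> 0"
    and q: "q > 0" "1 / q \<le> 16 * (b * \<gamma>)" "1 / q \<le> 16 * b\<^sup>2" and \<gamma>: "\<gamma> \<ge> 1"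
    and B1: "1 / sqrt \<delta> \<le> B1" and B2: "\<tau> = B2"
  defines "\<eta> \<equiv> sqrt (ln (real n) / (real n * (real L * (pmin * \<delta> / 8))))" and "\<beta> \<equiv> M * \<tau>"
  shows "8 * (8 * (14 * \<eta> + 2 * \<beta>) / q + b * (14 * \<eta> + 2 * \<beta>))
       \<le> 43344 * (bmax / (1 - bmax * sqrt (ln (real n) / real n)) *
           (\<gamma> * sqrt (ln (real n) / (real L * real n * pmin)) * B1 + M * real n * b powr (7/2) * B2))"
proof -
  have l: "0 < ln (real n)" and n1: "1 \<le> real n" using n by auto
  define \<eta>0 where "\<eta>0 = sqrt (ln (real n) / (real L * real n * pmin))"
  define u where "u = \<eta>0 * (1 / sqrt \<delta>)"
  have \<eta>0: "0 \<le> \<eta>0" using l L p n1 by (simp add: \<eta>0_def)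
  then have u: "0 \<le> u" using \<delta> by (simp add: u_def)
  have \<beta>: "0 \<le> \<beta>" using M \<tau> by (simp add: \<beta>_def)
  have \<eta>_nonneg: "0 \<le> \<eta>" using l L p \<delta> n1 by (simp add: \<eta>_def)
  \<comment> \<open>The factor 3 bounds the square root of the 8 in the number
    \<open>pmin * \<delta> / 8\<close> of comparisons.\<close>
  have \<eta>: "\<eta> \<le> 3 * u"
  proof -
    have "ln (real n) / (real n * (real L * (pmin * \<delta> / 8))) = 8 * (ln (real n) / (real L * real n * pmin) * (1 / \<delta>))"
      by (simp add: mult_ac)
    then have "\<eta> = sqrt 8 * u"
      unfolding \<eta>_def u_def \<eta>0_def by (simp only: real_sqrt_mult real_sqrt_divide real_sqrt_one)
    moreover have "sqrt 8 \<le> 3" by (rule real_le_lsqrt) auto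
    ultimately show ?thesis using u by (simp add: mult_right_mono)
  qed
  have "8 * (8 * (14 * \<eta> + 2 * \<beta>) / q + b * (14 * \<eta> + 2 * \<beta>))
      = 896 * \<eta> * (1 / q) + 128 * \<beta> * (1 / q) + 112 * (b * \<eta>) + 16 * (b * \<beta>)"
    by (simp add: field_simps add_divide_distrib)
  also have "\<dots> \<le> 896 * (3 * u) * (16 * (b * \<gamma>)) + 128 * \<beta> * (16 * b\<^sup>2) + 112 * (b * \<gamma> * (3 * u)) + 16 * (b\<^sup>2 * \<beta>)"
  proof (intro add_mono)
    show "896 * \<eta> * (1 / q) \<le> 896 * (3 * u) * (16 * (b * \<gamma>))"
      using \<eta> \<eta>_nonneg u q by (intro mult_mono) auto
    show "128 * \<beta> * (1 / q) \<le> 128 * \<beta> * (16 * b\<^sup>2)"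
      using \<beta> q by (intro mult_left_mono) auto
    have "b * 1 \<le> b * \<gamma>" using b \<gamma> by (intro mult_left_mono) auto
    then show "112 * (b * \<eta>) \<le> 112 * (b * \<gamma> * (3 * u))"
      using \<eta> \<eta>_nonneg b \<gamma> by (intro mult_left_mono mult_mono) auto
    have "b \<le> b\<^sup>2" using b by (simp add: power2_eq_square)
    then show "16 * (b * \<beta>) \<le> 16 * (b\<^sup>2 * \<beta>)" using \<beta> by (intro mult_left_mono mult_right_mono) auto
  qed
  \<comment> \<open>43344 = 896 * 3 * 16 + 112 * 3 from the noise, and 2064 = 128 * 16 + 16 from the
    bias.\<close>
  also have "\<dots> = 43344 * (b * (\<gamma> * u)) + 2064 * (b * (b * \<beta>))"
    by (simp add: power2_eq_square)
  also have "\<dots> \<le> 43344 * (b * (\<gamma> * u)) + 43344 * (b * (b * \<beta>))"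
    using b \<beta> by (intro add_left_mono mult_right_mono) auto
  also have "\<dots> = 43344 * (b * (\<gamma> * u + b * \<beta>))" by (simp add: distrib_left)
  also have "\<dots> \<le> 43344 * (bmax / (1 - bmax * sqrt (ln (real n) / real n)) *
           (\<gamma> * \<eta>0 * B1 + M * real n * b powr (7/2) * B2))"
  proof (rule mult_left_mono, rule mult_mono)
    show "b \<le> bmax / (1 - bmax * sqrt (ln (real n) / real n))"
    proof -
      have "0 \<le> bmax * sqrt (ln (real n) / real n)" using b bmax l by simp
      then have "b * (1 - bmax * sqrt (ln (real n) / real n)) \<le> b * 1" using b by (intro mult_left_mono) auto
      also have "\<dots> \<le> bmax" using bmax by simp
      finally show ?thesis using s by (simp add: le_divide_eq)
    qed
    have "\<gamma> * u \<le> \<gamma> * \<eta>0 * B1"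
      unfolding u_def mult.assoc using \<gamma> \<eta>0 B1 by (intro mult_left_mono) auto
    moreover have "b * 1 \<le> b powr (7/2) * real n" using powr_ge_self[OF b, of "7/2"] b n1 by (intro mult_mono) auto
    then have "b * \<beta> \<le> (b powr (7/2) * real n) * \<beta>" using \<beta> by (intro mult_right_mono) auto
    then have "b * \<beta> \<le> M * real n * b powr (7/2) * B2" by (simp add: \<beta>_def B2 mult_ac)
    ultimately show "\<gamma> * u + b * \<beta> \<le> \<gamma> * \<eta>0 * B1 + M * real n * b powr (7/2) * B2"
      by (rule add_mono)
    show "0 \<le> \<gamma> * u + b * \<beta>" using \<gamma> u b \<beta> by (intro add_nonneg_nonneg mult_nonneg_nonneg) auto
    show "0 \<le> bmax / (1 - bmax * sqrt (ln (real n) / real n))" using b bmax s by simp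
  qed auto
  finally show ?thesis unfolding \<eta>0_def .
qed

text \<open>Combines the failure probabilities of the graphs and of the outcomes given the graphs.
  The target \<open>C\<close> is left abstract, which keeps the explicit bandwidth formulas out of
  the probabilistic argument.\<close>

lemma prob_error_ge:
  fixes n T L :: nat and M t :: real and w p
  assumes n: "n \<ge> 2" and T: "T \<ge> 1" and L: "L \<ge> 1" and M: "M \<ge> 0" and t: "t \<in> {0..1}"
    and w: "\<And>s i. s \<in> {0..1} \<Longrightarrow> i \<in> {1..n} \<Longrightarrow> w s i > 0"
    and smooth: "btl_smooth n M w"
    and p: "\<And>t'. t' \<in> grid T \<Longrightarrow> 0 \<le> p t' \<and> p t' \<le> 1"
    and pmin: "\<And>t'. t' \<in> grid T \<Longrightarrow> pmin \<le> p t'" "pmin > 0"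
    and \<delta>: "\<delta> \<ge> 32768 * (ln (real n) / pmin)" "\<delta> \<le> real T"
    and small: "M * (\<delta> / real T) + sqrt (ln (real n) / real n) \<le> 1 / 250 * (1 / cond_number n w t powr (5/2))"
    and d: "d = 3 * real n * p_union T p \<delta> t"
  defines "b \<equiv> cond_number n w t" and "k \<equiv> pmin * \<delta> / 8"
  assumes q: "q = (if 4096 * b\<^sup>2 \<le> real L * k then 1 / (8 * b) else 1 / (16 * b\<^sup>2))"
    and C: "8 * (8 * (14 * sqrt (ln (real n) / (real n * (real L * k))) + 2 * (M * (\<delta> / real T))) / q
              + b * (14 * sqrt (ln (real n) / (real n * (real L * k))) + 2 * (M * (\<delta> / real T)))) \<le> C"
  shows "1 - 6 * real n powr (-9) \<le> measure_pmf.prob (data_law n T L w p)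
           {(G, Y). (\<exists>!\<pi>. stationary_distribution n (P_hat n T L \<delta> d G Y t) \<pi>) \<and>
               norm_inf n (\<lambda>i. the_stationary n (P_hat n T L \<delta> d G Y t) i - pi_star n w t i)
                 / norm_inf n (pi_star n w t) \<le> C}"
proof -
  have l: "1 / 2 \<le> ln (real n)"
  proof -
    have "ln 2 \<le> ln (real n)" using n by simp
    then show ?thesis using ln2_ge_two_thirds by linarith
  qed
  have p\<delta>: "32768 * ln (real n) \<le> pmin * \<delta>"
    using \<delta>(1) pmin(2) by (simp add: divide_le_eq mult.commute)
  \<comment> \<open>Since \<open>pmin\<close> is at most the edge probability at grid time 0,
    \<delta> is at least pmin \<delta>, and the hypothesis on pmin \<delta> forces \<delta> \<ge>
    2.\<close>
  have "pmin \<le> 1" using pmin(1)[of 0] p[of 0] T by (force simp: grid_def)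
  have \<delta>2: "2 \<le> \<delta>"
  proof -
    have "0 < \<delta>" using p\<delta> l pmin(2) zero_less_mult_pos[of pmin \<delta>] by linarith
    then have "pmin * \<delta> \<le> 1 * \<delta>" using \<open>pmin \<le> 1\<close> by (intro mult_right_mono) auto
    then show ?thesis using p\<delta> l by linarith
  qed
  have \<delta>96: "96 * (ln (real n) / pmin) \<le> \<delta>"
  proof -
    have "0 \<le> ln (real n) / pmin" using l pmin(2) by simp
    then show ?thesis using \<delta>(1) by linarith
  qed
  have k: "k > 0" using pmin \<delta>2 by (simp add: k_def)
  have Lk: "real L * k \<ge> 1"
  proof -
    have "1 * k \<le> real L * k" using L k by (intro mult_right_mono) auto
    then show ?thesis using p\<delta> l by (simp add: k_def)
  qed
  have b: "1 \<le> b" using cond_number_ge[of 1 n 1 w t] n w[OF t, of 1] by (simp add: b_def)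
  have \<beta>0: "0 \<le> M * (\<delta> / real T)" using M \<delta>2 by simp
  note small' = small_noise_imp[OF n b[unfolded b_def] \<beta>0 small]
  note graphs = prob_graphs_connected[OF n T t p pmin \<delta>96 \<delta>2 \<delta>(2), folded k_def]
  let ?R = "\<lambda>G Y. (\<exists>!\<pi>. stationary_distribution n (P_hat n T L \<delta> d G Y t) \<pi>) \<and>
               norm_inf n (\<lambda>i. the_stationary n (P_hat n T L \<delta> d G Y t) i - pi_star n w t i)
                 / norm_inf n (pi_star n w t) \<le> C"
  have "1 - 5 / real n ^ 10 - 1 / real n ^ 10 \<le> measure_pmf.prob (data_law n T L w p) {(G, Y). ?R G Y}"
    unfolding data_law_def
  proof (rule prob_bind_pmf_ge)
    show "1 - 1 / real n ^ 10 \<le> measure_pmf.prob (graphs_law n T p)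
        {G. \<forall>i\<in>{1..n}. \<forall>j\<in>{1..n}. i \<noteq> j \<longrightarrow> k \<le> real (card (nbhd_edge T G \<delta> t i j))}"
      by (rule graphs(1))
  next
    fix G assume "G \<in> {G. \<forall>i\<in>{1..n}. \<forall>j\<in>{1..n}. i \<noteq> j \<longrightarrow> k \<le> real (card (nbhd_edge T G \<delta> t i j))}"
    then have card: "k \<le> real (card (nbhd_edge T G \<delta> t i j))" if "i \<in> {1..n}" "j \<in> {1..n}" "i \<noteq> j" for i j
      using that by blast
    have d': "real n \<le> d" unfolding d by (rule graphs(2))
    have "1 - 5 / real n ^ 10 \<le> measure_pmf.prob (outcomes_law n T L w G)
           {Y. (\<exists>!\<pi>. stationary_distribution n (P_hat n T L \<delta> d G Y t) \<pi>) \<and>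
               norm_inf n (\<lambda>i. the_stationary n (P_hat n T L \<delta> d G Y t) i - pi_star n w t i)
                 / norm_inf n (pi_star n w t)
               \<le> 8 * (8 * (14 * sqrt (ln (real n) / (real n * (real L * k))) + 2 * (M * (\<delta> / real T))) / q
              + b * (14 * sqrt (ln (real n) / (real n * (real L * k))) + 2 * (M * (\<delta> / real T))))}"
      unfolding b_def using n T L M t w smooth k Lk card d' small' q[unfolded b_def]
      by (rule conditional_error_bound)
    also have "\<dots> \<le> measure_pmf.prob (outcomes_law n T L w G) {Y. ?R G Y}"
      by (intro measure_pmf.finite_measure_mono Collect_mono impI conjI) (auto intro: order.trans[OF _ C])
    finally show "1 - 5 / real n ^ 10 \<le> measure_pmf.prob (outcomes_law n T L w G) {Y. ?R G Y}" .
  qed auto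
  moreover have "1 / real n ^ 10 \<le> real n powr (-9)"
  proof -
    have "1 / real n ^ 10 \<le> 1 / real n ^ 9" using n by (intro divide_left_mono power_increasing) auto
    also have "\<dots> = real n powr (-9)"
      using n powr_realpow[of "real n" 9] by (simp add: powr_minus divide_inverse)
    finally show ?thesis .
  qed
  ultimately show ?thesis by simp
qed

theorem corollary2:
  "\<exists>c1 c2 c3 C K :: real. c1 > 0 \<and> c2 > 0 \<and> c3 > 0 \<and> C > 0 \<and> K > 0 \<and>
    (\<forall>(n::nat) (T::nat) (L::nat) (M::real) (w :: real \<Rightarrow> nat \<Rightarrow> real) (p :: real \<Rightarrow> real) (t::real).
      n \<ge> 2 \<longrightarrow> T \<ge> 1 \<longrightarrow> L \<ge> 1 \<longrightarrow> M \<ge> 0 \<longrightarrow> t \<in> {0..1} \<longrightarrow>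
      (\<forall>s\<in>{0..1}. \<forall>i\<in>{1..n}. w s i > 0) \<longrightarrow>
      btl_smooth n M w \<longrightarrow>
      (\<forall>t'\<in>grid T. 0 \<le> p t' \<and> p t' \<le> 1) \<longrightarrow>
      (let pmin = Min (p ` grid T);
           bmax = cond_number_max n w;
           b = cond_number n w t;
           \<gamma> = gamma_fac n b;
           \<delta> = bandwidth n T L M b pmin;
           d = 3 * real n * p_union T p \<delta> t
       in
         pmin > 0 \<longrightarrow>
         bmax * sqrt (ln (real n) / real n) < 1 \<longrightarrow>
         real n \<ge> c1 * ln (real n) \<longrightarrow>
         \<delta> \<ge> c2 * (ln (real n) / pmin) \<longrightarrow>
         min (\<gamma> powr (2/3) * (M * ln (real n)) powr (1/3) /
                (2 powr (2/3) * real n * b powr (7/3) * (real L * pmin) powr (1/3)) *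
                (1 / real T powr (1/3)))
             M
           + sqrt (ln (real n) / real n) \<le> c3 * (1 / b powr (5/2)) \<longrightarrow>
         measure_pmf.prob (data_law n T L w p)
           {(G, Y).
              (\<exists>!\<pi>. stationary_distribution n (P_hat n T L \<delta> d G Y t) \<pi>) \<and>
              norm_inf n (\<lambda>i. the_stationary n (P_hat n T L \<delta> d G Y t) i - pi_star n w t i)
                / norm_inf n (pi_star n w t)
              \<le> C * (bmax / (1 - bmax * sqrt (ln (real n) / real n)) *
                  (\<gamma> * sqrt (ln (real n) / (real L * real n * pmin)) *
                     max ((2 * M) powr (1/3) * real n powr (1/2) * b powr (7/6) *
                            (real L * pmin) powr (1/6) /
                            (\<gamma> powr (1/3) * ln (real n) powr (1/6) * real T powr (1/3)))
                         (1 / sqrt (real T))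
                   + M * real n * b powr (7/2) *
                     (if M = 0 then 1
                      else min (\<gamma> powr (2/3) * ln (real n) powr (1/3) /
                             ((2 * M) powr (2/3) * real n * b powr (7/3) *
                              (real L * pmin) powr (1/3) * real T powr (1/3)))
                          1)))}
         \<ge> 1 - K * real n powr (-9)))"
\<comment> \<open>32768 = 8 * 4096 makes the number of outcomes per pair at least 4096 ln n, as
  \<open>overlap_cost\<close> demands; 1/250 is the level of \<open>small_noise_imp\<close> and
  43344 the constant of \<open>error_le\<close>. The final 6 adds 5 for the outcomes and 1 for the
  graphs.\<close>
proof (rule exI[of _ 1], rule exI[of _ 32768], rule exI[of _ "1 / 250"], rule exI[of _ 43344], rule exI[of _ 6],
    intro conjI allI impI, goal_cases)
  case (6 n T L M w p t)
  define pmin bmax b where "pmin = Min (p ` grid T)" and "bmax = cond_number_max n w" and "b = cond_number n w t"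
  define \<gamma> \<delta> where "\<gamma> = gamma_fac n b" and "\<delta> = bandwidth n T L M b pmin"
  define k where "k = pmin * \<delta> / 8"
  define q where "q = (if 4096 * b\<^sup>2 \<le> real L * k then 1 / (8 * b) else 1 / (16 * b\<^sup>2))"
  have w: "\<And>s i. s \<in> {0..1} \<Longrightarrow> i \<in> {1..n} \<Longrightarrow> w s i > 0" using 6 by blast
  have p: "\<And>t'. t' \<in> grid T \<Longrightarrow> 0 \<le> p t' \<and> p t' \<le> 1" using 6 by blast
  have b1: "1 \<le> b" using cond_number_ge[of 1 n 1 w t] 6(1) w[OF 6(5), of 1] by (simp add: b_def)
  have bmax: "b \<le> bmax"
    unfolding b_def bmax_def using 6 w by (intro cond_number_le_max) auto
  have pmin: "pmin \<le> p t'" if "t' \<in> grid T" for t'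
    unfolding pmin_def using that finite_grid by (intro Min_le) auto
  show ?case
    unfolding Let_def pmin_def[symmetric] bmax_def[symmetric] b_def[symmetric] \<gamma>_def[symmetric] \<delta>_def[symmetric]
  proof (intro impI, goal_cases)
    case hyps: 1
    note bw = bandwidth_props[OF 6(1-4) b1 hyps(1), folded \<gamma>_def \<delta>_def]
    have K: "4096 * ln (real n) \<le> real L * k"
    proof -
      have "4096 * ln (real n) \<le> k" using hyps(1,4) by (simp add: k_def divide_le_eq mult.commute)
      also have "k \<le> real L * k"
        using 6(3) hyps(1) bw(2) mult_right_mono[of 1 "real L" k] by (simp add: k_def)
      finally show ?thesis .
    qed
    note cost = overlap_cost[OF 6(1) b1 K, folded q_def \<gamma>_def]
    have q0: "q > 0" using b1 by (simp add: q_def)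
    have \<tau>0: "0 \<le> \<delta> / real T" using bw(2) by simp
    \<comment> \<open>Folding with \<open>bw(4)\<close> turns the minimum in the smallness
      hypothesis into \<open>M * (\<delta> / real T)\<close>; \<open>error_le\<close> supplies the
      bound by the target \<open>C\<close>.\<close>
    show ?case
      unfolding b_def using 6(1-5) w 6(7) p pmin hyps(1,4) bw(3) hyps(5)[folded bw(4), unfolded b_def] refl
        q_def[unfolded k_def b_def]
        error_le[OF 6(1,3,4) b1 bmax hyps(2,1) bw(2) \<tau>0 q0 cost bw(1,6,5), folded k_def, unfolded b_def k_def]
      by (rule prob_error_ge)
  qed
qed simp_all

end
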